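(* Let $\mathcal{G} \rightrightarrows M$ be a Lie groupoid over a connected base $M$, and let $\eta$ be a $0$-metric on $\mathcal{G}$. Suppose that $\eta$ induces a weak Riemannian metric on the diffeological orbit space $M/\mathcal{G}$. Then $\mathcal{G}$ is regular.
   Context: Diffeology. A diffeological space is a set $X$ with, for each open subset $U$ of each $\mathbb{R}^n$ ($n\ge 0$), a set of maps $U\to X$ called plots, such that constant maps are plots, plots are closed under precomposition with $C^\infty$ maps between open subsets of Euclidean spaces, and a map that is locally a plot is a plot. A map is smooth if it sends plots to plots by composition. A manifold is a diffeological space whose plots are the $C^\infty$ maps. A quotient $X/R$ has as plots the maps that locally lift to plots of $X$. The functor $T_2$. $T_2X$ is the quotient of $\coprod_{p:U\to X \text{ plot},\,U\subseteq\mathbb{R}^n} U\times\mathbb{R}^n\times\mathbb{R}^n$ by the equivalence relation generated by $(p;r,v,w)\sim(q;f(r),D_rf(v),D_rf(w))$ whenever $q\circ f=p$ with $f$ a $C^\infty$ map, with the quotient diffeology; write $T_2p(r,v,w)$ for the class. A smooth $h:X\to Y$ induces $T_2h(T_2p(r,v,w))=T_2(h\circ p)(r,v,w)$. For a manifold, $T_2M=TM\times_M TM$. (Equivalently, $T_2$ is the left Kan extension of $U\mapsto U\times\mathbb{R}^n\times\mathbb{R}^n$ along the inclusion of Euclidean open sets into diffeological spaces.) A weak Riemannian metric on $X$ is a smooth map $g:T_2X\to\mathbb{R}$ such that for each plot $p:U\to X$, $p^*g:=g\circ T_2p:T_2U\to\mathbb{R}$ is a symmetric and positive (i.e. positive semi-definite)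 covariant $2$-tensor on $U$. Lie groupoids. Manifolds are Hausdorff and second-countable. A Lie groupoid $\mathcal{G}\rightrightarrows M$ has base a manifold $M$ and arrow space $\mathcal{G}$ a not-necessarily Hausdorff nor second-countable manifold, smooth structure maps, source $s$ and target $t$ submersions, with Hausdorff source and target fibres. Orbits are $t(s^{-1}(x))$; the orbit space $M/\mathcal{G}$ has the quotient diffeology, with quotient map $\pi:M\to M/\mathcal{G}$. $\mathcal{G}$ is regular if its anchor $(t,s):\mathcal{G}\to M\times M$ has constant rank. $\mathcal{F}$ is the singular foliation of $M$ by connected components of orbits, $T_x\mathcal{F}\subseteq T_xM$ is the tangent space at $x$ of the leaf through $x$, $T\mathcal{F}=\bigcup_xT_x\mathcal{F}$, $N\mathcal{F}=TM/T\mathcal{F}$ (fibrewise quotient, with classes $[v]$), and $N_2\mathcal{F}=N\mathcal{F}\times_MN\mathcal{F}$. $\mathcal{G}$ acts on $N\mathcal{F}$ by $g\cdot[v]=[Tt(\xi)]$, where $\xi\in T_g\mathcal{G}$ satisfies $[Ts(\xi)]=[v]$, and acts diagonally on $N_2\mathcal{F}$. $0$-metric. For a Riemannian metric $\eta$ on $M$, define the (not necessarily smooth) map $\eta^N:N_2\mathcal{F}\to\mathbb{R}$ by $\eta^N([v],[w])=\eta(v^\perp,w^\perp)$, where $v^\perp$ is the orthogonal projection of $v\in T_xM$ to $(T_x\mathcal{F})^\perp$. $\eta$ is a $0$-metric on $\mathcal{G}$ if $\eta^N$ is $\mathcal{G}$-invariant. Induced metric. There is a unique map $\lambda:N_2\mathcal{F}\to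 T_2(M/\mathcal{G})$ with $\lambda([v],[w])=T_2\pi(v,w)$. A $0$-metric $\eta$ induces the weak Riemannian metric $\overline{\eta}$ on $M/\mathcal{G}$ if $\overline{\eta}\circ\lambda=\eta^N$. *)

theory Defs
  imports "HOL-Analysis.Analysis" "HOL-Library.Function_Algebras"
begin

text \<open>Pointwise real vector space structure on functions, so that the library's \<open>dim\<close> applies to
  subspaces of \<open>nat \<Rightarrow> real\<close> and to the tangent vectors below.\<close>

instantiation "fun" :: (type, real_vector) real_vector
begin

definition scaleR_fun :: "real \<Rightarrow> ('a \<Rightarrow> 'b) \<Rightarrow> 'a \<Rightarrow> 'b"
  where "scaleR_fun a f = (\<lambda>x. a *\<^sub>R f x)"

instance
  by standard (auto simp: scaleR_fun_def fun_eq_iff scaleR_add_right scaleR_add_left)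

end

section \<open>Smooth maps between open subsets of Euclidean spaces\<close>

text \<open>All dimensions occur at once in the definition of a diffeology, so \<open>\<real>\<^sup>n\<close> is the library's
  \<open>Euclidean_space n\<close>: the functions \<open>nat \<Rightarrow> real\<close> vanishing at all indices \<open>\<ge> n\<close>.\<close>

type_synonym vec = "nat \<Rightarrow> real"

abbreviation Rn :: "nat \<Rightarrow> vec set"
  where "Rn n \<equiv> topspace (Euclidean_space n)"

definition partial_deriv :: "nat \<Rightarrow> (vec \<Rightarrow> real) \<Rightarrow> vec \<Rightarrow> real"
  where "partial_deriv i f x = deriv (\<lambda>t. f (x(i := t))) (x i)"

fun Ck_on :: "nat \<Rightarrow> nat \<Rightarrow> vec set \<Rightarrow> (vec \<Rightarrow> real) \<Rightarrow> bool" where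
  "Ck_on 0 n U f \<longleftrightarrow> continuous_map (subtopology (Euclidean_space n) U) euclideanreal f"
| "Ck_on (Suc k) n U f \<longleftrightarrow>
     continuous_map (subtopology (Euclidean_space n) U) euclideanreal f \<and>
     (\<forall>i<n. (\<forall>x\<in>U. (\<lambda>t. f (x(i := t))) differentiable (at (x i))) \<and> Ck_on k n U (partial_deriv i f))"

text \<open>\<open>C\<^sup>\<infinity>\<close> functions on an open subset \<open>U\<close> of \<open>\<real>\<^sup>n\<close>. Values outside \<open>U\<close> are irrelevant.\<close>

definition smooth_on :: "nat \<Rightarrow> vec set \<Rightarrow> (vec \<Rightarrow> real) \<Rightarrow> bool"
  where "smooth_on n U f \<longleftrightarrow> openin (Euclidean_space n) U \<and> (\<forall>k. Ck_on k n U f)"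

definition smooth_maps :: "nat \<Rightarrow> vec set \<Rightarrow> nat \<Rightarrow> vec set \<Rightarrow> (vec \<Rightarrow> vec) set"
  where "smooth_maps n U m V =
    {f \<in> U \<rightarrow>\<^sub>E V. V \<subseteq> Rn m \<and> openin (Euclidean_space n) U \<and> (\<forall>j<m. smooth_on n U (\<lambda>x. f x j))}"

text \<open>\<open>D\<^sub>r f (v)\<close> for \<open>f\<close> defined near \<open>r \<in> \<real>\<^sup>n\<close>.\<close>

definition deriv_map :: "nat \<Rightarrow> (vec \<Rightarrow> vec) \<Rightarrow> vec \<Rightarrow> vec \<Rightarrow> vec"
  where "deriv_map n f r v = (\<lambda>j. \<Sum>i<n. partial_deriv i (\<lambda>x. f x j) r * v i)"

lemma Rn_upd: "x \<in> Rn n \<Longrightarrow> i < n \<Longrightarrow> x(i := t) \<in> Rn n"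
  by (auto simp: topspace_Euclidean_space)

lemma eventually_upd_in:
  assumes U: "openin (Euclidean_space n) U" and x: "x \<in> U" and i: "i < n"
  shows "\<forall>\<^sub>F t in nhds (x i). x(i := t) \<in> U"
proof -
  have xn: "x \<in> Rn n"
    using U x openin_subset by blast
  have "continuous_map euclideanreal (Euclidean_space n) (\<lambda>t. x(i := t))"
    unfolding Euclidean_space_def continuous_map_in_subtopology
  proof
    show "continuous_map euclideanreal (product_topology (\<lambda>i. euclideanreal) UNIV) (\<lambda>t. x(i := t))"
      unfolding continuous_map_componentwise_UNIV by auto
    show "(\<lambda>t. x(i := t)) \<in> topspace euclideanreal \<rightarrow> {x. \<forall>i\<ge>n. x i = 0}"
      using xn i by (auto simp: topspace_Euclidean_space)
  qed
  then have "openin euclideanreal {t \<in> topspace euclideanreal. x(i := t) \<in> U}"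
    using U by (rule openin_continuous_map_preimage)
  then have "open {t. x(i := t) \<in> U}"
    by simp
  then show ?thesis
    unfolding eventually_nhds using x by (intro exI[of _ "{t. x(i := t) \<in> U}"]) auto
qed

lemma Ck_on_cong_subset:
  assumes "openin (Euclidean_space n) V" "V \<subseteq> U" "\<And>x. x \<in> V \<Longrightarrow> f x = g x" "Ck_on k n U f"
  shows "Ck_on k n V g"
  using assms(3,4)
proof (induction k arbitrary: f g)
  case 0
  have "continuous_map (subtopology (Euclidean_space n) V) euclideanreal f"
    using 0 assms(2) continuous_map_from_subtopology_mono by auto
  then show ?case
    using 0(1) by (auto elim!: continuous_map_eq)
next
  case (Suc k)
  have "continuous_map (subtopology (Euclidean_space n) V) euclideanreal f"
    using Suc.prems(2) assms(2) continuous_map_from_subtopology_mono by auto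
  then have 1: "continuous_map (subtopology (Euclidean_space n) V) euclideanreal g"
    using Suc.prems(1) by (auto elim!: continuous_map_eq)
  have ev: "\<forall>\<^sub>F t in nhds (x i). f (x(i := t)) = g (x(i := t))" if "x \<in> V" "i < n" for x i
    using eventually_upd_in[OF assms(1) that] by eventually_elim (use Suc.prems(1) in auto)
  have 2: "(\<lambda>t. g (x(i := t))) differentiable (at (x i))" if "x \<in> V" "i < n" for x i
  proof -
    have "(\<lambda>t. f (x(i := t))) differentiable (at (x i))"
      using Suc.prems(2) that assms(2) by auto
    then obtain d where "((\<lambda>t. f (x(i := t))) has_real_derivative d) (at (x i))"
      by (auto simp: real_differentiable_def)
    then have "((\<lambda>t. g (x(i := t))) has_real_derivative d) (at (x i))"
      using DERIV_cong_ev[OF refl ev[OF that] refl] by blast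
    then show ?thesis
      by (auto simp: real_differentiable_def)
  qed
  have 3: "Ck_on k n V (partial_deriv i g)" if "i < n" for i
  proof (rule Suc.IH)
    show "Ck_on k n U (partial_deriv i f)"
      using Suc.prems(2) that by simp
    show "partial_deriv i f x = partial_deriv i g x" if "x \<in> V" for x
      unfolding partial_deriv_def by (intro deriv_cong_ev ev that \<open>i < n\<close> refl)
  qed
  show ?case
    using 1 2 3 by simp
qed

lemma smooth_on_continuous:
  "smooth_on n U f \<Longrightarrow> continuous_map (subtopology (Euclidean_space n) U) euclideanreal f"
  unfolding smooth_on_def using Ck_on.simps(1) by blast

lemma smooth_maps_continuous:
  assumes f: "f \<in> smooth_maps n U m V"
  shows "continuous_map (subtopology (Euclidean_space n) U) (Euclidean_space m) f"
proof -
  let ?X = "subtopology (Euclidean_space n) U"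
  have fR: "f x \<in> Rn m" if "x \<in> U" for x
    using f that unfolding smooth_maps_def by blast
  have "continuous_map ?X euclideanreal (\<lambda>x. f x j)" for j
  proof (cases "j < m")
    case True
    then show ?thesis
      using f by (auto simp: smooth_maps_def intro: smooth_on_continuous)
  next
    case False
    show ?thesis
      by (rule continuous_map_eq[where f = "\<lambda>x. 0"])
        (use fR False in \<open>auto simp: topspace_Euclidean_space\<close>)
  qed
  then show ?thesis
    unfolding Euclidean_space_def[of m] continuous_map_in_subtopology continuous_map_componentwise_UNIV
    using fR by (auto simp: topspace_Euclidean_space)
qed

lemma smooth_maps_restrict:
  assumes f: "f \<in> smooth_maps m V n U" and W: "W \<subseteq> U" "openin (Euclidean_space n) W"
  shows "openin (Euclidean_space m) {v \<in> V. f v \<in> W}"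
    and "restrict f {v \<in> V. f v \<in> W} \<in> smooth_maps m {v \<in> V. f v \<in> W} n W"
proof -
  let ?V = "{v \<in> V. f v \<in> W}"
  have V: "openin (Euclidean_space m) V"
    using f by (simp add: smooth_maps_def)
  have "openin (subtopology (Euclidean_space m) V)
      {v \<in> topspace (subtopology (Euclidean_space m) V). f v \<in> W}"
    by (rule openin_continuous_map_preimage[OF smooth_maps_continuous[OF f] W(2)])
  moreover have "topspace (subtopology (Euclidean_space m) V) = V"
    using openin_subset[OF V] by auto
  ultimately have "openin (subtopology (Euclidean_space m) V) ?V"
    by (simp only:)
  then show O: "openin (Euclidean_space m) ?V"
    using openin_open_subtopology[OF V] by blast
  have "smooth_on m ?V (\<lambda>x. restrict f ?V x j)" if "j < n" for j
  proof -
    have "Ck_on k m V (\<lambda>x. f x j)" for k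
      using f that by (auto simp: smooth_maps_def smooth_on_def)
    then have "Ck_on k m ?V (\<lambda>x. restrict f ?V x j)" for k
      by (rule Ck_on_cong_subset[OF O, rotated -1]) auto
    then show ?thesis
      using O by (simp add: smooth_on_def)
  qed
  then show "restrict f ?V \<in> smooth_maps m ?V n W"
    using O openin_subset[OF W(2)] by (auto simp: smooth_maps_def)
qed

section \<open>Diffeologies\<close>

text \<open>\<open>P n U\<close> is the set of plots \<open>U \<rightarrow> X\<close>, for \<open>U\<close> open in \<open>\<real>\<^sup>n\<close>; plots are extensional functions
  on \<open>U\<close>. As constant maps are plots, the underlying set is determined by \<open>P\<close>.\<close>

type_synonym 'a diffeology = "nat \<Rightarrow> vec set \<Rightarrow> (vec \<Rightarrow> 'a) set"

definition diffeology_on :: "'a set \<Rightarrow> 'a diffeology \<Rightarrow> bool"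
  where "diffeology_on X P \<longleftrightarrow>
    (\<forall>n U p. p \<in> P n U \<longrightarrow> openin (Euclidean_space n) U \<and> p \<in> U \<rightarrow>\<^sub>E X) \<and>
    (\<forall>n U x. openin (Euclidean_space n) U \<longrightarrow> x \<in> X \<longrightarrow> (\<lambda>u\<in>U. x) \<in> P n U) \<and>
    (\<forall>n U p m V f. p \<in> P n U \<longrightarrow> openin (Euclidean_space m) V \<longrightarrow> f \<in> smooth_maps m V n U \<longrightarrow>
       compose V p f \<in> P m V) \<and>
    (\<forall>n U p. openin (Euclidean_space n) U \<longrightarrow> p \<in> U \<rightarrow>\<^sub>E X \<longrightarrow>
       (\<forall>r\<in>U. \<exists>V\<subseteq>U. openin (Euclidean_space n) V \<and> r \<in> V \<and> restrict p V \<in> P n V) \<longrightarrow> p \<in> P n U)"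

definition dsmooth :: "'a diffeology \<Rightarrow> 'b diffeology \<Rightarrow> ('a \<Rightarrow> 'b) \<Rightarrow> bool"
  where "dsmooth P Q h \<longleftrightarrow> (\<forall>n U p. p \<in> P n U \<longrightarrow> compose U h p \<in> Q n U)"

definition real_diffeology :: "real diffeology"
  where "real_diffeology n U = {f \<in> extensional U. smooth_on n U f}"

definition subset_diffeology :: "'a diffeology \<Rightarrow> 'a set \<Rightarrow> 'a diffeology"
  where "subset_diffeology P A n U = {p \<in> P n U. p ` U \<subseteq> A}"

text \<open>The quotient diffeology along a map \<open>q\<close>, on the image of \<open>q\<close>.\<close>

definition quotient_diffeology :: "'a diffeology \<Rightarrow> ('a \<Rightarrow> 'b) \<Rightarrow> 'b diffeology"
  where "quotient_diffeology P q n U =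
    {p \<in> extensional U. openin (Euclidean_space n) U \<and>
       (\<forall>r\<in>U. \<exists>V\<subseteq>U. openin (Euclidean_space n) V \<and> r \<in> V \<and> (\<exists>l \<in> P n V. \<forall>u\<in>V. p u = q (l u)))}"

lemma diffeology_on_quotient:
  assumes "diffeology_on X P"
  shows "diffeology_on (q ` X) (quotient_diffeology P q)"
proof -
  note A = assms[unfolded diffeology_on_def]
  have D: "p \<in> U \<rightarrow>\<^sub>E X" if "p \<in> P n U" for n U p
    using conjunct1[OF A, rule_format, OF that] by (rule conjunct2)
  have C: "(\<lambda>u\<in>U. x) \<in> P n U" if "openin (Euclidean_space n) U" "x \<in> X" for n U x
    using conjunct1[OF conjunct2[OF A], rule_format, OF that] .
  have S: "compose V p f \<in> P m V"
    if "p \<in> P n U" "openin (Euclidean_space m) V" "f \<in> smooth_maps m V n U" for n U p m V f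
    using conjunct1[OF conjunct2[OF conjunct2[OF A]], rule_format, OF that] .
  show ?thesis
    unfolding diffeology_on_def
  proof (intro conjI allI impI)
    fix n U p
    assume p: "p \<in> quotient_diffeology P q n U"
    then show "openin (Euclidean_space n) U"
      by (simp add: quotient_diffeology_def)
    have "p u \<in> q ` X" if u: "u \<in> U" for u
    proof -
      obtain V l where "u \<in> V" "l \<in> P n V" "\<forall>u\<in>V. p u = q (l u)"
        using p u unfolding quotient_diffeology_def by blast
      moreover have "l u \<in> X"
        using D[OF \<open>l \<in> P n V\<close>] \<open>u \<in> V\<close> by (rule PiE_mem)
      ultimately show ?thesis
        by blast
    qed
    moreover have "p \<in> extensional U"
      using p by (simp add: quotient_diffeology_def)
    ultimately show "p \<in> U \<rightarrow>\<^sub>E q ` X"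
      by (simp add: PiE_def)
  next
    fix n U y
    assume U: "openin (Euclidean_space n) U" and "y \<in> q ` X"
    then obtain x where "x \<in> X" "y = q x"
      by blast
    then show "(\<lambda>u\<in>U. y) \<in> quotient_diffeology P q n U"
      using U C[OF U] unfolding quotient_diffeology_def
      by (auto intro!: exI[of _ U] bexI[of _ "\<lambda>u\<in>U. x"])
  next
    fix n U p m V f
    assume p: "p \<in> quotient_diffeology P q n U" and V: "openin (Euclidean_space m) V"
      and f: "f \<in> smooth_maps m V n U"
    have fU: "f v \<in> U" if "v \<in> V" for v
      using f that unfolding smooth_maps_def by blast
    have "\<exists>V'\<subseteq>V. openin (Euclidean_space m) V' \<and> r \<in> V' \<and>
        (\<exists>l\<in>P m V'. \<forall>u\<in>V'. compose V p f u = q (l u))" if r: "r \<in> V" for r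
    proof -
      obtain W l where W: "W \<subseteq> U" "openin (Euclidean_space n) W" "f r \<in> W" "l \<in> P n W"
          "\<forall>u\<in>W. p u = q (l u)"
        using p fU[OF r] unfolding quotient_diffeology_def by blast
      define V' where "V' = {v \<in> V. f v \<in> W}"
      have V': "openin (Euclidean_space m) V'" and f': "restrict f V' \<in> smooth_maps m V' n W"
        using smooth_maps_restrict[OF f W(1,2)] by (auto simp: V'_def)
      have "compose V' l (restrict f V') \<in> P m V'"
        using S[OF W(4) V' f'] .
      moreover have "compose V p f u = q (compose V' l (restrict f V') u)" if "u \<in> V'" for u
        using that W(5) by (auto simp: compose_def V'_def)
      ultimately show ?thesis
        using V' r W(3) by (intro exI[of _ V']) (auto simp: V'_def)
    qed
    then show "compose V p f \<in> quotient_diffeology P q m V"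
      using V by (auto simp: quotient_diffeology_def compose_def)
  next
    fix n U p
    assume U: "openin (Euclidean_space n) U" and p: "p \<in> U \<rightarrow>\<^sub>E q ` X"
      and loc: "\<forall>r\<in>U. \<exists>V\<subseteq>U. openin (Euclidean_space n) V \<and> r \<in> V \<and>
                 restrict p V \<in> quotient_diffeology P q n V"
    have "\<exists>V\<subseteq>U. openin (Euclidean_space n) V \<and> r \<in> V \<and> (\<exists>l\<in>P n V. \<forall>u\<in>V. p u = q (l u))"
      if r: "r \<in> U" for r
    proof -
      obtain V where V: "V \<subseteq> U" "r \<in> V" "restrict p V \<in> quotient_diffeology P q n V"
        using loc r by blast
      then obtain W l where W: "W \<subseteq> V" "openin (Euclidean_space n) W" "r \<in> W" "l \<in> P n W"
          "\<forall>u\<in>W. restrict p V u = q (l u)"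
        unfolding quotient_diffeology_def by blast
      have "\<forall>u\<in>W. p u = q (l u)"
        using W(1,5) by (metis restrict_apply' subsetD)
      moreover have "W \<subseteq> U"
        using W(1) V(1) by (rule subset_trans)
      ultimately show ?thesis
        using W(2-4) by (intro exI[of _ W]) auto
    qed
    then show "p \<in> quotient_diffeology P q n U"
      using U p by (auto simp: quotient_diffeology_def PiE_def)
  qed
qed

section \<open>The functor \<open>T\<^sub>2\<close> and weak Riemannian metrics\<close>

type_synonym 'a plot = "nat \<times> vec set \<times> (vec \<Rightarrow> 'a)"
type_synonym 'a T2_pre = "'a plot \<times> vec \<times> vec \<times> vec"

text \<open>The coproduct of \<open>U \<times> \<real>\<^sup>n \<times> \<real>\<^sup>n\<close> over all plots \<open>p : U \<rightarrow> X\<close>, and its coproduct diffeology: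
  a plot of it locally stays in one summand, where it is given by three smooth maps.\<close>

definition T2_total :: "'a diffeology \<Rightarrow> 'a T2_pre set"
  where "T2_total P = {((n, U, p), (r, v, w)) | n U p r v w.
    p \<in> P n U \<and> r \<in> U \<and> v \<in> Rn n \<and> w \<in> Rn n}"

definition T2_total_diffeology :: "'a diffeology \<Rightarrow> 'a T2_pre diffeology"
  where "T2_total_diffeology P n U =
    {c \<in> extensional U. openin (Euclidean_space n) U \<and>
       (\<forall>r\<in>U. \<exists>V\<subseteq>U. openin (Euclidean_space n) V \<and> r \<in> V \<and>
         (\<exists>m W p. p \<in> P m W \<and>
           (\<exists>a \<in> smooth_maps n V m W. \<exists>b \<in> smooth_maps n V m (Rn m). \<exists>d \<in> smooth_maps n V m (Rn m).
              \<forall>u\<in>V. c u = ((m, W, p), (a u, b u, d u)))))}"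

definition T2_gen :: "'a diffeology \<Rightarrow> ('a T2_pre \<times> 'a T2_pre) set"
  where "T2_gen P =
    {(((n, U, p), (r, v, w)), ((m, V, q), (f r, deriv_map n f r v, deriv_map n f r w)))
      | n U p r v w m V q f.
        p \<in> P n U \<and> r \<in> U \<and> v \<in> Rn n \<and> w \<in> Rn n \<and>
        q \<in> P m V \<and> f \<in> smooth_maps n U m V \<and> compose U q f = p}"

definition T2_rel :: "'a diffeology \<Rightarrow> ('a T2_pre \<times> 'a T2_pre) set"
  where "T2_rel P = Restr ((T2_gen P \<union> (T2_gen P)\<inverse>)\<^sup>*) (T2_total P)"

lemma equiv_T2_rel: "equiv (T2_total P) (T2_rel P)"
proof (rule equivI)
  let ?s = "T2_gen P \<union> (T2_gen P)\<inverse>"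
  have "sym (?s\<^sup>*)"
    by (intro sym_rtrancl sym_Un_converse)
  then show "sym (T2_rel P)"
    by (auto simp: T2_rel_def sym_def)
  show "trans (T2_rel P)"
    unfolding T2_rel_def by (auto simp: trans_def intro: rtrancl_trans)
qed (auto simp: T2_rel_def refl_on_def)

type_synonym 'a T2 = "'a T2_pre set"

text \<open>\<open>T2_class P (n, U, p) r v w\<close> is \<open>T\<^sub>2p(r,v,w)\<close>.\<close>

definition T2_class :: "'a diffeology \<Rightarrow> 'a plot \<Rightarrow> vec \<Rightarrow> vec \<Rightarrow> vec \<Rightarrow> 'a T2"
  where "T2_class P p r v w = T2_rel P `` {(p, (r, v, w))}"

definition T2_diffeology :: "'a diffeology \<Rightarrow> 'a T2 diffeology"
  where "T2_diffeology P = quotient_diffeology (T2_total_diffeology P) (\<lambda>a. T2_rel P `` {a})"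

definition bilinear_form_on :: "'v::real_vector set \<Rightarrow> ('v \<Rightarrow> 'v \<Rightarrow> real) \<Rightarrow> bool"
  where "bilinear_form_on S b \<longleftrightarrow>
    (\<forall>u\<in>S. \<forall>v\<in>S. \<forall>w\<in>S. b (u + v) w = b u w + b v w \<and> b w (u + v) = b w u + b w v) \<and>
    (\<forall>v\<in>S. \<forall>w\<in>S. \<forall>a. b (a *\<^sub>R v) w = a * b v w \<and> b v (a *\<^sub>R w) = a * b v w)"

definition symmetric_form_on :: "'v set \<Rightarrow> ('v \<Rightarrow> 'v \<Rightarrow> real) \<Rightarrow> bool"
  where "symmetric_form_on S b \<longleftrightarrow> (\<forall>v\<in>S. \<forall>w\<in>S. b v w = b w v)"

definition covariant_2_tensor :: "nat \<Rightarrow> vec set \<Rightarrow> (vec \<Rightarrow> vec \<Rightarrow> vec \<Rightarrow> real) \<Rightarrow> bool"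
  where "covariant_2_tensor n U b \<longleftrightarrow>
    (\<forall>r\<in>U. bilinear_form_on (Rn n) (b r)) \<and>
    (\<forall>v\<in>Rn n. \<forall>w\<in>Rn n. smooth_on n U (\<lambda>r. b r v w))"

text \<open>Here \<open>T\<^sub>2U = U \<times> \<real>\<^sup>n \<times> \<real>\<^sup>n\<close>, so that \<open>p\<^sup>*g (r,v,w) = g (T\<^sub>2p(r,v,w))\<close>.\<close>

definition weak_riemannian_metric :: "'a diffeology \<Rightarrow> ('a T2 \<Rightarrow> real) \<Rightarrow> bool"
  where "weak_riemannian_metric P g \<longleftrightarrow>
    dsmooth (T2_diffeology P) real_diffeology g \<and>
    (\<forall>n U p. p \<in> P n U \<longrightarrow>
      (let b = (\<lambda>r v w. g (T2_class P (n, U, p) r v w)) in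
        covariant_2_tensor n U b \<and>
        (\<forall>r\<in>U. symmetric_form_on (Rn n) (b r) \<and> (\<forall>v\<in>Rn n. 0 \<le> b r v v))))"

section \<open>Manifolds\<close>

text \<open>A topological space with a (not necessarily maximal) smooth atlas; a chart is its domain
  together with its coordinate map. All charts have the same dimension: this is automatic for
  connected manifolds, and for the arrow space of a Lie groupoid over a connected base (\<open>s\<close> is a
  submersion, the dimension is locally constant, it is constant along the units, and translations
  identify the fibre of \<open>s\<close> near any arrow with a neighbourhood of a unit in another fibre).\<close>

type_synonym 'a chart = "'a set \<times> ('a \<Rightarrow> vec)"

record 'a manifold =
  mtop :: "'a topology"
  mdim :: nat
  atlas :: "'a chart set"

abbreviation points :: "'a manifold \<Rightarrow> 'a set"
  where "points M \<equiv> topspace (mtop M)"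

definition transition :: "'a chart \<Rightarrow> 'b chart \<Rightarrow> ('a \<Rightarrow> 'b) \<Rightarrow> vec \<Rightarrow> vec"
  where "transition c d f = (\<lambda>u. snd d (f (inv_into (fst c) (snd c) u)))"

text \<open>No separation or countability axiom is included.\<close>

definition smooth_manifold :: "'a manifold \<Rightarrow> bool"
  where "smooth_manifold M \<longleftrightarrow>
    (\<forall>(W, \<phi>) \<in> atlas M. openin (mtop M) W \<and> openin (Euclidean_space (mdim M)) (\<phi> ` W) \<and>
       homeomorphic_map (subtopology (mtop M) W) (subtopology (Euclidean_space (mdim M)) (\<phi> ` W)) \<phi>) \<and>
    (\<Union>c\<in>atlas M. fst c) = points M \<and>
    (\<forall>c\<in>atlas M. \<forall>d\<in>atlas M. \<forall>j<mdim M.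
       smooth_on (mdim M) (snd c ` (fst c \<inter> fst d)) (\<lambda>u. transition c d id u j))"

text \<open>A manifold as a diffeological space: the plots are the \<open>C\<^sup>\<infinity>\<close> maps.\<close>

definition manifold_diffeology :: "'a manifold \<Rightarrow> 'a diffeology"
  where "manifold_diffeology M n U =
    {p \<in> U \<rightarrow>\<^sub>E points M. openin (Euclidean_space n) U \<and>
       continuous_map (subtopology (Euclidean_space n) U) (mtop M) p \<and>
       (\<forall>(W, \<phi>) \<in> atlas M. \<forall>j<mdim M. smooth_on n {u\<in>U. p u \<in> W} (\<lambda>u. \<phi> (p u) j))}"

definition charts_at :: "'a manifold \<Rightarrow> 'a \<Rightarrow> 'a chart set"
  where "charts_at M x = {c \<in> atlas M. x \<in> fst c}"

text \<open>A tangent vector at \<open>x\<close> is the family of its coordinate vectors in all charts around \<open>x\<close>,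
  related by the derivatives of the transition maps (and \<open>0\<close> at the other charts).\<close>

type_synonym 'a tvec = "'a chart \<Rightarrow> vec"

definition tangent_space :: "'a manifold \<Rightarrow> 'a \<Rightarrow> 'a tvec set"
  where "tangent_space M x = {v.
    (\<forall>c. c \<notin> charts_at M x \<longrightarrow> v c = 0) \<and>
    (\<forall>c\<in>charts_at M x. v c \<in> Rn (mdim M)) \<and>
    (\<forall>c\<in>charts_at M x. \<forall>d\<in>charts_at M x.
       v d = deriv_map (mdim M) (transition c d id) (snd c x) (v c))}"

text \<open>The tangent map \<open>T\<^sub>x f\<close> of a smooth map \<open>f : M \<rightarrow> N\<close>, computed in any chart at \<open>x\<close>.\<close>

definition tangent_map :: "'a manifold \<Rightarrow> 'b manifold \<Rightarrow> ('a \<Rightarrow> 'b) \<Rightarrow> 'a \<Rightarrow> 'a tvec \<Rightarrow> 'b tvec"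
  where "tangent_map M N f x v =
    (let c = (SOME c. c \<in> charts_at M x) in
     (\<lambda>d. if d \<in> charts_at N (f x) then deriv_map (mdim M) (transition c d f) (snd c x) (v c) else 0))"

text \<open>\<open>T\<^sub>r p (v)\<close> for a plot \<open>p\<close> of \<open>M\<close> defined near \<open>r \<in> \<real>\<^sup>n\<close> and \<open>v \<in> \<real>\<^sup>n\<close>.\<close>

definition plot_tangent :: "'a manifold \<Rightarrow> nat \<Rightarrow> (vec \<Rightarrow> 'a) \<Rightarrow> vec \<Rightarrow> vec \<Rightarrow> 'a tvec"
  where "plot_tangent M n p r v =
    (\<lambda>d. if d \<in> charts_at M (p r) then deriv_map n (\<lambda>u. snd d (p u)) r v else 0)"

definition riemannian_metric :: "'a manifold \<Rightarrow> ('a \<Rightarrow> 'a tvec \<Rightarrow> 'a tvec \<Rightarrow> real) \<Rightarrow> bool"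
  where "riemannian_metric M \<eta> \<longleftrightarrow>
    (\<forall>x\<in>points M. bilinear_form_on (tangent_space M x) (\<eta> x) \<and>
       symmetric_form_on (tangent_space M x) (\<eta> x) \<and>
       (\<forall>v\<in>tangent_space M x. v \<noteq> 0 \<longrightarrow> 0 < \<eta> x v v)) \<and>
    (\<forall>n U p. p \<in> manifold_diffeology M n U \<longrightarrow>
       covariant_2_tensor n U (\<lambda>r v w. \<eta> (p r) (plot_tangent M n p r v) (plot_tangent M n p r w)))"

section \<open>Lie groupoids\<close>

record ('g, 'm) groupoid =
  arrows :: "'g manifold"
  base :: "'m manifold"
  src :: "'g \<Rightarrow> 'm"
  tgt :: "'g \<Rightarrow> 'm"
  gunit :: "'m \<Rightarrow> 'g"
  ginv :: "'g \<Rightarrow> 'g"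
  gmult :: "'g \<Rightarrow> 'g \<Rightarrow> 'g"

definition src_fibre :: "('g, 'm) groupoid \<Rightarrow> 'm \<Rightarrow> 'g set"
  where "src_fibre G x = {g \<in> points (arrows G). src G g = x}"

definition tgt_fibre :: "('g, 'm) groupoid \<Rightarrow> 'm \<Rightarrow> 'g set"
  where "tgt_fibre G x = {g \<in> points (arrows G). tgt G g = x}"

abbreviation T_src :: "('g, 'm) groupoid \<Rightarrow> 'g \<Rightarrow> 'g tvec \<Rightarrow> 'm tvec"
  where "T_src G \<equiv> tangent_map (arrows G) (base G) (src G)"

abbreviation T_tgt :: "('g, 'm) groupoid \<Rightarrow> 'g \<Rightarrow> 'g tvec \<Rightarrow> 'm tvec"
  where "T_tgt G \<equiv> tangent_map (arrows G) (base G) (tgt G)"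

text \<open>\<open>gmult G g h\<close> is the composite \<open>gh\<close>, defined for \<open>src G g = tgt G h\<close>. Its smoothness is that of
  a map on the fibre product with the subset diffeology of the product.\<close>

locale lie_groupoid =
  fixes G :: "('g, 'm) groupoid"
  assumes arrows_manifold: "smooth_manifold (arrows G)"
    and base_manifold: "smooth_manifold (base G)"
    and base_Hausdorff: "Hausdorff_space (mtop (base G))"
    and base_second_countable: "second_countable (mtop (base G))"
    and src_fibre_Hausdorff:
      "x \<in> points (base G) \<Longrightarrow> Hausdorff_space (subtopology (mtop (arrows G)) (src_fibre G x))"
    and tgt_fibre_Hausdorff:
      "x \<in> points (base G) \<Longrightarrow> Hausdorff_space (subtopology (mtop (arrows G)) (tgt_fibre G x))"
    and src_smooth: "dsmooth (manifold_diffeology (arrows G)) (manifold_diffeology (base G)) (src G)"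
    and tgt_smooth: "dsmooth (manifold_diffeology (arrows G)) (manifold_diffeology (base G)) (tgt G)"
    and unit_smooth: "dsmooth (manifold_diffeology (base G)) (manifold_diffeology (arrows G)) (gunit G)"
    and inv_smooth: "dsmooth (manifold_diffeology (arrows G)) (manifold_diffeology (arrows G)) (ginv G)"
    and mult_smooth:
      "\<lbrakk>a \<in> manifold_diffeology (arrows G) n U; b \<in> manifold_diffeology (arrows G) n U;
        \<And>u. u \<in> U \<Longrightarrow> src G (a u) = tgt G (b u)\<rbrakk> \<Longrightarrow>
       (\<lambda>u\<in>U. gmult G (a u) (b u)) \<in> manifold_diffeology (arrows G) n U"
    and src_submersion:
      "g \<in> points (arrows G) \<Longrightarrow>
       T_src G g ` tangent_space (arrows G) g = tangent_space (base G) (src G g)"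
    and tgt_submersion:
      "g \<in> points (arrows G) \<Longrightarrow>
       T_tgt G g ` tangent_space (arrows G) g = tangent_space (base G) (tgt G g)"
    and src_in: "g \<in> points (arrows G) \<Longrightarrow> src G g \<in> points (base G)"
    and tgt_in: "g \<in> points (arrows G) \<Longrightarrow> tgt G g \<in> points (base G)"
    and unit_in: "x \<in> points (base G) \<Longrightarrow> gunit G x \<in> points (arrows G)"
    and src_unit: "x \<in> points (base G) \<Longrightarrow> src G (gunit G x) = x"
    and tgt_unit: "x \<in> points (base G) \<Longrightarrow> tgt G (gunit G x) = x"
    and mult_in:
      "\<lbrakk>g \<in> points (arrows G); h \<in> points (arrows G); src G g = tgt G h\<rbrakk> \<Longrightarrow>
       gmult G g h \<in> points (arrows G)"
    and src_mult:
      "\<lbrakk>g \<in> points (arrows G); h \<in> points (arrows G); src G g = tgt G h\<rbrakk> \<Longrightarrow>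
       src G (gmult G g h) = src G h"
    and tgt_mult:
      "\<lbrakk>g \<in> points (arrows G); h \<in> points (arrows G); src G g = tgt G h\<rbrakk> \<Longrightarrow>
       tgt G (gmult G g h) = tgt G g"
    and mult_assoc:
      "\<lbrakk>g \<in> points (arrows G); h \<in> points (arrows G); k \<in> points (arrows G);
        src G g = tgt G h; src G h = tgt G k\<rbrakk> \<Longrightarrow>
       gmult G (gmult G g h) k = gmult G g (gmult G h k)"
    and mult_unit_left: "g \<in> points (arrows G) \<Longrightarrow> gmult G (gunit G (tgt G g)) g = g"
    and mult_unit_right: "g \<in> points (arrows G) \<Longrightarrow> gmult G g (gunit G (src G g)) = g"
    and inv_in: "g \<in> points (arrows G) \<Longrightarrow> ginv G g \<in> points (arrows G)"
    and src_inv: "g \<in> points (arrows G) \<Longrightarrow> src G (ginv G g) = tgt G g"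
    and tgt_inv: "g \<in> points (arrows G) \<Longrightarrow> tgt G (ginv G g) = src G g"
    and mult_inv_left: "g \<in> points (arrows G) \<Longrightarrow> gmult G (ginv G g) g = gunit G (src G g)"
    and mult_inv_right: "g \<in> points (arrows G) \<Longrightarrow> gmult G g (ginv G g) = gunit G (tgt G g)"

text \<open>The rank of \<open>T\<^sub>g(t,s)\<close>, as a map to \<open>T(M \<times> M) = TM \<times> TM\<close>.\<close>

definition anchor_rank :: "('g, 'm) groupoid \<Rightarrow> 'g \<Rightarrow> nat"
  where "anchor_rank G g = dim ((\<lambda>\<xi>. (T_tgt G g \<xi>, T_src G g \<xi>)) ` tangent_space (arrows G) g)"

definition regular_groupoid :: "('g, 'm) groupoid \<Rightarrow> bool"
  where "regular_groupoid G \<longleftrightarrow> (\<exists>k. \<forall>g\<in>points (arrows G). anchor_rank G g = k)"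

section \<open>The orbit space and the orbit foliation\<close>

definition orbit :: "('g, 'm) groupoid \<Rightarrow> 'm \<Rightarrow> 'm set"
  where "orbit G x = tgt G ` src_fibre G x"

text \<open>The orbit space consists of the orbits, and \<open>\<pi> = orbit G\<close>.\<close>

definition orbit_space_diffeology :: "('g, 'm) groupoid \<Rightarrow> 'm set diffeology"
  where "orbit_space_diffeology G = quotient_diffeology (manifold_diffeology (base G)) (orbit G)"

definition quotient_topology :: "'a topology \<Rightarrow> ('a \<Rightarrow> 'b) \<Rightarrow> 'b topology"
  where "quotient_topology X f =
    topology (\<lambda>V. V \<subseteq> f ` topspace X \<and> openin X {x \<in> topspace X. f x \<in> V})"

lemma openin_quotient_topology:
  "openin (quotient_topology X f) V \<longleftrightarrow>
     V \<subseteq> f ` topspace X \<and> openin X {x \<in> topspace X. f x \<in> V}"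
proof -
  have "istopology (\<lambda>V. V \<subseteq> f ` topspace X \<and> openin X {x \<in> topspace X. f x \<in> V})"
    unfolding istopology_def
  proof (intro conjI allI impI)
    fix S T
    assume "S \<subseteq> f ` topspace X \<and> openin X {x \<in> topspace X. f x \<in> S}"
      and "T \<subseteq> f ` topspace X \<and> openin X {x \<in> topspace X. f x \<in> T}"
    moreover have "{x \<in> topspace X. f x \<in> S \<inter> T} =
        {x \<in> topspace X. f x \<in> S} \<inter> {x \<in> topspace X. f x \<in> T}"
      by blast
    ultimately show "S \<inter> T \<subseteq> f ` topspace X" "openin X {x \<in> topspace X. f x \<in> S \<inter> T}"
      by auto
  next
    fix \<K>
    assume *: "\<forall>K\<in>\<K>. K \<subseteq> f ` topspace X \<and> openin X {x \<in> topspace X. f x \<in> K}"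
    then show "\<Union>\<K> \<subseteq> f ` topspace X"
      by blast
    have "{x \<in> topspace X. f x \<in> \<Union>\<K>} = (\<Union>K\<in>\<K>. {x \<in> topspace X. f x \<in> K})"
      by blast
    then show "openin X {x \<in> topspace X. f x \<in> \<Union>\<K>}"
      using * by auto
  qed
  then show ?thesis
    by (simp add: quotient_topology_def)
qed

text \<open>The orbit through \<open>x\<close> is an immersed submanifold of the base. Its manifold structure is the
  quotient of the source fibre at \<open>x\<close> along the target map; its topology is in general finer than
  the one induced from the base. The leaf through \<open>x\<close> is a connected component for that topology.\<close>

definition orbit_topology :: "('g, 'm) groupoid \<Rightarrow> 'm \<Rightarrow> 'm topology"
  where "orbit_topology G x =
    quotient_topology (subtopology (mtop (arrows G)) (src_fibre G x)) (tgt G)"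

definition orbit_diffeology :: "('g, 'm) groupoid \<Rightarrow> 'm \<Rightarrow> 'm diffeology"
  where "orbit_diffeology G x =
    quotient_diffeology (subset_diffeology (manifold_diffeology (arrows G)) (src_fibre G x)) (tgt G)"

definition leaf :: "('g, 'm) groupoid \<Rightarrow> 'm \<Rightarrow> 'm set"
  where "leaf G x = connected_component_of_set (orbit_topology G x) x"

text \<open>\<open>T\<^sub>x\<F>\<close>: the velocities at \<open>x\<close> of the smooth curves in the leaf through \<open>x\<close>.\<close>

definition TF :: "('g, 'm) groupoid \<Rightarrow> 'm \<Rightarrow> 'm tvec set"
  where "TF G x =
    {plot_tangent (base G) 1 c 0 (\<lambda>i. if i = 0 then 1 else 0) | c I.
       c \<in> subset_diffeology (orbit_diffeology G x) (leaf G x) 1 I \<and> 0 \<in> I \<and> c 0 = x}"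

text \<open>The class \<open>[v] \<in> N\<^sub>x\<F> = T\<^sub>xM / T\<^sub>x\<F>\<close>, as a coset, and \<open>N\<^sub>2\<F>\<close>, whose elements carry their base point.\<close>

definition normal_class :: "('g, 'm) groupoid \<Rightarrow> 'm \<Rightarrow> 'm tvec \<Rightarrow> 'm tvec set"
  where "normal_class G x v = {u \<in> tangent_space (base G) x. u - v \<in> TF G x}"

definition normal_space :: "('g, 'm) groupoid \<Rightarrow> 'm \<Rightarrow> 'm tvec set set"
  where "normal_space G x = normal_class G x ` tangent_space (base G) x"

type_synonym 'm N2 = "'m \<times> 'm tvec set \<times> 'm tvec set"

definition N2F :: "('g, 'm) groupoid \<Rightarrow> 'm N2 set"
  where "N2F G = (SIGMA x : points (base G). normal_space G x \<times> normal_space G x)"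

definition normal_act :: "('g, 'm) groupoid \<Rightarrow> 'g \<Rightarrow> 'm tvec set \<Rightarrow> 'm tvec set"
  where "normal_act G g C =
    normal_class G (tgt G g) (T_tgt G g
      (SOME \<xi>. \<xi> \<in> tangent_space (arrows G) g \<and> normal_class G (src G g) (T_src G g \<xi>) = C))"

section \<open>\<open>0\<close>-metrics and the induced metric\<close>

text \<open>\<open>perp G \<eta> x v\<close> is \<open>v\<^sup>\<bottom>\<close>, the \<open>\<eta>\<close>-orthogonal projection of \<open>v\<close> to the orthogonal complement of \<open>T\<^sub>x\<F>\<close>.\<close>

definition perp :: "('g, 'm) groupoid \<Rightarrow> ('m \<Rightarrow> 'm tvec \<Rightarrow> 'm tvec \<Rightarrow> real) \<Rightarrow> 'm \<Rightarrow> 'm tvec \<Rightarrow> 'm tvec"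
  where "perp G \<eta> x v =
    (THE u. u \<in> tangent_space (base G) x \<and> (\<forall>a\<in>TF G x. \<eta> x u a = 0) \<and> v - u \<in> TF G x)"

text \<open>\<open>\<eta>\<^sup>N\<close>; as \<open>v\<^sup>\<bottom>\<close> only depends on \<open>[v]\<close>, the choice of representatives does not matter.\<close>

definition eta_N :: "('g, 'm) groupoid \<Rightarrow> ('m \<Rightarrow> 'm tvec \<Rightarrow> 'm tvec \<Rightarrow> real) \<Rightarrow> 'm N2 \<Rightarrow> real"
  where "eta_N G \<eta> = (\<lambda>(x, C, D).
    \<eta> x (perp G \<eta> x (SOME v. v \<in> C)) (perp G \<eta> x (SOME w. w \<in> D)))"

definition zero_metric :: "('g, 'm) groupoid \<Rightarrow> ('m \<Rightarrow> 'm tvec \<Rightarrow> 'm tvec \<Rightarrow> real) \<Rightarrow> bool"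
  where "zero_metric G \<eta> \<longleftrightarrow> riemannian_metric (base G) \<eta> \<and>
    (\<forall>g\<in>points (arrows G). \<forall>C\<in>normal_space G (src G g). \<forall>D\<in>normal_space G (src G g).
       eta_N G \<eta> (tgt G g, normal_act G g C, normal_act G g D) = eta_N G \<eta> (src G g, C, D))"

text \<open>The map \<open>\<lambda> : N\<^sub>2\<F> \<rightarrow> T\<^sub>2(M/G)\<close> with \<open>\<lambda>([v],[w]) = T\<^sub>2\<pi>(v,w)\<close>. Under \<open>T\<^sub>2M = TM \<times>\<^sub>M TM\<close>, the class
  \<open>T\<^sub>2p(r,v,w)\<close> of a plot \<open>p\<close> of \<open>M\<close> is the pair \<open>(T\<^sub>rp(v), T\<^sub>rp(w))\<close>, and \<open>T\<^sub>2\<pi>\<close> sends it to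
  \<open>T\<^sub>2(\<pi> \<circ> p)(r,v,w)\<close>. Every element of \<open>N\<^sub>2\<F>\<close> arises in this way, so that \<open>\<lambda>\<close> is unique on \<open>N\<^sub>2\<F>\<close>.\<close>

definition is_lambda :: "('g, 'm) groupoid \<Rightarrow> ('m N2 \<Rightarrow> 'm set T2) \<Rightarrow> bool"
  where "is_lambda G l \<longleftrightarrow>
    (\<forall>n U p. p \<in> manifold_diffeology (base G) n U \<longrightarrow>
      (\<forall>r\<in>U. \<forall>v\<in>Rn n. \<forall>w\<in>Rn n.
        l (p r, normal_class G (p r) (plot_tangent (base G) n p r v),
                normal_class G (p r) (plot_tangent (base G) n p r w)) =
        T2_class (orbit_space_diffeology G) (n, U, compose U (orbit G) p) r v w))"

definition induces ::
  "('g, 'm) groupoid \<Rightarrow> ('m \<Rightarrow> 'm tvec \<Rightarrow> 'm tvec \<Rightarrow> real) \<Rightarrow> ('m set T2 \<Rightarrow> real) \<Rightarrow> bool"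
  where "induces G \<eta> g \<longleftrightarrow>
    weak_riemannian_metric (orbit_space_diffeology G) g \<and>
    (\<exists>l. is_lambda G l \<and> (\<forall>X\<in>N2F G. g (l X) = eta_N G \<eta> X))"

end

theory Submission
  imports Defs
begin

text \<open>The anchor has rank \<open>dim M + dim T\<^sub>x\<F>\<close> at an arrow with target \<open>x\<close>, so that the claim is that
  \<open>dim T\<^sub>x\<F>\<close> is constant. In a chart of \<open>M\<close>, \<open>\<eta>\<^sup>N\<close> is the pullback of the induced metric along a plot
  of \<open>M/\<G>\<close>, hence a continuous tensor. It is positive semi-definite with kernel \<open>T\<F>\<close>, and so is
  \<open>\<eta> - \<eta>\<^sup>N\<close> with kernel \<open>T\<F>\<^sup>\<bottom>\<close>. Ranks of continuous semi-definite forms are lower semicontinuous and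
  these two add up to \<open>dim M\<close>, so \<open>dim T\<F>\<close> is locally constant, and \<open>M\<close> is connected.

  To identify \<open>T\<^sub>x\<F>\<close> with the image under \<open>Tt\<close> of the kernel of \<open>Ts\<close> at any arrow with target \<open>x\<close>, curves in
  one source fibre are right translated to another, and the kernel of \<open>Ts\<close> is realised by curves in
  the source fibre through an implicit function theorem, proved by eliminating one variable at a time
  because the dimension is not a type here.\<close>

section \<open>Calculus on open subsets of \<open>\<real>\<^sup>n\<close>\<close>

text \<open>\<open>TF\<close> collects velocities of curves in a leaf, and the leaf topology is a
  quotient of a source fibre. From this description it is not visible that \<open>TF G x\<close> is
  closed under addition; its identification with a linear image of a kernel is what makes it a
  subspace. That identification is available at every arrow ending at \<open>x\<close>, so the rank
  of the anchor depends on the target alone.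

  Two semi-definite forms are used because each controls \<open>TF\<close> from one side only. The
  pulled back metric is definite on a complement of \<open>TF\<close> and stays so nearby, which
  keeps \<open>dim (TF G x)\<close> from growing. The difference of the two metrics is definite on
  \<open>TF\<close> itself, which keeps the dimension from dropping.

  Smoothness is given by iterated partial derivatives along coordinate lines, so the chain rule has
  to pass through an estimate of Frechet type, obtained by changing one coordinate at a
  time.\<close>

lemma Euclidean_space_eq: "Euclidean_space n = top_of_set (Rn n)"
  by (simp add: Euclidean_space_def topspace_Euclidean_space euclidean_product_topology)

lemma openin_Euclidean_space_iff: "openin (Euclidean_space n) U \<longleftrightarrow> openin (top_of_set (Rn n)) U"
  using Euclidean_space_eq by simp

lemma Rn_iff: "x \<in> Rn n \<longleftrightarrow> (\<forall>i\<ge>n. x i = 0)"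
  by (simp add: topspace_Euclidean_space)

lemma continuous_map_Euclidean_iff:
  "U \<subseteq> Rn n \<Longrightarrow> continuous_map (subtopology (Euclidean_space n) U) euclideanreal f \<longleftrightarrow> continuous_on U f"
  using arg_cong[OF Euclidean_space_eq[of n], of "\<lambda>X. continuous_map (subtopology X U) euclideanreal f"]
  by (simp add: subtopology_subtopology Int_absorb1)

lemma openin_subset_Rn: "openin (Euclidean_space n) U \<Longrightarrow> U \<subseteq> Rn n"
  by (rule openin_subset)

text \<open>Sup-norm balls serve as neighbourhoods: moving a single coordinate towards the centre
  stays inside, which is what the one-variable arguments need.\<close>

definition cube :: "nat \<Rightarrow> vec \<Rightarrow> real \<Rightarrow> vec set"
  where "cube n a e = {y \<in> Rn n. \<forall>j<n. \<bar>y j - a j\<bar> < e}"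

lemma openin_cube: "openin (Euclidean_space n) (cube n a e)"
proof -
  have "open (\<Inter>j<n. {y::vec. \<bar>y j - a j\<bar> < e})"
    by (intro open_INT ballI open_Collect_less continuous_on_rabs continuous_on_diff continuous_on_const
        continuous_on_product_coordinates finite_lessThan)
  moreover have "cube n a e = Rn n \<inter> (\<Inter>j<n. {y. \<bar>y j - a j\<bar> < e})"
    by (auto simp: cube_def)
  ultimately show ?thesis
    unfolding openin_Euclidean_space_iff openin_open by blast
qed

lemma cube_self: "a \<in> Rn n \<Longrightarrow> e > 0 \<Longrightarrow> a \<in> cube n a e"
  by (simp add: cube_def)

lemma cube_mono: "d \<le> e \<Longrightarrow> cube n a d \<subseteq> cube n a e"
  by (force simp: cube_def)

text \<open>A basic open set of the product topology restricts the coordinates one by one. On R^n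
  the coordinates from \<open>n\<close> on vanish, like those of \<open>a\<close>, so only the first
  \<open>n\<close> matter and the minimum of finitely many radii is positive.\<close>

lemma cube_inside:
  assumes "openin (Euclidean_space n) U" "a \<in> U"
  obtains e where "e > 0" "cube n a e \<subseteq> U"
proof -
  obtain T where T: "open T" "U = Rn n \<inter> T"
    using assms(1) unfolding openin_Euclidean_space_iff openin_open by blast
  have "openin (product_topology (\<lambda>i. euclidean) UNIV) T"
    using T(1) by (simp add: open_fun_def)
  then obtain X where X: "a \<in> PiE UNIV X" "\<And>i. openin euclideanreal (X i)" "PiE UNIV X \<subseteq> T"
    using product_topology_open_contains_basis[of "\<lambda>i. euclidean" UNIV T a] assms(2) T(2) by auto
  have "\<exists>e>0. \<forall>i<k. \<forall>y. \<bar>y - a i\<bar> < e \<longrightarrow> y \<in> X i" for k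
  proof (induction k)
    case (Suc k)
    then obtain e where e: "e > 0" "\<forall>i<k. \<forall>y. \<bar>y - a i\<bar> < e \<longrightarrow> y \<in> X i"
      by blast
    have "open (X k)" "a k \<in> X k"
      using X by (auto simp: PiE_def)
    then obtain e' where e': "e' > 0" "\<forall>y. dist y (a k) < e' \<longrightarrow> y \<in> X k"
      by (auto simp: open_dist)
    show ?case
      using e e' by (intro exI[of _ "min e e'"]) (auto simp: less_Suc_eq dist_real_def)
  qed (auto intro: exI[of _ 1])
  then obtain e where e: "e > 0" "\<forall>i<n. \<forall>y. \<bar>y - a i\<bar> < e \<longrightarrow> y \<in> X i"
    by blast
  have "cube n a e \<subseteq> U"
  proof
    fix y
    assume y: "y \<in> cube n a e"
    have "y i \<in> X i" for i
    proof (cases "i < n")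
      case False
      then have "y i = a i"
        using y T(2) assms(2) by (simp add: cube_def Rn_iff)
      then show ?thesis
        using X(1) by (auto simp: PiE_def)
    qed (use e y in \<open>auto simp: cube_def\<close>)
    then show "y \<in> U"
      using X(3) y T(2) by (auto simp: cube_def)
  qed
  then show thesis
    using e(1) that by blast
qed

lemma continuous_cube:
  assumes U: "openin (Euclidean_space n) U" and a: "a \<in> U" and g: "continuous_on U g"
      and e: "e > (0::real)"
  obtains d where "d > 0" "cube n a d \<subseteq> U" "\<And>y. y \<in> cube n a d \<Longrightarrow> \<bar>g y - g a\<bar> < e"
proof -
  have "openin (top_of_set U) (U \<inter> g -` {g a - e <..< g a + e})"
    using g by (rule continuous_openin_preimage_gen) auto
  then have "openin (Euclidean_space n) (U \<inter> g -` {g a - e <..< g a + e})"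
    using U unfolding openin_Euclidean_space_iff by (meson openin_trans)
  then obtain d where "d > 0" "cube n a d \<subseteq> U \<inter> g -` {g a - e <..< g a + e}"
    using cube_inside[of n "U \<inter> g -` {g a - e <..< g a + e}" a] a e by auto
  then show thesis
    by (intro that[of d]) (auto simp: abs_less_iff subset_iff algebra_simps)
qed

section \<open>Functions of class C^k and their closure properties\<close>

lemma Ck_continuous:
  "Ck_on k n U f \<Longrightarrow> continuous_map (subtopology (Euclidean_space n) U) euclideanreal f"
  by (cases k) auto

lemma Ck_mono: "Ck_on (Suc k) n U f \<Longrightarrow> Ck_on k n U f"
  by (induction k arbitrary: f) auto

lemma continuous_on_Ck:
  assumes "openin (Euclidean_space n) U" "Ck_on k n U f"
  shows "continuous_on U f"
  using assms Ck_continuous continuous_map_Euclidean_iff openin_subset_Rn by blast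

lemma Ck_has_pd:
  assumes "Ck_on (Suc k) n U f" "x \<in> U" "i < n"
  shows "((\<lambda>t. f (x(i := t))) has_real_derivative partial_deriv i f x) (at (x i))"
  using assms by (simp add: partial_deriv_def DERIV_deriv_iff_real_differentiable)

lemma Ck_pd: "Ck_on (Suc k) n U f \<Longrightarrow> i < n \<Longrightarrow> Ck_on k n U (partial_deriv i f)"
  by simp

lemma Ck_cong:
  assumes "openin (Euclidean_space n) U" "\<And>x. x \<in> U \<Longrightarrow> f x = g x"
  shows "Ck_on k n U f \<longleftrightarrow> Ck_on k n U g"
  using Ck_on_cong_subset[OF assms(1) subset_refl, of f g k]
    Ck_on_cong_subset[OF assms(1) subset_refl, of g f k] assms(2) by metis

text \<open>The closure proofs know the partial derivatives as explicit formulas \<open>g i\<close>.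
  These have to be identified with \<open>partial_deriv i f\<close> on \<open>U\<close> before an
  induction on \<open>k\<close> can go on.\<close>

lemma Ck_SucI:
  assumes U: "openin (Euclidean_space n) U" and c: "continuous_on U f"
    and d: "\<And>i x. i < n \<Longrightarrow> x \<in> U \<Longrightarrow> ((\<lambda>t. f (x(i := t))) has_real_derivative g i x) (at (x i))"
    and k: "\<And>i. i < n \<Longrightarrow> Ck_on k n U (g i)"
  shows "Ck_on (Suc k) n U f"
proof -
  have "continuous_map (subtopology (Euclidean_space n) U) euclideanreal f"
    using c continuous_map_Euclidean_iff[OF openin_subset_Rn[OF U]] by simp
  moreover have "(\<lambda>t. f (x(i := t))) differentiable at (x i)" if "i < n" "x \<in> U" for i x
    using d[OF that] by (auto simp: real_differentiable_def)
  moreover have "Ck_on k n U (partial_deriv i f)" if "i < n" for i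
    using Ck_cong[OF U, of "g i" "partial_deriv i f" k] k[OF that] DERIV_imp_deriv[OF d[OF that]]
    by (simp add: partial_deriv_def)
  ultimately show ?thesis
    by simp
qed

lemma Ck_const:
  assumes "openin (Euclidean_space n) U"
  shows "Ck_on k n U (\<lambda>x. c)"
proof (induction k arbitrary: c)
  case (Suc k)
  show ?case
    by (rule Ck_SucI[OF assms, where g = "\<lambda>i x. 0"]) (use Suc in auto)
qed auto

lemma Ck_coord:
  assumes U: "openin (Euclidean_space n) U"
  shows "Ck_on k n U (\<lambda>x. x j)"
proof (cases k)
  case 0
  show ?thesis
    using continuous_map_Euclidean_iff[OF openin_subset_Rn[OF U]] 0
    by (simp add: continuous_on_subset[OF continuous_on_product_coordinates])
next
  case (Suc k')
  show ?thesis
    unfolding Suc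
    by (rule Ck_SucI[OF assms, where g = "\<lambda>i x. if i = j then 1 else 0"])
      (auto intro!: Ck_const U continuous_on_subset[OF continuous_on_product_coordinates])
qed

lemma Ck_add:
  assumes U: "openin (Euclidean_space n) U"
  shows "Ck_on k n U f \<Longrightarrow> Ck_on k n U g \<Longrightarrow> Ck_on k n U (\<lambda>x. f x + g x)"
proof (induction k arbitrary: f g)
  case (Suc k)
  show ?case
  proof (rule Ck_SucI[OF U, where g = "\<lambda>i x. partial_deriv i f x + partial_deriv i g x"])
    show "continuous_on U (\<lambda>x. f x + g x)"
      using Suc.prems by (intro continuous_intros continuous_on_Ck[OF U, of "Suc k"])
    fix i assume i: "i < n"
    show "Ck_on k n U (\<lambda>x. partial_deriv i f x + partial_deriv i g x)"
      by (intro Suc.IH Ck_pd[OF _ i] Suc.prems)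
    fix x assume x: "x \<in> U"
    show "((\<lambda>t. f (x(i := t)) + g (x(i := t)))
        has_real_derivative partial_deriv i f x + partial_deriv i g x) (at (x i))"
      by (intro DERIV_add Ck_has_pd[OF Suc.prems(1) x i] Ck_has_pd[OF Suc.prems(2) x i])
  qed
qed (auto intro: continuous_intros)

lemma Ck_mult:
  assumes U: "openin (Euclidean_space n) U"
  shows "Ck_on k n U f \<Longrightarrow> Ck_on k n U g \<Longrightarrow> Ck_on k n U (\<lambda>x. f x * g x)"
proof (induction k arbitrary: f g)
  case (Suc k)
  show ?case
  proof (rule Ck_SucI[OF U, where g = "\<lambda>i x. partial_deriv i f x * g x + f x * partial_deriv i g x"])
    show "continuous_on U (\<lambda>x. f x * g x)"
      using Suc.prems by (intro continuous_intros continuous_on_Ck[OF U, of "Suc k"])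
    fix i assume i: "i < n"
    show "Ck_on k n U (\<lambda>x. partial_deriv i f x * g x + f x * partial_deriv i g x)"
      by (intro Ck_add[OF U] Suc.IH Ck_pd[OF _ i] Suc.prems Ck_mono[OF Suc.prems(1)]
          Ck_mono[OF Suc.prems(2)])
    fix x assume x: "x \<in> U"
    show "((\<lambda>t. f (x(i := t)) * g (x(i := t)))
        has_real_derivative partial_deriv i f x * g x + f x * partial_deriv i g x) (at (x i))"
      using DERIV_mult[OF Ck_has_pd[OF Suc.prems(1) x i] Ck_has_pd[OF Suc.prems(2) x i]]
      by (simp add: mult_ac add_ac fun_upd_def)
  qed
qed (auto intro: continuous_intros)

lemma Ck_sum:
  assumes U: "openin (Euclidean_space n) U"
  shows "finite A \<Longrightarrow> (\<And>a. a \<in> A \<Longrightarrow> Ck_on k n U (f a)) \<Longrightarrow> Ck_on k n U (\<lambda>x. \<Sum>a\<in>A. f a x)"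
  by (induction A rule: finite_induct) (auto intro: Ck_const[OF U] Ck_add[OF U])

lemma Ck_uminus:
  assumes U: "openin (Euclidean_space n) U" and f: "Ck_on k n U f"
  shows "Ck_on k n U (\<lambda>x. - f x)"
  using Ck_mult[OF U Ck_const[OF U, of k "-1"] f] by simp

lemma Ck_inverse:
  assumes U: "openin (Euclidean_space n) U"
  shows "Ck_on k n U f \<Longrightarrow> (\<And>x. x \<in> U \<Longrightarrow> f x \<noteq> 0) \<Longrightarrow> Ck_on k n U (\<lambda>x. inverse (f x))"
proof (induction k arbitrary: f)
  case 0
  then show ?case
    using continuous_map_Euclidean_iff[OF openin_subset_Rn[OF U]] by (auto intro: continuous_intros)
next
  case (Suc k)
  show ?case
  proof (rule Ck_SucI[OF U,
      where g = "\<lambda>i x. - (partial_deriv i f x * (inverse (f x) * inverse (f x)))"])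
    show "continuous_on U (\<lambda>x. inverse (f x))"
      using continuous_on_Ck[OF U Suc.prems(1)] Suc.prems(2) by (auto intro: continuous_intros)
    fix i assume i: "i < n"
    show "Ck_on k n U (\<lambda>x. - (partial_deriv i f x * (inverse (f x) * inverse (f x))))"
      by (intro Ck_uminus[OF U] Ck_mult[OF U] Suc.IH Ck_pd[OF _ i] Suc.prems Ck_mono[OF Suc.prems(1)])
    fix x assume x: "x \<in> U"
    show "((\<lambda>t. inverse (f (x(i := t))))
        has_real_derivative - (partial_deriv i f x * (inverse (f x) * inverse (f x)))) (at (x i))"
      using DERIV_inverse_fun[OF Ck_has_pd[OF Suc.prems(1) x i]] Suc.prems(2)[OF x]
      by (simp add: power2_eq_square mult_ac fun_upd_def)
  qed
qed

section \<open>Differentiability and the chain rule\<close>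

lemma has_real_derivative_alt:
  "(f has_real_derivative D) (at x) \<longleftrightarrow>
    (\<forall>e>0. \<forall>\<^sub>F y in at x. \<bar>f y - f x - D * (y - x)\<bar> \<le> e * \<bar>y - x\<bar>)"
  unfolding has_field_derivative_def has_derivative_within_alt2
  by (auto simp: bounded_linear_mult_right)

text \<open>Continuity of the partial derivatives makes them \<open>e\<close>-close to their values
  at \<open>a\<close> on a small cube. Walking from \<open>a\<close> to \<open>y\<close> parallel to
  the axes, the mean value inequality bounds each of the \<open>m\<close> increments, and these are
  summed.\<close>

lemma Frechet_estimate:
  assumes V: "openin (Euclidean_space m) V" and f: "Ck_on (Suc 0) m V f" and a: "a \<in> V" and e: "e > 0"
  obtains d where "d > 0" "cube m a d \<subseteq> V"
    "\<And>y. y \<in> cube m a d \<Longrightarrow>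
      \<bar>f y - f a - (\<Sum>j<m. partial_deriv j f a * (y j - a j))\<bar> \<le> e * (\<Sum>j<m. \<bar>y j - a j\<bar>)"
proof -
  have aR: "a \<in> Rn m"
    using V a openin_subset_Rn by blast
  \<comment> \<open>Finitely many partial derivatives are treated one after the other, shrinking the
    cube each time.\<close>
  have "\<exists>d>0. cube m a d \<subseteq> V \<and> (\<forall>j<k. \<forall>y\<in>cube m a d. \<bar>partial_deriv j f y - partial_deriv j f a\<bar> \<le> e)"
    if "k \<le> m" for k
    using that
  proof (induction k)
    case 0
    then show ?case
      using cube_inside[OF V a] by auto
  next
    case (Suc k)
    then obtain d where d: "d > 0" "cube m a d \<subseteq> V"
        "\<forall>j<k. \<forall>y\<in>cube m a d. \<bar>partial_deriv j f y - partial_deriv j f a\<bar> \<le> e"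
      by auto
    have "continuous_on V (partial_deriv k f)"
      using continuous_on_Ck[OF V Ck_pd[OF f]] Suc.prems by auto
    then obtain d' where d': "d' > 0" "\<And>y. y \<in> cube m a d' \<Longrightarrow>
        \<bar>partial_deriv k f y - partial_deriv k f a\<bar> < e"
      using continuous_cube[OF V a _ e] by metis
    have sub: "cube m a (min d d') \<subseteq> cube m a d" "cube m a (min d d') \<subseteq> cube m a d'"
      by (auto intro!: cube_mono)
    have "\<bar>partial_deriv j f y - partial_deriv j f a\<bar> \<le> e"
      if "j < Suc k" "y \<in> cube m a (min d d')" for j y
    proof (cases "j = k")
      case True
      then show ?thesis
        using less_imp_le[OF d'(2)] sub(2) that(2) by blast
    next
      case False
      then have "j < k"
        using that(1) by simp
      then show ?thesis
        using d(3) sub(1) that(2) by blast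
    qed
    then have "\<forall>j<Suc k. \<forall>y\<in>cube m a (min d d'). \<bar>partial_deriv j f y - partial_deriv j f a\<bar> \<le> e"
      by simp
    moreover have "min d d' > 0" "cube m a (min d d') \<subseteq> V"
      using d(1,2) d'(1) sub(1) by auto
    ultimately show ?case
      by blast
  qed
  from this[OF order_refl] obtain d where d: "d > 0" "cube m a d \<subseteq> V"
      "\<And>j y. j < m \<Longrightarrow> y \<in> cube m a d \<Longrightarrow> \<bar>partial_deriv j f y - partial_deriv j f a\<bar> \<le> e"
    by blast
  have "\<bar>f y - f a - (\<Sum>j<m. partial_deriv j f a * (y j - a j))\<bar> \<le> e * (\<Sum>j<m. \<bar>y j - a j\<bar>)"
    if y: "y \<in> cube m a d" for y
  proof -
    \<comment> \<open>The vertices of the path: \<open>h 0\<close> is \<open>a\<close>,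
      \<open>h m\<close> is \<open>y\<close>, and step \<open>k\<close> changes coordinate
      \<open>k\<close> only.\<close>
    define h where "h k = (\<lambda>j. if j < k then y j else a j)" for k
    have hm: "h m = y"
      using y aR by (auto simp: h_def cube_def Rn_iff fun_eq_iff)
    have "\<bar>f (h k) - f a - (\<Sum>j<k. partial_deriv j f a * (y j - a j))\<bar> \<le> e * (\<Sum>j<k. \<bar>y j - a j\<bar>)"
      if "k \<le> m" for k
      using that
    proof (induction k)
      case (Suc k)
      define S where "S = closed_segment (a k) (y k)"
      have h_in: "(h k)(k := s) \<in> cube m a d" if "s \<in> S" for s
      proof -
        have "\<bar>s - a k\<bar> \<le> \<bar>y k - a k\<bar>"
          using that segment_bound1[of s "a k" "y k"] by (simp add: S_def)
        moreover have "\<bar>y k - a k\<bar> < d"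
          using y Suc.prems by (simp add: cube_def)
        ultimately have "\<bar>s - a k\<bar> < d"
          by linarith
        then show ?thesis
          using y aR d(1) Suc.prems by (auto simp: cube_def h_def Rn_iff)
      qed
      \<comment> \<open>Subtracting the linear function with slope
        \<open>partial_deriv k f a\<close> leaves a derivative that is bounded by \<open>e\<close>
        on the segment.\<close>
      have "norm ((\<lambda>s. f ((h k)(k := s)) - partial_deriv k f a * s) (y k) -
          (\<lambda>s. f ((h k)(k := s)) - partial_deriv k f a * s) (a k)) \<le> e * norm (y k - a k)"
      proof (rule field_differentiable_bound[where S = S
          and f' = "\<lambda>s. partial_deriv k f ((h k)(k := s)) - partial_deriv k f a"])
        fix s assume s: "s \<in> S"
        have "((\<lambda>t. f ((h k)(k := t))) has_real_derivative partial_deriv k f ((h k)(k := s))) (at s)"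
          using Ck_has_pd[OF f, of "(h k)(k := s)" k] h_in[OF s] d(2) Suc.prems by auto
        then show "((\<lambda>s. f ((h k)(k := s)) - partial_deriv k f a * s)
            has_real_derivative partial_deriv k f ((h k)(k := s)) - partial_deriv k f a)
                (at s within S)"
          by (auto intro!: derivative_eq_intros intro: has_field_derivative_at_within)
        show "norm (partial_deriv k f ((h k)(k := s)) - partial_deriv k f a) \<le> e"
          using d(3)[OF _ h_in[OF s]] Suc.prems by auto
      qed (auto simp: S_def)
      moreover have "(h k)(k := y k) = h (Suc k)" "(h k)(k := a k) = h k"
        by (auto simp: h_def fun_eq_iff)
      ultimately have "\<bar>f (h (Suc k)) - f (h k) - partial_deriv k f a * (y k - a k)\<bar> \<le> e * \<bar>y k - a k\<bar>"
        by (simp add: algebra_simps)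
      then show ?case
        using Suc.IH Suc.prems by (simp add: algebra_simps)
    qed (simp add: h_def)
    from this[OF order_refl] show ?thesis
      by (simp only: hm)
  qed
  then show thesis
    using that d by blast
qed

text \<open>Insert the linear approximation of each coordinate of the curve into the Frechet
  estimate of \<open>f\<close> at \<open>c t0\<close>. The derivatives constrain only the first
  \<open>m\<close> coordinates; \<open>R\<close> keeps the others zero, so that the curve enters the
  cube.\<close>

lemma DERIV_along_curve:
  assumes V: "openin (Euclidean_space m) V" and f: "Ck_on (Suc 0) m V f" and c: "c t0 \<in> V"
    and d: "\<And>j. j < m \<Longrightarrow> ((\<lambda>t. c t j) has_real_derivative c' j) (at t0)"
    and R: "\<forall>\<^sub>F t in at t0. c t \<in> Rn m"
  shows "((\<lambda>t. f (c t)) has_real_derivative (\<Sum>j<m. partial_deriv j f (c t0) * c' j)) (at t0)"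
  unfolding has_real_derivative_alt
proof (intro allI impI)
  fix e :: real assume e: "e > 0"
  \<comment> \<open>\<open>L\<close> bounds the speed of the curve near \<open>t0\<close> and
    \<open>K\<close> the gradient of \<open>f\<close>. The remainder of \<open>f\<close> costs
    \<open>e1 * L\<close> and that of the curve \<open>K * e2\<close>, each at most
    \<open>e / 2\<close>. The bound \<open>e2 \<le> 1\<close> accounts for the summands 1 in
    \<open>L\<close>, while \<open>L + 1\<close> and \<open>K + 1\<close> avoid division by
    zero.\<close>
  define L where "L = (\<Sum>j<m. \<bar>c' j\<bar> + 1)"
  define K where "K = (\<Sum>j<m. \<bar>partial_deriv j f (c t0)\<bar>)"
  have L: "L \<ge> 0" and K: "K \<ge> 0"
    by (auto simp: L_def K_def intro!: sum_nonneg)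
  define e1 where "e1 = e / (2 * (L + 1))"
  define e2 where "e2 = min 1 (e / (2 * (K + 1)))"
  have e1: "e1 > 0" and e2: "e2 > 0"
    using e L K by (auto simp: e1_def e2_def)
  obtain \<delta> where \<delta>: "\<delta> > 0" "cube m (c t0) \<delta> \<subseteq> V"
    "\<And>y. y \<in> cube m (c t0) \<delta> \<Longrightarrow>
      \<bar>f y - f (c t0)
          - (\<Sum>j<m. partial_deriv j f (c t0) * (y j - c t0 j))\<bar> \<le> e1 * (\<Sum>j<m. \<bar>y j - c t0 j\<bar>)"
    using Frechet_estimate[OF V f c e1] by blast
  have "\<forall>\<^sub>F t in at t0. \<forall>j\<in>{..<m}. \<bar>c t j - c t0 j\<bar> < \<delta>"
  proof (intro eventually_ball_finite ballI)
    fix j assume "j \<in> {..<m}"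
    then have "isCont (\<lambda>t. c t j) t0"
      using d DERIV_isCont by blast
    then have "((\<lambda>t. c t j) \<longlongrightarrow> c t0 j) (at t0)"
      by (simp add: isCont_def)
    from tendstoD[OF this \<delta>(1)] show "\<forall>\<^sub>F t in at t0. \<bar>c t j - c t0 j\<bar> < \<delta>"
      by (simp add: dist_real_def)
  qed auto
  moreover have "\<forall>\<^sub>F t in at t0. \<forall>j\<in>{..<m}. \<bar>c t j - c t0 j - c' j * (t - t0)\<bar> \<le> e2 * \<bar>t - t0\<bar>"
    using d e2 by (intro eventually_ball_finite ballI) (auto simp: has_real_derivative_alt)
  ultimately show
      "\<forall>\<^sub>F t in at t0. \<bar>f (c t) - f (c t0) - (\<Sum>j<m. partial_deriv j f (c t0) * c' j) * (t - t0)\<bar> \<le>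
          e * \<bar>t - t0\<bar>"
    using R
  proof eventually_elim
    case (elim t)
    let ?p = "\<lambda>j. partial_deriv j f (c t0)"
    have "c t \<in> cube m (c t0) \<delta>"
      using elim by (auto simp: cube_def)
    note 1 = \<delta>(3)[OF this]
    have e21: "e2 \<le> 1"
      by (simp add: e2_def)
    have "(\<Sum>j<m. \<bar>c t j - c t0 j\<bar>) \<le> (\<Sum>j<m. (\<bar>c' j\<bar> + 1) * \<bar>t - t0\<bar>)"
    proof (rule sum_mono)
      fix j assume j: "j \<in> {..<m}"
      have "\<bar>c t j - c t0 j\<bar> \<le> \<bar>c' j * (t - t0)\<bar> + e2 * \<bar>t - t0\<bar>"
        using bspec[OF elim(2) j] by linarith
      also have "\<dots> \<le> \<bar>c' j\<bar> * \<bar>t - t0\<bar> + 1 * \<bar>t - t0\<bar>"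
        using e21 by (intro add_mono mult_right_mono) (auto simp: abs_mult)
      finally show "\<bar>c t j - c t0 j\<bar> \<le> (\<bar>c' j\<bar> + 1) * \<bar>t - t0\<bar>"
        by (simp add: algebra_simps)
    qed
    also have "\<dots> = L * \<bar>t - t0\<bar>"
      by (simp add: L_def sum_distrib_right)
    finally have "e1 * (\<Sum>j<m. \<bar>c t j - c t0 j\<bar>) \<le> e1 * (L * \<bar>t - t0\<bar>)"
      using e1 by (intro mult_left_mono) auto
    also have "\<dots> = (e1 * L) * \<bar>t - t0\<bar>"
      by simp
    also have "\<dots> \<le> (e / 2) * \<bar>t - t0\<bar>"
      using L e by (intro mult_right_mono) (auto simp: e1_def field_simps)
    finally have 2: "e1 * (\<Sum>j<m. \<bar>c t j - c t0 j\<bar>) \<le> (e / 2) * \<bar>t - t0\<bar>" .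
    have "\<bar>(\<Sum>j<m. ?p j * (c t j - c t0 j)) - (\<Sum>j<m. ?p j * c' j) * (t - t0)\<bar>
      = \<bar>\<Sum>j<m. ?p j * (c t j - c t0 j - c' j * (t - t0))\<bar>"
      by (simp only: sum_distrib_right sum_subtractf[symmetric]) (simp add: algebra_simps)
    also have "\<dots> \<le> (\<Sum>j<m. \<bar>?p j * (c t j - c t0 j - c' j * (t - t0))\<bar>)"
      by (rule sum_abs)
    also have "\<dots> \<le> (\<Sum>j<m. \<bar>?p j\<bar> * (e2 * \<bar>t - t0\<bar>))"
      using elim(2) by (intro sum_mono) (auto simp: abs_mult intro!: mult_left_mono)
    also have "\<dots> = (K * e2) * \<bar>t - t0\<bar>"
      by (simp add: K_def sum_distrib_right mult.assoc)
    also have "\<dots> \<le> (K * (e / (2 * (K + 1)))) * \<bar>t - t0\<bar>"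
      using K by (intro mult_right_mono mult_left_mono) (auto simp: e2_def)
    also have "\<dots> \<le> (e / 2) * \<bar>t - t0\<bar>"
      using K e by (intro mult_right_mono) (auto simp: field_simps)
    finally show ?case
      using 1 2 by linarith
  qed
qed

lemma has_pd_comp:
  assumes V: "openin (Euclidean_space m) V" and f: "Ck_on (Suc 0) m V f"
    and U: "openin (Euclidean_space n) U" and g: "\<And>j. j < m \<Longrightarrow> Ck_on (Suc 0) n U (\<lambda>x. g x j)"
    and gV: "\<And>x. x \<in> U \<Longrightarrow> g x \<in> V" and x: "x \<in> U" and i: "i < n"
  shows "((\<lambda>t. f (g (x(i := t)))) has_real_derivative
    (\<Sum>j<m. partial_deriv j f (g x) * partial_deriv i (\<lambda>x. g x j) x)) (at (x i))"
proof -
  have "((\<lambda>t. f (g (x(i := t)))) has_real_derivative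
    (\<Sum>j<m. partial_deriv j f (g (x(i := x i))) * partial_deriv i (\<lambda>x. g x j) x)) (at (x i))"
  proof (rule DERIV_along_curve[OF V f])
    show "\<forall>\<^sub>F t in at (x i). g (x(i := t)) \<in> Rn m"
      using eventually_upd_in[OF U x i] openin_subset_Rn[OF V] gV
      by (force simp: eventually_at_filter elim: eventually_mono)
  qed (use gV x Ck_has_pd[OF g x i] in auto)
  then show ?thesis
    by simp
qed

lemma continuous_on_Rn:
  assumes "\<And>j. j < m \<Longrightarrow> continuous_on U (\<lambda>x. g x j)" "\<And>x. x \<in> U \<Longrightarrow> g x \<in> Rn m"
  shows "continuous_on U g"
proof (rule continuous_on_coordinatewise_then_product)
  fix j
  show "continuous_on U (\<lambda>x. g x j)"
  proof (cases "j < m")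
    case False
    then show ?thesis
      using assms(2) continuous_on_cong[of U U "\<lambda>x. g x j" "\<lambda>x. 0"] by (auto simp: Rn_iff)
  qed (use assms in auto)
qed

text \<open>By the chain rule each partial derivative is a sum of products of some
  \<open>partial_deriv j f\<close> composed with \<open>g\<close> and partial derivatives of
  \<open>g\<close>. Hence the outer function is generalized in the induction while \<open>g\<close>
  stays fixed.\<close>

lemma Ck_comp:
  assumes V: "openin (Euclidean_space m) V"
    and U: "openin (Euclidean_space n) U" and gV: "\<And>x. x \<in> U \<Longrightarrow> g x \<in> V"
  shows "Ck_on k m V f \<Longrightarrow> (\<And>j. j < m \<Longrightarrow> Ck_on k n U (\<lambda>x. g x j)) \<Longrightarrow> Ck_on k n U (\<lambda>x. f (g x))"
proof (induction k arbitrary: f)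
  case (0 f)
  have "continuous_on U g"
    using continuous_on_Ck[OF U 0(2)] gV openin_subset_Rn[OF V] by (intro continuous_on_Rn[of m]) auto
  then have "continuous_on U (\<lambda>x. f (g x))"
    using continuous_on_Ck[OF V 0(1)] gV by (intro continuous_on_compose2[of V f U g]) auto
  then show ?case
    using openin_subset_Rn[OF U] by (simp add: continuous_map_Euclidean_iff)
next
  case (Suc k f)
  have 1: "Ck_on (Suc 0) m' W h" if "Ck_on (Suc k) m' W h" for m' W h
    using that by (induction k) (auto dest: Ck_mono simp del: Ck_on.simps)
  have "continuous_on U g"
    using continuous_on_Ck[OF U Suc(3)] gV openin_subset_Rn[OF V] by (intro continuous_on_Rn[of m]) auto
  then have c: "continuous_on U (\<lambda>x. f (g x))"
    using continuous_on_Ck[OF V Suc(2)] gV by (intro continuous_on_compose2[of V f U g]) auto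
  show ?case
  proof (rule Ck_SucI[OF U c has_pd_comp[OF V 1[OF Suc.prems(1)] U 1[OF Suc.prems(2)] gV]])
    fix i assume i: "i < n"
    have "Ck_on k n U (\<lambda>x. partial_deriv j f (g x) * partial_deriv i (\<lambda>x. g x j) x)" if "j < m" for j
      using Suc.IH[OF Ck_pd[OF Suc.prems(1) that] Ck_mono[OF Suc.prems(2)]]
          Ck_pd[OF Suc.prems(2)[OF that] i]
      by (rule Ck_mult[OF U])
    then show "Ck_on k n U (\<lambda>x. \<Sum>j<m. partial_deriv j f (g x) * partial_deriv i (\<lambda>x. g x j) x)"
      by (intro Ck_sum U) auto
  qed
qed

lemma smooth_on_open: "smooth_on n U f \<Longrightarrow> openin (Euclidean_space n) U"
  by (simp add: smooth_on_def)

lemma smooth_on_Ck: "smooth_on n U f \<Longrightarrow> Ck_on k n U f"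
  by (simp add: smooth_on_def)

lemma smooth_onI: "openin (Euclidean_space n) U \<Longrightarrow> (\<And>k. Ck_on k n U f) \<Longrightarrow> smooth_on n U f"
  by (simp add: smooth_on_def)

lemma smooth_on_subset:
  "smooth_on n U f \<Longrightarrow> openin (Euclidean_space n) V \<Longrightarrow> V \<subseteq> U \<Longrightarrow> smooth_on n V f"
  by (auto simp: smooth_on_def intro: Ck_on_cong_subset)

lemma smooth_on_cong:
  assumes "smooth_on n U f" "\<And>x. x \<in> U \<Longrightarrow> f x = g x"
  shows "smooth_on n U g"
  using assms(1) Ck_cong[OF smooth_on_open[OF assms(1)], of f g] assms(2) unfolding smooth_on_def
    by blast

lemma smooth_on_comp:
  assumes "smooth_on m V f" "openin (Euclidean_space n) U" "\<And>j. j < m \<Longrightarrow> smooth_on n U (\<lambda>x. g x j)"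
    "\<And>x. x \<in> U \<Longrightarrow> g x \<in> V"
  shows "smooth_on n U (\<lambda>x. f (g x))"
proof (rule smooth_onI[OF assms(2)])
  show "Ck_on k n U (\<lambda>x. f (g x))" for k
    using Ck_comp[OF smooth_on_open[OF assms(1)] assms(2,4) smooth_on_Ck[OF assms(1)]
        smooth_on_Ck[OF assms(3)]] .
qed

lemma smooth_on_continuous_on: "smooth_on n U f \<Longrightarrow> continuous_on U f"
  using continuous_on_Ck smooth_on_def by blast

lemma smooth_on_pd: "smooth_on n U f \<Longrightarrow> i < n \<Longrightarrow> smooth_on n U (partial_deriv i f)"
  using Ck_pd unfolding smooth_on_def by blast

lemma smooth_on_has_pd:
  "smooth_on n U f \<Longrightarrow> x \<in> U \<Longrightarrow> i < n \<Longrightarrow>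
    ((\<lambda>t. f (x(i := t))) has_real_derivative partial_deriv i f x) (at (x i))"
  using Ck_has_pd smooth_on_Ck by blast

section \<open>The implicit function theorem for one equation\<close>

lemma continuous_on_upd: "continuous_on A (\<lambda>x::vec. x(i := s))"
proof (rule continuous_on_coordinatewise_then_product)
  fix j
  show "continuous_on A (\<lambda>x. (x(i := s)) j)"
    by (cases "j = i") (auto intro: continuous_on_subset[OF continuous_on_product_coordinates])
qed

text \<open>To differentiate an implicit function, coordinate \<open>j\<close> is moved and
  coordinate \<open>i\<close> responds. All but two terms of the Frechet estimate then
  vanish.\<close>

lemma sum_two_upd:
  fixes p :: "nat \<Rightarrow> real"
  assumes "i < n" "j < n" "i \<noteq> j"
  shows "(\<Sum>l<n. p l * ((a(j := t, i := s)) l - a l)) = p j * (t - a j) + p i * (s - a i)"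
    and "(\<Sum>l<n. \<bar>(a(j := t, i := s)) l - a l\<bar>) = \<bar>t - a j\<bar> + \<bar>s - a i\<bar>"
proof -
  have "(\<Sum>l<n. p l * ((a(j := t, i := s)) l - a l)) =
      (\<Sum>l<n. (if l = j then p j * (t - a j) else 0) + (if l = i then p i * (s - a i) else 0))"
    using assms by (intro sum.cong) auto
  then show "(\<Sum>l<n. p l * ((a(j := t, i := s)) l - a l)) = p j * (t - a j) + p i * (s - a i)"
    using assms by (simp add: sum.distrib)
  have "(\<Sum>l<n. \<bar>(a(j := t, i := s)) l - a l\<bar>) =
      (\<Sum>l<n. (if l = j then \<bar>t - a j\<bar> else 0) + (if l = i then \<bar>s - a i\<bar> else 0))"
    using assms by (intro sum.cong) auto
  then show "(\<Sum>l<n. \<bar>(a(j := t, i := s)) l - a l\<bar>) = \<bar>t - a j\<bar> + \<bar>s - a i\<bar>"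
    using assms by (simp add: sum.distrib)
qed

text \<open>Here \<open>D\<close> is the change of the free coordinate, \<open>d\<close> that of the
  implicit function, and \<open>r\<close>, \<open>p\<close> are the corresponding partial
  derivatives, so the slope is \<open>- r / p\<close>. With X = d + (r / p) D the hypothesis bounds
  p |X| by \<epsilon> |X| plus \<epsilon> (1 + |r / p|) |D|. One entry of the minimum lets the left
  side absorb the first term, the other bounds the second.\<close>

lemma implicit_estimate:
  fixes p :: real
  assumes p: "p > 0" and e: "e > 0" and \<epsilon>: "\<epsilon> = min (p / 2) (e * p / (2 * (1 + \<bar>r / p\<bar>)))"
    and h: "\<bar>r * D + p * d\<bar> \<le> \<epsilon> * (\<bar>D\<bar> + \<bar>d\<bar>)"
  shows "\<bar>d + r / p * D\<bar> \<le> e * \<bar>D\<bar>"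
proof -
  define q where "q = r / p"
  define X where "X = d + q * D"
  have r: "r = q * p"
    using p by (simp add: q_def)
  have "r * D + p * d = p * X"
    by (simp add: r X_def algebra_simps)
  then have 1: "p * \<bar>X\<bar> \<le> \<epsilon> * (\<bar>D\<bar> + \<bar>d\<bar>)"
    using h p by (simp add: abs_mult)
  have \<epsilon>2: "\<epsilon> \<le> p / 2"
    unfolding \<epsilon> by (rule min.cobounded1)
  have "\<epsilon> > 0"
    using p e \<epsilon> by (auto intro!: divide_pos_pos mult_pos_pos add_pos_nonneg)
  have "\<bar>d\<bar> = \<bar>X - q * D\<bar>"
    by (simp add: X_def)
  also have "\<dots> \<le> \<bar>X\<bar> + \<bar>q\<bar> * \<bar>D\<bar>"
    using abs_triangle_ineq4[of X "q * D"] by (simp add: abs_mult)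
  finally have "\<epsilon> * (\<bar>D\<bar> + \<bar>d\<bar>) \<le> \<epsilon> * (\<bar>D\<bar> + (\<bar>X\<bar> + \<bar>q\<bar> * \<bar>D\<bar>))"
    using \<open>\<epsilon> > 0\<close> by (intro mult_left_mono) auto
  also have "\<dots> = \<epsilon> * \<bar>X\<bar> + (\<epsilon> * (1 + \<bar>q\<bar>)) * \<bar>D\<bar>"
    by (simp add: algebra_simps)
  also have "\<dots> \<le> (p / 2) * \<bar>X\<bar> + (e * p / 2) * \<bar>D\<bar>"
  proof (intro add_mono mult_right_mono)
    have "\<epsilon> \<le> e * p / (2 * (1 + \<bar>q\<bar>))"
      by (simp add: \<epsilon> q_def)
    then have "\<epsilon> * (1 + \<bar>q\<bar>) \<le> e * p / (2 * (1 + \<bar>q\<bar>)) * (1 + \<bar>q\<bar>)"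
      by (intro mult_right_mono) auto
    also have "\<dots> = e * p / 2"
      by (simp add: field_simps)
    finally show "\<epsilon> * (1 + \<bar>q\<bar>) \<le> e * p / 2" .
  qed (use \<epsilon>2 in auto)
  finally have "p * \<bar>X\<bar> \<le> (p / 2) * \<bar>X\<bar> + (e * p / 2) * \<bar>D\<bar>"
    using 1 by linarith
  then have "p * \<bar>X\<bar> \<le> p * (e * \<bar>D\<bar>)"
    by (simp add: field_simps)
  then show ?thesis
    using p by (simp add: X_def q_def)
qed

text \<open>The implicit function is smooth because its partial derivatives are rational expressions in
  the partial derivatives of \<open>f\<close> composed with the implicit function itself.\<close>

lemma implicit_function_pos:
  assumes f: "smooth_on n U f" and u0: "u0 \<in> U" and i: "i < n" and pos: "partial_deriv i f u0 > 0"
  obtains W \<phi> where "openin (Euclidean_space n) W" "u0 \<in> W" "smooth_on n W \<phi>" "\<phi> u0 = u0 i"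
    "\<And>x. x \<in> W \<Longrightarrow> x(i := \<phi> x) \<in> U \<and> f (x(i := \<phi> x)) = f u0"
proof -
  have U: "openin (Euclidean_space n) U" and UR: "U \<subseteq> Rn n"
    using f smooth_on_open openin_subset_Rn by blast+
  have u0R: "u0 \<in> Rn n"
    using u0 UR by blast
  define c where "c = f u0"
  obtain d where d: "d > 0" "cube n u0 d \<subseteq> U"
    "\<And>y. y \<in> cube n u0 d \<Longrightarrow> \<bar>partial_deriv i f y - partial_deriv i f u0\<bar> < partial_deriv i f u0"
    using continuous_cube[OF U u0 smooth_on_continuous_on[OF smooth_on_pd[OF f i]] pos] by blast
  have pd: "partial_deriv i f y > 0" if "y \<in> cube n u0 d" for y
    using d(3)[OF that] by linarith
  \<comment> \<open>Solutions are sought within distance \<open>b\<close> of \<open>u0 i\<close>,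
    while \<open>f\<close> increases in coordinate \<open>i\<close> up to distance \<open>d\<close>.
    The gap leaves room for the comparison points at distance \<open>3 / 2 * b\<close> used for
    continuity.\<close>
  define b where "b = d / 2"
  have b: "0 < b" "b < d"
    using d(1) by (auto simp: b_def)
  define I where "I s \<longleftrightarrow> \<bar>s - u0 i\<bar> < d" for s
  have upd: "x(i := s) \<in> cube n u0 d" if "x \<in> cube n u0 d" "I s" for x s
    using that i by (auto simp: cube_def I_def Rn_iff)
  have dv: "((\<lambda>t. f (x(i := t))) has_real_derivative partial_deriv i f (x(i := s))) (at s)"
    if "x \<in> cube n u0 d" "I s" for x s
    using smooth_on_has_pd[OF f _ i, of "x(i := s)"] d(2) upd[OF that] by auto
  have mono: "f (x(i := s)) < f (x(i := s'))" if x: "x \<in> cube n u0 d" and s: "I s" "I s'" "s < s'"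
      for x s s'
  proof (rule DERIV_pos_imp_increasing[OF s(3)])
    fix t assume "s \<le> t" "t \<le> s'"
    then have "I t"
      using s by (auto simp: I_def)
    then show "\<exists>y. ((\<lambda>t. f (x(i := t))) has_real_derivative y) (at t) \<and> 0 < y"
      using dv[OF x] pd[OF upd[OF x]] by blast
  qed
  have cont: "continuous_on (cube n u0 d) (\<lambda>x. f (x(i := s)))" if "I s" for s
    using upd[OF _ that] d(2)
    by (intro continuous_on_compose2[OF smooth_on_continuous_on[OF f] continuous_on_upd]) auto
  have Ib: "I (u0 i - b)" "I (u0 i + b)" "I (u0 i)"
    using b by (auto simp: I_def)
  have u0c: "u0 \<in> cube n u0 d"
    using cube_self[OF u0R d(1)] .
  have lo: "f (u0(i := u0 i - b)) < c" and hi: "c < f (u0(i := u0 i + b))"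
    using mono[OF u0c Ib(1) Ib(3)] mono[OF u0c Ib(3) Ib(2)] b by (auto simp: c_def)
  \<comment> \<open>On a small cube the values at both ends of the interval stay on their sides of
    \<open>c\<close>, so the intermediate value theorem gives a solution for every \<open>x\<close>
    in it.\<close>
  obtain d1 where d1: "d1 > 0" "cube n u0 d1 \<subseteq> cube n u0 d"
      "\<And>y. y \<in> cube n u0 d1 \<Longrightarrow>
          \<bar>f (y(i := u0 i - b)) - f (u0(i := u0 i - b))\<bar> < c - f (u0(i := u0 i - b))"
    using continuous_cube[OF openin_cube u0c cont[OF Ib(1)], of "c - f (u0(i := u0 i - b))"] lo by auto
  obtain d2 where d2: "d2 > 0" "cube n u0 d2 \<subseteq> cube n u0 d"
      "\<And>y. y \<in> cube n u0 d2 \<Longrightarrow>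
          \<bar>f (y(i := u0 i + b)) - f (u0(i := u0 i + b))\<bar> < f (u0(i := u0 i + b)) - c"
    using continuous_cube[OF openin_cube u0c cont[OF Ib(2)], of "f (u0(i := u0 i + b)) - c"] hi by auto
  define W where "W = cube n u0 (min d1 d2)"
  have W: "openin (Euclidean_space n) W" "u0 \<in> W"
    using openin_cube cube_self[OF u0R] d1(1) d2(1) by (auto simp: W_def)
  have W12: "W \<subseteq> cube n u0 d1" "W \<subseteq> cube n u0 d2"
    unfolding W_def by (intro cube_mono; simp)+
  have WQ: "W \<subseteq> cube n u0 d"
    using W12 d1(2) by blast
  have "\<exists>s. \<bar>s - u0 i\<bar> \<le> b \<and> f (x(i := s)) = c" if x: "x \<in> W" for x
  proof -
    have "f (x(i := u0 i - b)) \<le> c" "c \<le> f (x(i := u0 i + b))"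
      using d1(3)[of x] d2(3)[of x] W12 x by (auto simp: subset_iff abs_less_iff)
    moreover have "continuous_on {u0 i - b..u0 i + b} (\<lambda>s. f (x(i := s)))"
    proof (rule DERIV_continuous_on)
      fix s assume "s \<in> {u0 i - b..u0 i + b}"
      then have "I s"
        using b by (auto simp: I_def)
      then show "((\<lambda>s. f (x(i := s)))
          has_real_derivative partial_deriv i f (x(i := s))) (at s within {u0 i - b..u0 i + b})"
        using dv x WQ by (blast intro: has_field_derivative_at_within)
    qed
    ultimately obtain s where "u0 i - b \<le> s" "s \<le> u0 i + b" "f (x(i := s)) = c"
      using IVT'[of "\<lambda>s. f (x(i := s))" "u0 i - b" c "u0 i + b"] b by auto
    then show ?thesis
      by (intro exI[of _ s]) (auto simp: abs_le_iff)
  qed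
  then obtain \<phi> where \<phi>b: "\<And>x. x \<in> W \<Longrightarrow> \<bar>\<phi> x - u0 i\<bar> \<le> b" and \<phi>c: "\<And>x. x \<in> W \<Longrightarrow> f (x(i := \<phi> x)) = c"
    by metis
  have \<phi>I: "I (\<phi> x)" if "x \<in> W" for x
    using \<phi>b[OF that] b by (simp add: I_def)
  \<comment> \<open>By monotonicity the position of \<open>s\<close> relative to
    \<open>\<phi> x\<close> is read off from the sign of \<open>f (x(i := s)) - c\<close>. This
    yields uniqueness and reduces continuity of \<open>\<phi>\<close> to that of
    \<open>f\<close>.\<close>
  have less1: "s < \<phi> x \<longleftrightarrow> f (x(i := s)) < c" and less2: "\<phi> x < s \<longleftrightarrow> c < f (x(i := s))"
      if "x \<in> W" "I s" for x s
    using mono[of x s "\<phi> x"] mono[of x "\<phi> x" s] \<phi>I[OF that(1)] that \<phi>c[OF that(1)] WQ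
    by (cases s "\<phi> x" rule: linorder_cases; force)+
  have uniq: "\<phi> x = s" if "x \<in> W" "I s" "f (x(i := s)) = c" for x s
    using less1[OF that(1,2)] less2[OF that(1,2)] that(3) by auto
  have \<phi>u0: "\<phi> u0 = u0 i"
    using uniq[OF W(2) Ib(3)] by (simp add: c_def)
  have \<phi>cont: "continuous_on W \<phi>"
    unfolding continuous_on_def
  proof
    fix x0 assume x0: "x0 \<in> W"
    show "(\<phi> \<longlongrightarrow> \<phi> x0) (at x0 within W)"
    proof (rule order_tendstoI)
      fix l assume l: "l < \<phi> x0"
      \<comment> \<open>The bound \<open>l\<close> may lie outside the interval where
        \<open>f\<close> is monotone. The clipped bound is still below \<open>\<phi> x0\<close>,
        which is at least \<open>u0 i - b\<close>.\<close>
      define l' where "l' = max l (u0 i - 3 / 2 * b)"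
      have l': "l' < \<phi> x0" "I l'"
        using l \<phi>b[OF x0] b unfolding l'_def I_def b_def by linarith+
      have "((\<lambda>x. f (x(i := l'))) \<longlongrightarrow> f (x0(i := l'))) (at x0 within W)"
        using continuous_on_subset[OF cont[OF l'(2)] WQ] x0 by (simp add: continuous_on_def)
      then have "\<forall>\<^sub>F x in at x0 within W. f (x(i := l')) < c"
        using less1[OF x0 l'(2)] l'(1) by (auto dest: order_tendstoD)
      moreover have "\<forall>\<^sub>F x in at x0 within W. x \<in> W"
        by (simp add: eventually_at_filter)
      ultimately show "\<forall>\<^sub>F x in at x0 within W. l < \<phi> x"
      proof eventually_elim
        case (elim x)
        then have "l' < \<phi> x"
          using less1 l'(2) by blast
        then show ?case
          unfolding l'_def by linarith
      qed
    next
      fix l assume l: "\<phi> x0 < l"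
      define l' where "l' = min l (u0 i + 3 / 2 * b)"
      have l': "\<phi> x0 < l'" "I l'"
        using l \<phi>b[OF x0] b unfolding l'_def I_def b_def by linarith+
      have "((\<lambda>x. f (x(i := l'))) \<longlongrightarrow> f (x0(i := l'))) (at x0 within W)"
        using continuous_on_subset[OF cont[OF l'(2)] WQ] x0 by (simp add: continuous_on_def)
      then have "\<forall>\<^sub>F x in at x0 within W. c < f (x(i := l'))"
        using less2[OF x0 l'(2)] l'(1) by (auto dest: order_tendstoD)
      moreover have "\<forall>\<^sub>F x in at x0 within W. x \<in> W"
        by (simp add: eventually_at_filter)
      ultimately show "\<forall>\<^sub>F x in at x0 within W. \<phi> x < l"
      proof eventually_elim
        case (elim x)
        then have "\<phi> x < l'"
          using less2 l'(2) by blast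
        then show ?case
          unfolding l'_def by linarith
      qed
    qed
  qed
  define \<psi> where "\<psi> x = x(i := \<phi> x)" for x
  have \<psi>Q: "\<psi> x \<in> cube n u0 d" if "x \<in> W" for x
    using upd \<phi>I[OF that] that WQ by (auto simp: \<psi>_def)
  have \<psi>U: "\<psi> x \<in> U" if "x \<in> W" for x
    using \<psi>Q[OF that] d(2) by blast
  \<comment> \<open>Coordinate \<open>i\<close> of \<open>x\<close> is overwritten, so
    \<open>\<phi>\<close> does not depend on it and the derivative in that direction is 0.\<close>
  define g where "g j x =
      (if j = i then 0 else - (partial_deriv j f (\<psi> x) * inverse (partial_deriv i f (\<psi> x))))" for j x
  have d\<phi>: "((\<lambda>t. \<phi> (x(j := t))) has_real_derivative g j x) (at (x j))" if j: "j < n" and x: "x \<in> W"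
      for j x
  proof (cases "j = i")
    case True
    have "\<forall>\<^sub>F t in nhds (x j). x(j := t) \<in> W"
      using eventually_upd_in[OF W(1) x j] .
    then have "\<forall>\<^sub>F t in nhds (x j). \<phi> (x(j := t)) = \<phi> x"
      by eventually_elim (use uniq \<phi>I[OF x] \<phi>c[OF x] True in auto)
    then have "((\<lambda>t. \<phi> (x(j := t))) has_real_derivative 0) (at (x j)) \<longleftrightarrow> ((\<lambda>t. \<phi> x)
        has_real_derivative 0) (at (x j))"
      by (intro DERIV_cong_ev refl)
    then show ?thesis
      using True by (simp add: g_def)
  next
    case False
    show ?thesis
      unfolding has_real_derivative_alt
    proof (intro allI impI)
      fix e :: real assume e: "e > 0"
      define p where "p = partial_deriv i f (\<psi> x)"
      define r where "r = partial_deriv j f (\<psi> x)"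
      define \<epsilon> where "\<epsilon> = min (p / 2) (e * p / (2 * (1 + \<bar>r / p\<bar>)))"
      have p: "p > 0"
        using pd[OF \<psi>Q[OF x]] by (simp add: p_def)
      have \<epsilon>: "\<epsilon> > 0"
        using p e by (auto simp: \<epsilon>_def intro!: divide_pos_pos mult_pos_pos add_pos_nonneg)
      obtain d3 where d3: "d3 > 0" "cube n (\<psi> x) d3 \<subseteq> U"
        "\<And>y. y \<in> cube n (\<psi> x) d3 \<Longrightarrow>
          \<bar>f y - f (\<psi> x) - (\<Sum>l<n. partial_deriv l f (\<psi> x) * (y l - \<psi> x l))\<bar> \<le> \<epsilon> * (\<Sum>l<n. \<bar>y l - \<psi> x l\<bar>)"
        using Frechet_estimate[OF U smooth_on_Ck[OF f] \<psi>U[OF x] \<epsilon>] by blast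
      \<comment> \<open>Continuity of \<open>\<phi>\<close>, already known, keeps the responding
        coordinate inside the cube of the Frechet estimate.\<close>
      obtain d4 where d4: "d4 > 0" "cube n x d4 \<subseteq> W" "\<And>y. y \<in> cube n x d4 \<Longrightarrow> \<bar>\<phi> y - \<phi> x\<bar> < d3"
        using continuous_cube[OF W(1) x \<phi>cont d3(1)] by blast
      have "\<forall>\<^sub>F t in at (x j). dist t (x j) < min d3 d4"
        unfolding eventually_at using d3(1) d4(1) by (intro exI[of _ "min d3 d4"]) auto
      then show "\<forall>\<^sub>F t in at (x j). \<bar>\<phi> (x(j := t)) - \<phi> (x(j := x j)) - g j x * (t - x j)\<bar> \<le>
          e * \<bar>t - x j\<bar>"
      proof eventually_elim
        case (elim t)
        have xR: "x \<in> Rn n"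
          using x W(1) openin_subset_Rn by blast
        have x1: "x(j := t) \<in> cube n x d4"
          using elim xR j d4(1) by (auto simp: cube_def Rn_iff dist_real_def)
        define s where "s = \<phi> (x(j := t))"
        have s: "\<bar>s - \<phi> x\<bar> < d3"
          using d4(3)[OF x1] by (simp add: s_def)
        have y: "\<psi> (x(j := t)) = (\<psi> x)(j := t, i := s)"
          using False by (auto simp: \<psi>_def s_def fun_eq_iff)
        have "\<psi> (x(j := t)) \<in> cube n (\<psi> x) d3"
          unfolding y using s elim xR i j d3(1) False
            by (auto simp: cube_def Rn_iff dist_real_def \<psi>_def)
        then have "(\<psi> x)(j := t, i := s) \<in> cube n (\<psi> x) d3"
          by (simp only: y)
        note d3(3)[OF this, unfolded sum_two_upd[OF i j False[symmetric]]]
        moreover have "f ((\<psi> x)(j := t, i := s)) = c" "f (\<psi> x) = c"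
          using \<phi>c[OF x] \<phi>c[of "x(j := t)"] x1 d4(2) unfolding y[symmetric] by (auto simp: \<psi>_def)
        moreover have "\<psi> x j = x j" "\<psi> x i = \<phi> x"
          using False by (auto simp: \<psi>_def)
        ultimately have "\<bar>r * (t - x j) + p * (s - \<phi> x)\<bar> \<le> \<epsilon> * (\<bar>t - x j\<bar> + \<bar>s - \<phi> x\<bar>)"
          by (simp add: p_def r_def)
        from implicit_estimate[OF p e \<epsilon>_def this]
        show ?case
          using False by (simp add: s_def g_def p_def r_def divide_inverse)
      qed
    qed
  qed
  have "Ck_on k n W \<phi>" for k
  proof (induction k)
    case 0
    show ?case
      using \<phi>cont openin_subset_Rn[OF W(1)] by (simp add: continuous_map_Euclidean_iff)
  next
    case (Suc k)
    have \<psi>k: "Ck_on k n W (\<lambda>x. \<psi> x l)" for l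
      using Suc Ck_coord[OF W(1), of k l] by (cases "l = i") (auto simp: \<psi>_def)
    have comp: "Ck_on k n W (\<lambda>x. partial_deriv l f (\<psi> x))" if "l < n" for l
      using Ck_comp[OF U W(1) \<psi>U smooth_on_Ck[OF smooth_on_pd[OF f that]] \<psi>k] .
    show ?case
    proof (rule Ck_SucI[OF W(1) \<phi>cont d\<phi>])
      fix j assume j: "j < n"
      show "Ck_on k n W (g j)"
      proof (cases "j = i")
        case True
        then show ?thesis
          using Ck_const[OF W(1), of k 0] by (simp add: g_def[abs_def])
      next
        case False
        have "partial_deriv i f (\<psi> x) \<noteq> 0" if "x \<in> W" for x
          using pd[OF \<psi>Q[OF that]] by simp
        then have "Ck_on k n W (\<lambda>x. - (partial_deriv j f (\<psi> x) * inverse (partial_deriv i f (\<psi> x))))"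
          by (intro Ck_uminus[OF W(1)] Ck_mult[OF W(1)] Ck_inverse[OF W(1)] comp i j)
        then show ?thesis
          using False by (simp add: g_def[abs_def])
      qed
    qed
  qed
  then have "smooth_on n W \<phi>"
    using W(1) by (intro smooth_onI)
  moreover have "x(i := \<phi> x) \<in> U \<and> f (x(i := \<phi> x)) = f u0" if "x \<in> W" for x
    using \<psi>U[OF that] \<phi>c[OF that] by (simp add: \<psi>_def c_def)
  ultimately show thesis
    using that[of W \<phi>, OF W _ \<phi>u0] by blast
qed

section \<open>The derivative as a linear map\<close>

lemma pd_cong:
  assumes "openin (Euclidean_space n) V" "r \<in> V" "i < n" "\<And>x. x \<in> V \<Longrightarrow> f x = g x"
  shows "partial_deriv i f r = partial_deriv i g r"
  unfolding partial_deriv_def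
proof (rule deriv_cong_ev[OF _ refl])
  show "\<forall>\<^sub>F t in nhds (r i). f (r(i := t)) = g (r(i := t))"
    using eventually_upd_in[OF assms(1-3)] by eventually_elim (use assms(4) in auto)
qed

lemma deriv_map_cong:
  assumes "openin (Euclidean_space n) V" "r \<in> V" "\<And>x. x \<in> V \<Longrightarrow> f x j = g x j"
  shows "deriv_map n f r v j = deriv_map n g r v j"
  unfolding deriv_map_def using pd_cong[OF assms(1,2) _ assms(3)] by (intro sum.cong) auto

lemma pd_const: "partial_deriv i (\<lambda>x. c) r = 0"
  by (simp add: partial_deriv_def)

lemma pd_coord: "partial_deriv i (\<lambda>x. x j) r = (if i = j then 1 else 0)"
  by (auto simp: partial_deriv_def)

lemma deriv_map_const: "deriv_map n (\<lambda>x. c) r v = 0"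
  by (simp add: deriv_map_def pd_const fun_eq_iff)

lemma deriv_map_id: "v \<in> Rn n \<Longrightarrow> deriv_map n (\<lambda>x. x) r v = v"
  by (auto simp: deriv_map_def pd_coord Rn_iff fun_eq_iff if_distrib[of "\<lambda>x. x * _"] cong: if_cong)

lemma linear_deriv_map: "linear (deriv_map n f r)"
  by (intro linearI)
      (auto simp: deriv_map_def fun_eq_iff scaleR_fun_def algebra_simps sum.distrib sum_distrib_left)

lemma deriv_map_in_Rn:
  assumes "openin (Euclidean_space n) V" "r \<in> V" "\<And>x. x \<in> V \<Longrightarrow> f x \<in> Rn m"
  shows "deriv_map n f r v \<in> Rn m"
  unfolding Rn_iff
proof (intro allI impI)
  fix j assume "m \<le> j"
  then have "deriv_map n f r v j = deriv_map n (\<lambda>x. 0) r v j"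
    using assms(3) by (intro deriv_map_cong[OF assms(1,2)]) (auto simp: Rn_iff)
  then show "deriv_map n f r v j = 0"
    by (simp add: deriv_map_const)
qed

lemma pd_comp:
  assumes "smooth_on m V f" "openin (Euclidean_space n) U" "\<And>j. j < m \<Longrightarrow> smooth_on n U (\<lambda>x. g x j)"
    "\<And>x. x \<in> U \<Longrightarrow> g x \<in> V" "x \<in> U" "i < n"
  shows "partial_deriv i (\<lambda>x. f (g x)) x =
      (\<Sum>j<m. partial_deriv j f (g x) * partial_deriv i (\<lambda>x. g x j) x)"
  using has_pd_comp[OF smooth_on_open[OF assms(1)] smooth_on_Ck[OF assms(1)] assms(2)
      smooth_on_Ck[OF assms(3)] assms(4-6)]
  unfolding partial_deriv_def by (rule DERIV_imp_deriv)

text \<open>Stated for a single component \<open>l\<close>, as smoothness is a property of scalar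
  functions; a scalar function can then enter as a family that is constant in the component.\<close>

lemma deriv_map_comp:
  assumes "smooth_on m V (\<lambda>x. f x l)" "openin (Euclidean_space n) U" "\<And>j. j < m \<Longrightarrow>
      smooth_on n U (\<lambda>x. g x j)"
    "\<And>x. x \<in> U \<Longrightarrow> g x \<in> V" "x \<in> U"
  shows "deriv_map n (\<lambda>x. f (g x)) x v l = deriv_map m f (g x) (deriv_map n g x v) l"
proof -
  have "deriv_map n (\<lambda>x. f (g x)) x v l =
      (\<Sum>i<n. \<Sum>j<m. partial_deriv j (\<lambda>x. f x l) (g x) * partial_deriv i (\<lambda>x. g x j) x * v i)"
    unfolding deriv_map_def using pd_comp[OF assms(1-5)]
    by (intro sum.cong refl) (simp add: sum_distrib_right)
  also have "\<dots> = deriv_map m f (g x) (deriv_map n g x v) l"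
    unfolding deriv_map_def by (subst sum.swap) (simp add: sum_distrib_left mult.assoc)
  finally show ?thesis .
qed

lemma smooth_on_uminus: "smooth_on n U f \<Longrightarrow> smooth_on n U (\<lambda>x. - f x)"
  unfolding smooth_on_def using Ck_uminus by blast

lemma smooth_on_const: "openin (Euclidean_space n) U \<Longrightarrow> smooth_on n U (\<lambda>x. c)"
  by (intro smooth_onI Ck_const)

lemma smooth_on_coord: "openin (Euclidean_space n) U \<Longrightarrow> smooth_on n U (\<lambda>x. x j)"
  by (intro smooth_onI Ck_coord)

text \<open>A negative partial derivative becomes positive for \<open>- f\<close>, which has the
  same level sets.\<close>

lemma implicit_function:
  assumes f: "smooth_on n U f" and u0: "u0 \<in> U" and i: "i < n" and nz: "partial_deriv i f u0 \<noteq> 0"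
  obtains W \<phi> where "openin (Euclidean_space n) W" "u0 \<in> W" "smooth_on n W \<phi>" "\<phi> u0 = u0 i"
    "\<And>x. x \<in> W \<Longrightarrow> x(i := \<phi> x) \<in> U \<and> f (x(i := \<phi> x)) = f u0"
proof (cases "partial_deriv i f u0 > 0")
  case True
  then show thesis
    using implicit_function_pos[OF f u0 i] that by metis
next
  case False
  have "((\<lambda>t. - f (u0(i := t))) has_real_derivative - partial_deriv i f u0) (at (u0 i))"
    by (intro DERIV_minus smooth_on_has_pd[OF f u0 i])
  then have "partial_deriv i (\<lambda>x. - f x) u0 = - partial_deriv i f u0"
    unfolding partial_deriv_def by (rule DERIV_imp_deriv)
  then have "partial_deriv i (\<lambda>x. - f x) u0 > 0"
    using False nz by simp
  from implicit_function_pos[OF smooth_on_uminus[OF f] u0 i this] obtain W \<phi> where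
    "openin (Euclidean_space n) W" "u0 \<in> W" "smooth_on n W \<phi>" "\<phi> u0 = u0 i"
    "\<And>x. x \<in> W \<Longrightarrow> x(i := \<phi> x) \<in> U \<and> - f (x(i := \<phi> x)) = - f u0"
    by metis
  then show thesis
    using that[of W \<phi>] by auto
qed

text \<open>\<open>\<psi>\<close> overwrites one coordinate by the implicit function and keeps all
  \<open>n\<close> coordinates as parameters, so such maps compose without reindexing. Its
  derivative is the identity on the kernel of the differential of \<open>f\<close>: the components
  other than \<open>i\<close> are untouched, and since \<open>f\<close> is constant along
  \<open>\<psi>\<close>, component \<open>i\<close> is determined through its nonzero
  coefficient.\<close>

lemma hypersurface_parametrization:
  assumes f: "smooth_on n U f" and u0: "u0 \<in> U" and w: "(\<Sum>i<n. partial_deriv i f u0 * w i) \<noteq> 0"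
  obtains W \<psi> where "openin (Euclidean_space n) W" "u0 \<in> W" "\<And>j. smooth_on n W (\<lambda>x. \<psi> x j)" "\<psi> u0 = u0"
    "\<And>x. x \<in> W \<Longrightarrow> \<psi> x \<in> U \<and> f (\<psi> x) = f u0"
    "\<And>v. v \<in> Rn n \<Longrightarrow> (\<Sum>i<n. partial_deriv i f u0 * v i) = 0 \<Longrightarrow> deriv_map n \<psi> u0 v = v"
proof -
  obtain i where i: "i < n" and nz: "partial_deriv i f u0 \<noteq> 0"
  proof (rule ccontr)
    assume "\<not> thesis"
    then have "\<forall>i<n. partial_deriv i f u0 = 0"
      using that by blast
    then have "(\<Sum>i<n. partial_deriv i f u0 * w i) = 0"
      by (intro sum.neutral) auto
    then show False
      using w by contradiction
  qed
  obtain W \<phi> where W: "openin (Euclidean_space n) W" "u0 \<in> W" and \<phi>: "smooth_on n W \<phi>" "\<phi> u0 = u0 i"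
    "\<And>x. x \<in> W \<Longrightarrow> x(i := \<phi> x) \<in> U \<and> f (x(i := \<phi> x)) = f u0"
    using implicit_function[OF f u0 i nz] by blast
  define \<psi> where "\<psi> x = x(i := \<phi> x)" for x
  have sm: "smooth_on n W (\<lambda>x. \<psi> x j)" for j
    using \<phi>(1) smooth_on_coord[OF W(1), of j] by (cases "j = i") (auto simp: \<psi>_def)
  have \<psi>: "\<psi> x \<in> U \<and> f (\<psi> x) = f u0" if "x \<in> W" for x
    using \<phi>(3)[OF that] by (simp add: \<psi>_def)
  have \<psi>0: "\<psi> u0 = u0"
    by (simp add: \<psi>_def \<phi>(2))
  have "deriv_map n \<psi> u0 v = v" if v: "v \<in> Rn n" "(\<Sum>i<n. partial_deriv i f u0 * v i) = 0" for v
  proof -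
    have ne: "deriv_map n \<psi> u0 v l = v l" if "l \<noteq> i" for l
    proof -
      have "(\<lambda>x. \<psi> x l) = (\<lambda>x. x l)"
        using that by (simp add: \<psi>_def)
      then have "deriv_map n \<psi> u0 v l = deriv_map n (\<lambda>x. x) u0 v l"
        by (simp add: deriv_map_def)
      then show ?thesis
        by (simp add: deriv_map_id[OF v(1)])
    qed
    have "(\<Sum>l<n. partial_deriv l f u0 * deriv_map n \<psi> u0 v l) =
        deriv_map n (\<lambda>x l. f x) (\<psi> u0) (deriv_map n \<psi> u0 v) 0"
      by (simp add: deriv_map_def \<psi>0)
    also have "\<dots> = deriv_map n (\<lambda>x l. f (\<psi> x)) u0 v 0"
      using deriv_map_comp[of n U "\<lambda>x l. f x" 0 n W \<psi> u0 v] f W sm \<psi> by simp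
    also have "\<dots> = deriv_map n (\<lambda>x l. f u0) u0 v 0"
      using \<psi> by (intro deriv_map_cong[OF W]) auto
    also have "\<dots> = 0"
      by (simp add: deriv_map_const)
    finally have "(\<Sum>l<n. partial_deriv l f u0 * (deriv_map n \<psi> u0 v l - v l)) = 0"
      using v(2) by (simp add: algebra_simps sum_subtractf)
    moreover have "(\<Sum>l<n. partial_deriv l f u0 * (deriv_map n \<psi> u0 v l - v l)) =
        (\<Sum>l<n. if l = i then partial_deriv i f u0 * (deriv_map n \<psi> u0 v i - v i) else 0)"
      using ne by (intro sum.cong) auto
    ultimately have "deriv_map n \<psi> u0 v i = v i"
      using i nz by simp
    then show ?thesis
      using ne by (metis ext)
  qed
  then show thesis
    using that[OF W sm \<psi>0 \<psi>] by blast
qed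

text \<open>Induction on the number of equations: given \<open>\<Gamma>\<close> for the first \<open>k\<close> of them, compose it with a
  parametrization of the hypersurface on which \<open>F\<^sub>k \<circ> \<Gamma>\<close> is constant.\<close>

lemma level_set_parametrization:
  assumes F: "\<And>l. l < m \<Longrightarrow> smooth_on n U (\<lambda>x. F x l)" and U: "openin (Euclidean_space n) U" "u0 \<in> U"
    and surj: "\<And>l. l < m \<Longrightarrow> \<exists>w\<in>Rn n. \<forall>l'<m. deriv_map n F u0 w l' = (if l' = l then 1 else 0)"
  obtains W \<Gamma> where "openin (Euclidean_space n) W" "u0 \<in> W" "\<And>j. smooth_on n W (\<lambda>x. \<Gamma> x j)" "\<Gamma> u0 = u0"
    "\<And>x. x \<in> W \<Longrightarrow> \<Gamma> x \<in> U" "\<And>x l. x \<in> W \<Longrightarrow> l < m \<Longrightarrow> F (\<Gamma> x) l = F u0 l"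
    "\<And>v. v \<in> Rn n \<Longrightarrow> \<forall>l<m. deriv_map n F u0 v l = 0 \<Longrightarrow> deriv_map n \<Gamma> u0 v = v"
proof -
  have "\<exists>W \<Gamma>. openin (Euclidean_space n) W \<and> u0 \<in> W \<and> (\<forall>j. smooth_on n W (\<lambda>x. \<Gamma> x j)) \<and> \<Gamma> u0 = u0 \<and>
    (\<forall>x\<in>W. \<Gamma> x \<in> U \<and> (\<forall>l<k. F (\<Gamma> x) l = F u0 l)) \<and>
    (\<forall>v\<in>Rn n. (\<forall>l<k. deriv_map n F u0 v l = 0) \<longrightarrow> deriv_map n \<Gamma> u0 v = v)" if "k \<le> m" for k
    using that
  proof (induction k)
    case 0
    show ?case
      using U smooth_on_coord[OF U(1)]
        by (intro exI[of _ U] exI[of _ "\<lambda>x. x"]) (auto simp: deriv_map_id)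
  next
    case (Suc k)
    then obtain W \<Gamma> where W: "openin (Euclidean_space n) W" "u0 \<in> W"
        and sm: "\<And>j. smooth_on n W (\<lambda>x. \<Gamma> x j)"
      and \<Gamma>0: "\<Gamma> u0 = u0" and \<Gamma>: "\<And>x. x \<in> W \<Longrightarrow> \<Gamma> x \<in> U \<and> (\<forall>l<k. F (\<Gamma> x) l = F u0 l)"
      and D: "\<And>v. v \<in> Rn n \<Longrightarrow> \<forall>l<k. deriv_map n F u0 v l = 0 \<Longrightarrow> deriv_map n \<Gamma> u0 v = v"
      by (metis Suc_leD)
    have k: "k < m"
      using Suc.prems by simp
    have \<Gamma>U: "\<Gamma> x \<in> U" if "x \<in> W" for x
      using \<Gamma>[OF that] by simp
    define f where "f x = F (\<Gamma> x) k" for x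
    have f: "smooth_on n W f"
      unfolding f_def using smooth_on_comp[OF F[OF k] W(1) sm \<Gamma>U] .
    \<comment> \<open>The derivative of \<open>\<Gamma>\<close> fixes the vectors killed by the
      first \<open>k\<close> differentials, so on them \<open>f\<close> has the same differential as
      component \<open>k\<close> of \<open>F\<close>.\<close>
    have df: "(\<Sum>i<n. partial_deriv i f u0 * v i) = deriv_map n F u0 v k"
      if v: "v \<in> Rn n" "\<forall>l<k. deriv_map n F u0 v l = 0" for v
    proof -
      have "(\<Sum>i<n. partial_deriv i f u0 * v i) = deriv_map n (\<lambda>x. F (\<Gamma> x)) u0 v k"
        by (simp add: deriv_map_def f_def[abs_def])
      also have "\<dots> = deriv_map n F (\<Gamma> u0) (deriv_map n \<Gamma> u0 v) k"
        by (rule deriv_map_comp[of n U F k n W \<Gamma>, OF F[OF k] W(1) sm \<Gamma>U W(2)])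
      finally show ?thesis
        by (simp add: \<Gamma>0 D[OF v])
    qed
    \<comment> \<open>This dual vector is killed by the first \<open>k\<close> differentials but not
      by the next one, so the new equation is nondegenerate on the level set found so far.\<close>
    obtain w where w: "w \<in> Rn n" "\<forall>l'<m. deriv_map n F u0 w l' = (if l' = k then 1 else 0)"
      using surj[OF k] by blast
    have "(\<Sum>i<n. partial_deriv i f u0 * w i) \<noteq> 0"
      using df[of w] w k by auto
    then obtain W' \<psi> where W': "openin (Euclidean_space n) W'" "u0 \<in> W'"
        and \<psi>s: "\<And>j. smooth_on n W' (\<lambda>x. \<psi> x j)"
      and \<psi>0: "\<psi> u0 = u0" and \<psi>: "\<And>x. x \<in> W' \<Longrightarrow> \<psi> x \<in> W \<and> f (\<psi> x) = f u0"
      and \<psi>D: "\<And>v. v \<in> Rn n \<Longrightarrow> (\<Sum>i<n. partial_deriv i f u0 * v i) = 0 \<Longrightarrow> deriv_map n \<psi> u0 v = v"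
      using hypersurface_parametrization[OF f W(2), of w] by blast
    have \<psi>W: "\<psi> x \<in> W" if "x \<in> W'" for x
      using \<psi>[OF that] by simp
    show ?case
    proof (intro exI[of _ W'] exI[of _ "\<lambda>x. \<Gamma> (\<psi> x)"] conjI allI ballI impI)
      show "smooth_on n W' (\<lambda>x. \<Gamma> (\<psi> x) j)" for j
        using smooth_on_comp[OF sm W'(1) \<psi>s \<psi>W] .
      show "\<Gamma> (\<psi> u0) = u0"
        by (simp add: \<psi>0 \<Gamma>0)
      show "\<Gamma> (\<psi> x) \<in> U" if "x \<in> W'" for x
        using \<Gamma>U \<psi>W that by blast
      show "F (\<Gamma> (\<psi> x)) l = F u0 l" if "x \<in> W'" "l < Suc k" for x l
        using \<Gamma>[OF \<psi>W[OF that(1)]] \<psi>[OF that(1)] that(2) by (auto simp: less_Suc_eq f_def \<Gamma>0)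
      show "deriv_map n (\<lambda>x. \<Gamma> (\<psi> x)) u0 v = v"
          if v: "v \<in> Rn n" "\<forall>l<Suc k. deriv_map n F u0 v l = 0" for v
      proof
        fix j
        have 1: "\<forall>l<k. deriv_map n F u0 v l = 0"
          using v(2) by simp
        have "deriv_map n (\<lambda>x. \<Gamma> (\<psi> x)) u0 v j = deriv_map n \<Gamma> (\<psi> u0) (deriv_map n \<psi> u0 v) j"
          by (rule deriv_map_comp[of n W \<Gamma> j n W' \<psi>, OF sm W'(1) \<psi>s \<psi>W W'(2)])
        also have "\<dots> = v j"
          using \<psi>D[OF v(1)] df[OF v(1) 1] v(2) D[OF v(1) 1] by (simp add: \<psi>0)
        finally show "deriv_map n (\<lambda>x. \<Gamma> (\<psi> x)) u0 v j = v j" .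
      qed
    qed (use W' in auto)
  qed
  from this[OF order_refl] show thesis
    using that by blast
qed

section \<open>Dimension and positive definite forms\<close>

text \<open>The coordinates of \<open>x\<close> with respect to \<open>B\<close> vanish off
  \<open>B0\<close> and off \<open>C\<close>, hence everywhere.\<close>

lemma span_Int_independent_disjoint:
  assumes "independent B" "B0 \<subseteq> B" "C \<subseteq> B" "B0 \<inter> C = {}" "x \<in> span B0" "x \<in> span C"
  shows "x = 0"
proof -
  have ind: "independent B0"
    using assms(1,2) independent_mono by blast
  have "representation B x = representation B0 x" "representation B x = representation C x"
    using representation_extend[OF assms(1,5,2)] representation_extend[OF assms(1,6,3)] by auto
  then have "representation B0 x b = 0" for b
    using representation_ne_zero[of B0 x b] representation_ne_zero[of C x b] assms(4) by auto
  then show ?thesis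
    using sum_nonzero_representation_eq[OF ind assms(5)] by simp
qed

text \<open>Most of the library's facts about \<open>dim\<close> need a type of finite dimension, which excludes \<open>vec\<close>.\<close>

definition finite_span :: "'a::real_vector set \<Rightarrow> bool"
  where "finite_span S \<longleftrightarrow> (\<exists>T. finite T \<and> S \<subseteq> span T)"

lemma finite_span_subset: "finite_span T \<Longrightarrow> S \<subseteq> T \<Longrightarrow> finite_span S"
  by (auto simp: finite_span_def)

lemma finite_span_independent: "finite_span S \<Longrightarrow> independent B \<Longrightarrow> B \<subseteq> S \<Longrightarrow> finite B"
  unfolding finite_span_def using independent_span_bound by blast

lemma finite_span_image:
  assumes "linear f" "finite_span S"
  shows "finite_span (f ` S)"
proof -
  obtain T where "finite T" "S \<subseteq> span T"
    using assms(2) by (auto simp: finite_span_def)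
  then have "f ` S \<subseteq> span (f ` T)"
    using linear_span_image[OF assms(1)] by blast
  then show ?thesis
    using \<open>finite T\<close> by (auto simp: finite_span_def)
qed

text \<open>An infinite basis has \<open>card\<close> 0, so monotonicity of \<open>dim\<close> can
  fail if the larger set is not of finite span.\<close>

lemma dim_mono_finite_span:
  fixes S T :: "'a::real_vector set"
  assumes "finite_span T" "S \<subseteq> T"
  shows "dim S \<le> dim T"
proof -
  obtain B where B: "B \<subseteq> S" "independent B" "card B = dim S"
    using basis_exists[of S] by metis
  obtain C where C: "C \<subseteq> T" "independent C" "T \<subseteq> span C" "card C = dim T"
    using basis_exists[of T] by metis
  have "finite C"
    using finite_span_independent[OF assms(1) C(2,1)] .
  then show ?thesis
    using independent_span_bound[of C B] B C assms(2) by auto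
qed

text \<open>Extend a basis \<open>B0\<close> of the kernel to a basis \<open>B\<close> of
  \<open>S\<close>. The span of the added vectors meets that of \<open>B0\<close> only in 0, so
  \<open>f\<close> is injective on it, and the images of the added vectors form a basis of the
  image.\<close>

lemma dim_image_plus_dim_kernel:
  fixes f :: "'a::real_vector \<Rightarrow> 'b::real_vector"
  assumes f: "linear f" and S: "subspace S" and fin: "finite_span S"
  shows "dim S = dim (f ` S) + dim {x\<in>S. f x = 0}"
proof -
  let ?K = "{x\<in>S. f x = 0}"
  obtain B0 where B0: "B0 \<subseteq> ?K" "independent B0" "?K \<subseteq> span B0" "card B0 = dim ?K"
    by (rule basis_exists[of ?K])
  obtain B where B: "B0 \<subseteq> B" "B \<subseteq> S" "independent B" "S \<subseteq> span B"
    using maximal_independent_subset_extend[of B0 S] B0 by blast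
  have finB: "finite B"
    using finite_span_independent[OF fin B(3,2)] .
  define C where "C = B - B0"
  have spC: "span C \<subseteq> S"
    using span_minimal[of C S] B(2) S by (auto simp: C_def)
  have inj: "inj_on f (span C)"
  proof (subst linear_inj_on_iff_eq_0[OF f subspace_span], intro ballI impI)
    fix x assume "x \<in> span C" "f x = 0"
    then have "x \<in> span B0"
      using spC B0(3) by blast
    then show "x = 0"
      using \<open>x \<in> span C\<close> span_Int_independent_disjoint[OF B(3,1), of C] by (auto simp: C_def)
  qed
  have indC: "independent C"
    unfolding C_def by (rule independent_mono[OF B(3)]) auto
  have "f ` S \<subseteq> span (f ` C)"
  proof -
    have "f ` B \<subseteq> span (f ` C)"
    proof
      fix y assume "y \<in> f ` B"
      then obtain b where "b \<in> B" "y = f b"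
        by blast
      then show "y \<in> span (f ` C)"
        using B0(1) by (cases "b \<in> B0") (auto simp: C_def span_zero intro: span_base)
    qed
    then have "span (f ` B) \<subseteq> span (f ` C)"
      by (rule span_minimal[OF _ subspace_span])
    then show ?thesis
      using B(4) linear_span_image[OF f, of B] by blast
  qed
  moreover have "f ` C \<subseteq> f ` S"
    using B(2) by (auto simp: C_def)
  moreover have "independent (f ` C)"
    using linear_independent_injective_image[OF f indC inj] .
  ultimately have "dim (f ` S) = card (f ` C)"
    by (intro dim_unique) auto
  also have "\<dots> = card C"
    using inj inj_on_subset[OF inj span_superset] by (intro card_image)
  finally have "dim (f ` S) = card C" .
  moreover have "dim S = card B"
    using dim_unique[of B S] B by auto
  moreover have "card B = card C + card B0"
    using finB B(1) by (simp add: C_def card_Diff_subset finite_subset card_mono)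
  ultimately show ?thesis
    using B0(4) by simp
qed

lemma dim_linear_image_inj:
  assumes "linear f" "subspace S" "finite_span S" "\<And>x. x \<in> S \<Longrightarrow> f x = 0 \<Longrightarrow> x = 0"
  shows "dim (f ` S) = dim S"
proof -
  have "{x\<in>S. f x = 0} = {0}"
    using assms(4) subspace_0[OF assms(2)] linear_0[OF assms(1)] by auto
  moreover have "dim {0::'a} = 0"
    using dim_unique[of "{}" "{0::'a}" 0] independent_empty by (simp add: span_empty)
  ultimately show ?thesis
    using dim_image_plus_dim_kernel[OF assms(1-3)] by simp
qed

lemma linear_snd_prod: "linear snd"
  by (auto intro!: linearI)

lemma linear_Pair0: "linear (\<lambda>x. (x, 0))"
  by (auto intro!: linearI)

lemma finite_span_Times:
  assumes "finite_span S" "finite_span T"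
  shows "finite_span (S \<times> T)"
proof -
  obtain A B where A: "finite A" "S \<subseteq> span A" and B: "finite B" "T \<subseteq> span B"
    using assms by (auto simp: finite_span_def)
  have 1: "linear (\<lambda>x::'a. (x, 0::'b))" "linear (\<lambda>y::'b. (0::'a, y))"
    by (auto intro!: linearI)
  have "(x, y) \<in> span ((\<lambda>x. (x, 0)) ` A \<union> (\<lambda>y. (0, y)) ` B)" if "x \<in> S" "y \<in> T" for x y
  proof -
    have "(x, 0) \<in> span ((\<lambda>x. (x, 0::'b)) ` A)" "(0, y) \<in> span ((\<lambda>y. (0::'a, y)) ` B)"
      using linear_span_image[OF 1(1)] linear_span_image[OF 1(2)] A B that by blast+
    then have "(x, 0) + (0, y) \<in> span ((\<lambda>x. (x, 0)) ` A \<union> (\<lambda>y. (0, y)) ` B)"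
      by (intro span_add) (meson Un_upper1 Un_upper2 span_mono subsetD)+
    then show ?thesis
      by simp
  qed
  then show ?thesis
    using A B unfolding finite_span_def
    by (intro exI[of _ "(\<lambda>x. (x, 0)) ` A \<union> (\<lambda>y. (0, y)) ` B"]) auto
qed

text \<open>Addition is injective on the product of \<open>S\<close> and \<open>K\<close> because
  they meet only in 0, and the dimension of the product is counted by the second projection.\<close>

lemma dim_direct_sum:
  fixes S K :: "'a::real_vector set"
  assumes S: "subspace S" "finite_span S" and K: "subspace K" "finite_span K" and SK: "S \<inter> K \<subseteq> {0}"
  shows "dim S + dim K = dim {x + y | x y. x \<in> S \<and> y \<in> K}"
proof -
  have SxK: "subspace (S \<times> K)" "finite_span (S \<times> K)"
    using S K by (auto intro: subspace_Times finite_span_Times)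
  have add: "linear (\<lambda>z::'a \<times> 'a. fst z + snd z)"
    by (auto intro!: linearI simp: algebra_simps scaleR_add_right)
  have "dim ((\<lambda>z. fst z + snd z) ` (S \<times> K)) = dim (S \<times> K)"
  proof (rule dim_linear_image_inj[OF add SxK])
    fix z assume z: "z \<in> S \<times> K" "fst z + snd z = 0"
    then have "snd z = - fst z"
      by (simp add: eq_neg_iff_add_eq_0 add.commute)
    then have "snd z \<in> S \<inter> K"
      using z(1) subspace_neg[OF S(1)] by auto
    then show "z = 0"
      using SK z(2) by (auto simp: prod_eq_iff)
  qed
  moreover have "(\<lambda>z. fst z + snd z) ` (S \<times> K) = {x + y | x y. x \<in> S \<and> y \<in> K}"
    by force
  moreover have "dim (S \<times> K) = dim (snd ` (S \<times> K)) + dim {z \<in> S \<times> K. snd z = 0}"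
    by (rule dim_image_plus_dim_kernel[OF linear_snd_prod SxK])
  moreover have "snd ` (S \<times> K) = K"
    using subspace_0[OF S(1)] by force
  moreover have "{z \<in> S \<times> K. snd z = 0} = (\<lambda>x. (x, 0)) ` S"
    using subspace_0[OF K(1)] by auto
  moreover have "dim ((\<lambda>x. (x, 0::'a)) ` S) = dim S"
    by (rule dim_linear_image_inj[OF linear_Pair0 S]) (auto simp: zero_prod_def)
  ultimately show ?thesis
    by simp
qed

lemma subspace_Rn: "subspace (Rn n)"
  by (auto simp: subspace_def Rn_iff scaleR_fun_def)

lemma Rn_expansion: "v \<in> Rn n \<Longrightarrow> v = (\<Sum>i<n. v i *\<^sub>R (\<lambda>j. if j = i then 1 else 0))"
proof
  fix j assume v: "v \<in> Rn n"
  have "(\<Sum>i<n. v i *\<^sub>R (\<lambda>j. if j = i then 1 else 0)) j = (\<Sum>i<n. v i * (if j = i then 1 else 0))"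
    by (induction n) (auto simp: scaleR_fun_def)
  also have "\<dots> = v j"
    using v by (auto simp: Rn_iff if_distrib[of "\<lambda>x. _ * x"] cong: if_cong)
  finally show "v j = (\<Sum>i<n. v i *\<^sub>R (\<lambda>j. if j = i then 1 else 0)) j" ..
qed

lemma finite_span_Rn: "finite_span (Rn n)"
  unfolding finite_span_def
proof (intro exI conjI subsetI)
  fix v assume "v \<in> Rn n"
  show "v \<in> span ((\<lambda>i j. if j = i then 1 else 0) ` {..<n})"
    by (subst Rn_expansion[OF \<open>v \<in> Rn n\<close>]) (intro span_sum span_scale span_base; simp)
qed simp

section \<open>Bilinear forms and orthogonality\<close>

context
  fixes V :: "'a::real_vector set" and b :: "'a \<Rightarrow> 'a \<Rightarrow> real"
  assumes V: "subspace V" and bil: "bilinear_form_on V b"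
begin

lemma bilinear_form_add:
  "u \<in> V \<Longrightarrow> v \<in> V \<Longrightarrow> w \<in> V \<Longrightarrow> b (u + v) w = b u w + b v w"
  "u \<in> V \<Longrightarrow> v \<in> V \<Longrightarrow> w \<in> V \<Longrightarrow> b w (u + v) = b w u + b w v"
  using bil by (simp_all add: bilinear_form_on_def)

lemma bilinear_form_scale:
  "v \<in> V \<Longrightarrow> w \<in> V \<Longrightarrow> b (a *\<^sub>R v) w = a * b v w"
  "v \<in> V \<Longrightarrow> w \<in> V \<Longrightarrow> b v (a *\<^sub>R w) = a * b v w"
  using bil by (simp_all add: bilinear_form_on_def)

lemma bilinear_form_zero: "w \<in> V \<Longrightarrow> b 0 w = 0" "w \<in> V \<Longrightarrow> b w 0 = 0"
  using bilinear_form_scale[of w w 0] by simp_all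

lemma bilinear_form_diff:
  "u \<in> V \<Longrightarrow> v \<in> V \<Longrightarrow> w \<in> V \<Longrightarrow> b (u - v) w = b u w - b v w"
  using bilinear_form_add(1)[of "u - v" v w] subspace_diff[OF V] by auto

lemma bilinear_form_sum:
  assumes "w \<in> V" "\<And>i. i \<in> A \<Longrightarrow> e i \<in> V"
  shows "b (\<Sum>i\<in>A. a i *\<^sub>R e i) w = (\<Sum>i\<in>A. a i * b (e i) w)"
    and "b w (\<Sum>i\<in>A. a i *\<^sub>R e i) = (\<Sum>i\<in>A. a i * b w (e i))"
proof -
  have "b (\<Sum>i\<in>A. a i *\<^sub>R e i) w = (\<Sum>i\<in>A. a i * b (e i) w) \<and> b w (\<Sum>i\<in>A. a i *\<^sub>R e i) =
      (\<Sum>i\<in>A. a i * b w (e i))"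
    using assms(2)
  proof (induction A rule: infinite_finite_induct)
    case (insert x F)
    have "(\<Sum>i\<in>F. a i *\<^sub>R e i) \<in> V"
      using insert.prems by (intro subspace_sum[OF V] subspace_scale[OF V]) auto
    moreover have "a x *\<^sub>R e x \<in> V" "e x \<in> V"
      using insert.prems by (auto intro: subspace_scale[OF V])
    ultimately show ?case
      using insert assms(1) by (simp add: bilinear_form_add bilinear_form_scale)
  qed (simp_all add: bilinear_form_zero assms(1))
  then show "b (\<Sum>i\<in>A. a i *\<^sub>R e i) w = (\<Sum>i\<in>A. a i * b (e i) w)"
    and "b w (\<Sum>i\<in>A. a i *\<^sub>R e i) = (\<Sum>i\<in>A. a i * b w (e i))"
    by auto
qed

text \<open>The vectors orthogonal to the residual form a subspace that contains every
  \<open>e j\<close>, hence their span.\<close>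

lemma orthonormal_projection:
  fixes e :: "nat \<Rightarrow> 'a"
  assumes e: "\<And>i. i < k \<Longrightarrow> e i \<in> V"
    and on: "\<And>i j. i < k \<Longrightarrow> j < k \<Longrightarrow> b (e i) (e j) = (if i = j then 1 else 0)"
    and v: "v \<in> V" and a: "a \<in> span (e ` {..<k})"
  shows "b (v - (\<Sum>i<k. b v (e i) *\<^sub>R e i)) a = 0"
proof -
  define p where "p = (\<Sum>i<k. b v (e i) *\<^sub>R e i)"
  have p: "p \<in> V"
    unfolding p_def using e by (intro subspace_sum[OF V] subspace_scale[OF V]) auto
  have vp: "v - p \<in> V"
    using subspace_diff[OF V v p] .
  have "e ` {..<k} \<subseteq> {a\<in>V. b (v - p) a = 0}"
  proof
    fix x assume "x \<in> e ` {..<k}"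
    then obtain j where j: "j < k" "x = e j"
      by blast
    have "b p (e j) = (\<Sum>i<k. b v (e i) * b (e i) (e j))"
      unfolding p_def using e j by (intro bilinear_form_sum) auto
    also have "\<dots> = (\<Sum>i<k. if i = j then b v (e j) else 0)"
      using on j by (intro sum.cong) auto
    also have "\<dots> = b v (e j)"
      using j by simp
    finally show "x \<in> {a\<in>V. b (v - p) a = 0}"
      using j e v p by (simp add: bilinear_form_diff)
  qed
  moreover have "subspace {a\<in>V. b (v - p) a = 0}"
    using V vp unfolding subspace_def
    by (auto simp: bilinear_form_zero bilinear_form_add bilinear_form_scale)
  ultimately have "span (e ` {..<k}) \<subseteq> {a\<in>V. b (v - p) a = 0}"
    by (rule span_minimal)
  then show ?thesis
    using a by (auto simp: p_def)
qed

text \<open>Gram-Schmidt. A vector that depends on the earlier ones has residual 0 and is skipped,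
  which is why \<open>k\<close> is not tied to the cardinality of \<open>T\<close>.\<close>

lemma orthonormal_family_exists:
  assumes sym: "symmetric_form_on V b" and pos: "\<And>v. v \<in> V \<Longrightarrow> v \<noteq> 0 \<Longrightarrow> b v v > 0"
    and T: "finite T" "T \<subseteq> V"
  shows "\<exists>k e. (\<forall>i<k. e i \<in> V) \<and> (\<forall>i<k. \<forall>j<k. b (e i) (e j) = (if i = j then 1 else 0)) \<and>
    span (e ` {..<k::nat}) = span T"
  using T
proof (induction T rule: finite_induct)
  case empty
  show ?case
    by (intro exI[of _ 0]) auto
next
  case (insert x T)
  then obtain k and e :: "nat \<Rightarrow> 'a" where e: "\<And>i. i < k \<Longrightarrow> e i \<in> V"
    and on: "\<And>i j. i < k \<Longrightarrow> j < k \<Longrightarrow> b (e i) (e j) = (if i = j then 1 else 0)"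
    and sp: "span (e ` {..<k}) = span T"
    by (metis insert_subset)
  have x: "x \<in> V"
    using insert by simp
  define p where "p = (\<Sum>i<k. b x (e i) *\<^sub>R e i)"
  have psp: "p \<in> span T"
    unfolding sp[symmetric] p_def by (intro span_sum span_scale span_base) auto
  have pV: "p \<in> V"
    unfolding p_def using e by (intro subspace_sum[OF V] subspace_scale[OF V]) auto
  define y where "y = x - p"
  have y: "y \<in> V"
    using subspace_diff[OF V x pV] by (simp add: y_def)
  have orth: "b y a = 0" if "a \<in> span T" for a
    using orthonormal_projection[of k e, OF e on x] that sp by (simp add: y_def p_def)
  show ?case
  proof (cases "y = 0")
    case True
    then have "x \<in> span T"
      using psp by (simp add: y_def)
    then have "span (insert x T) = span T"
      by (rule span_redundant)
    then show ?thesis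
      using e on sp by blast
  next
    case False
    then have bp: "b y y > 0"
      using pos y by blast
    define z where "z = inverse (sqrt (b y y)) *\<^sub>R y"
    have z: "z \<in> V"
      using subspace_scale[OF V y] by (simp add: z_def)
    have zz: "b z z = 1"
      using y bp subspace_scale[OF V y]
        by (simp add: z_def bilinear_form_scale field_simps flip: power2_eq_square)
    define e' where "e' = e(k := z)"
    have ze: "b z (e j) = 0 \<and> b (e j) z = 0" if "j < k" for j
    proof -
      have "e j \<in> span T"
        using that by (auto simp flip: sp intro: span_base)
      then have "b z (e j) = 0"
        using orth e[OF that] y by (simp add: z_def bilinear_form_scale)
      then show ?thesis
        using sym z e[OF that] by (auto simp: symmetric_form_on_def)
    qed
    have yz: "y = sqrt (b y y) *\<^sub>R z"
      using bp by (simp add: z_def)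
    have "span (insert z (e ` {..<k})) = span (insert x T)"
    proof (rule antisym; rule span_minimal[OF _ subspace_span])
      have "y \<in> span (insert x T)"
        unfolding y_def using psp span_mono[of T "insert x T"]
          by (intro span_diff) (auto intro: span_base)
      moreover have "e ` {..<k} \<subseteq> span (insert x T)"
        using span_superset[of "e ` {..<k}"] sp span_mono[of T "insert x T"] by blast
      ultimately show "insert z (e ` {..<k}) \<subseteq> span (insert x T)"
        by (auto simp: z_def intro: span_scale)
      have T: "span T \<subseteq> span (insert z (e ` {..<k}))"
        unfolding sp[symmetric] by (rule span_mono) auto
      have "y \<in> span (insert z (e ` {..<k}))"
        by (subst yz) (intro span_scale span_base; simp)
      then have "y + p \<in> span (insert z (e ` {..<k}))"
        using psp T by (intro span_add) auto
      then show "insert x T \<subseteq> span (insert z (e ` {..<k}))"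
        using T span_superset[of T] by (auto simp: y_def)
    qed
    moreover have "e' ` {..<Suc k} = insert z (e ` {..<k})"
      by (auto simp: e'_def lessThan_Suc)
    ultimately have "span (e' ` {..<Suc k}) = span (insert x T)"
      by simp
    moreover have "\<forall>i<Suc k. e' i \<in> V"
      using e z by (auto simp: e'_def less_Suc_eq)
    moreover have "\<forall>i<Suc k. \<forall>j<Suc k. b (e' i) (e' j) = (if i = j then 1 else 0)"
      using on ze zz by (auto simp: e'_def less_Suc_eq)
    ultimately show ?thesis
      by blast
  qed
qed

lemma orthonormal_basis_exists:
  assumes sym: "symmetric_form_on V b" and pos: "\<And>v. v \<in> V \<Longrightarrow> v \<noteq> 0 \<Longrightarrow> b v v > 0"
    and S: "subspace S" "finite_span S" "S \<subseteq> V"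
  obtains k and e :: "nat \<Rightarrow> 'a" where "\<And>i. i < k \<Longrightarrow> e i \<in> S" "span (e ` {..<k}) = S"
    "\<And>i j. i < k \<Longrightarrow> j < k \<Longrightarrow> b (e i) (e j) = (if i = j then 1 else 0)"
proof -
  obtain B where B: "B \<subseteq> S" "independent B" "S \<subseteq> span B"
    using basis_exists[of S] by metis
  have "finite B"
    using finite_span_independent[OF S(2) B(2,1)] .
  then obtain k and e :: "nat \<Rightarrow> 'a"
    where e: "\<forall>i<k. \<forall>j<k. b (e i) (e j) = (if i = j then 1 else 0)"
      and sp: "span (e ` {..<k}) = span B"
    using orthonormal_family_exists[OF sym pos, of B] order_trans[OF B(1) S(3)] by blast
  have "span B = S"
    using span_minimal[OF B(1) S(1)] B(3) by blast
  then have "span (e ` {..<k}) = S"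
    using sp by simp
  moreover have "e i \<in> S" if "i < k" for i
    unfolding calculation[symmetric] using that by (intro span_base) auto
  ultimately show thesis
    using that[of k e] e by blast
qed

text \<open>The residual of the projection to an orthonormal basis of \<open>S\<close> is one
  solution. The difference of two solutions lies in \<open>S\<close> and is orthogonal to
  \<open>S\<close>, so it is 0 by definiteness. Unique existence is what the definite description in
  \<open>perp\<close> asks for.\<close>

lemma orthogonal_decomposition:
  assumes sym: "symmetric_form_on V b" and pos: "\<And>v. v \<in> V \<Longrightarrow> v \<noteq> 0 \<Longrightarrow> b v v > 0"
    and S: "subspace S" "finite_span S" "S \<subseteq> V" and v: "v \<in> V"
  shows "\<exists>!u. u \<in> V \<and> (\<forall>a\<in>S. b u a = 0) \<and> v - u \<in> S"
proof -
  obtain k and e :: "nat \<Rightarrow> 'a" where e: "\<And>i. i < k \<Longrightarrow> e i \<in> S" and sp: "span (e ` {..<k}) = S"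
    and on: "\<And>i j. i < k \<Longrightarrow> j < k \<Longrightarrow> b (e i) (e j) = (if i = j then 1 else 0)"
    using orthonormal_basis_exists[OF sym pos S] by blast
  define p where "p = (\<Sum>i<k. b v (e i) *\<^sub>R e i)"
  have p: "p \<in> S"
    unfolding p_def using e by (intro subspace_sum[OF S(1)] subspace_scale[OF S(1)]) auto
  have eV: "e i \<in> V" if "i < k" for i
    using e[OF that] S(3) by blast
  have "v - p \<in> V" "\<forall>a\<in>S. b (v - p) a = 0"
    using subspace_diff[OF V v] p S(3) orthonormal_projection[of k e v, OF eV on v] sp
      by (auto simp: p_def)
  moreover have "u = v - p" if u: "u \<in> V" "\<forall>a\<in>S. b u a = 0" "v - u \<in> S" for u
  proof (rule ccontr)
    assume "u \<noteq> v - p"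
    then have ne: "u - (v - p) \<noteq> 0"
      by simp
    have s: "u - (v - p) \<in> S"
      using subspace_diff[OF S(1) p u(3)] by (simp add: algebra_simps)
    have "b (u - (v - p)) (u - (v - p)) = 0"
      using u(1,2) calculation s S(3) by (subst bilinear_form_diff) auto
    moreover have "b (u - (v - p)) (u - (v - p)) > 0"
      using pos[OF _ ne] s S(3) by blast
    ultimately show False
      by simp
  qed
  moreover have "v - (v - p) \<in> S"
    using p by simp
  ultimately show ?thesis
    by blast
qed

end

lemma bilinear_form_on_subset: "bilinear_form_on V b \<Longrightarrow> S \<subseteq> V \<Longrightarrow> bilinear_form_on S b"
  unfolding bilinear_form_on_def by blast

lemma symmetric_form_on_subset: "symmetric_form_on V b \<Longrightarrow> S \<subseteq> V \<Longrightarrow> symmetric_form_on S b"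
  unfolding symmetric_form_on_def by blast

text \<open>In a basis orthonormal at \<open>r0\<close>, the Gram matrix of \<open>Q r\<close> is
  the identity at \<open>r0\<close> and varies continuously. As long as its entries differ from
  those of the identity by less than 1 in total, \<open>Q r v v\<close> is positive for all nonzero
  \<open>v\<close> at once.\<close>

lemma positive_definite_open:
  fixes S :: "'a::real_vector set"
  assumes U: "openin (Euclidean_space n) U" "r0 \<in> U"
    and bil: "\<And>r. r \<in> U \<Longrightarrow> bilinear_form_on S (Q r)"
    and cont: "\<And>v w. v \<in> S \<Longrightarrow> w \<in> S \<Longrightarrow> continuous_on U (\<lambda>r. Q r v w)"
    and sym: "symmetric_form_on S (Q r0)" and S: "subspace S" "finite_span S"
    and pos: "\<And>v. v \<in> S \<Longrightarrow> v \<noteq> 0 \<Longrightarrow> Q r0 v v > 0"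
  obtains N where "openin (Euclidean_space n) N" "r0 \<in> N" "N \<subseteq> U"
    "\<And>r v. r \<in> N \<Longrightarrow> v \<in> S \<Longrightarrow> v \<noteq> 0 \<Longrightarrow> Q r v v > (0::real)"
proof -
  obtain k and e :: "nat \<Rightarrow> 'a" where e: "\<And>i. i < k \<Longrightarrow> e i \<in> S" and sp: "span (e ` {..<k}) = S"
    and on: "\<And>i j. i < k \<Longrightarrow> j < k \<Longrightarrow> Q r0 (e i) (e j) = (if i = j then 1 else 0)"
    using orthonormal_basis_exists[OF S(1) bil[OF U(2)] sym pos S subset_refl] by blast
  define \<delta> :: "nat \<Rightarrow> nat \<Rightarrow> real" where "\<delta> i j = (if i = j then 1 else 0)" for i j
  define h where "h r = (\<Sum>i<k. \<Sum>j<k. \<bar>Q r (e i) (e j) - \<delta> i j\<bar>)" for r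
  have "continuous_on U h"
    unfolding h_def using e by (intro continuous_intros cont) auto
  then obtain d where d: "d > 0" "cube n r0 d \<subseteq> U" "\<And>r. r \<in> cube n r0 d \<Longrightarrow> \<bar>h r - h r0\<bar> < 1"
    using continuous_cube[OF U, of h 1] by (metis zero_less_one)
  have h0: "h r0 = 0"
    using on by (simp add: h_def \<delta>_def)
  have *: "Q r v v > 0" if r: "r \<in> cube n r0 d" and v: "v \<in> S" "v \<noteq> 0" for r v
  proof -
    have rU: "r \<in> U"
      using r d(2) by blast
    define a where "a i = Q r0 v (e i)" for i
    \<comment> \<open>The residual lies in \<open>S\<close>, which is the span of the family, and is
      orthogonal to that span, so definiteness at \<open>r0\<close> makes it 0.\<close>
    have v_eq: "v = (\<Sum>i<k. a i *\<^sub>R e i)"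
    proof (rule ccontr)
      assume ne: "\<not> ?thesis"
      have s: "v - (\<Sum>i<k. a i *\<^sub>R e i) \<in> S"
        using e v(1) by (intro subspace_diff[OF S(1)] subspace_sum[OF S(1)] subspace_scale[OF S(1)])
            auto
      have "Q r0 (v - (\<Sum>i<k. a i *\<^sub>R e i)) (v - (\<Sum>i<k. a i *\<^sub>R e i)) = 0"
        using orthonormal_projection[OF S(1) bil[OF U(2)] e on v(1), of k] s sp by (simp add: a_def)
      moreover have "Q r0 (v - (\<Sum>i<k. a i *\<^sub>R e i)) (v - (\<Sum>i<k. a i *\<^sub>R e i)) > 0"
        using pos[OF s] ne by simp
      ultimately show False
        by simp
    qed
    \<comment> \<open>This is \<open>Q r0 v v\<close> in orthonormal coordinates. It bounds every
      product \<open>a i * a j\<close> in absolute value, so \<open>Q r v v\<close> differs from it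
      by at most \<open>A * h r\<close>.\<close>
    define A where "A = (\<Sum>i<k. (a i)\<^sup>2)"
    have "A \<noteq> 0"
    proof
      assume "A = 0"
      then have "\<forall>i<k. a i = 0"
        by (auto simp: A_def sum_nonneg_eq_0_iff)
      then show False
        using v(2) v_eq by simp
    qed
    moreover have "A \<ge> 0"
      by (auto simp: A_def intro: sum_nonneg)
    ultimately have A: "A > 0"
      by simp
    have "Q r v v = (\<Sum>i<k. \<Sum>j<k. a i * a j * Q r (e i) (e j))"
    proof -
      have "Q r v v = (\<Sum>i<k. a i * Q r (e i) v)"
        by (subst (1) v_eq, rule bilinear_form_sum(1)[OF S(1) bil[OF rU] v(1)]) (use e in auto)
      also have "\<dots> = (\<Sum>i<k. a i * (\<Sum>j<k. a j * Q r (e i) (e j)))"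
        by (intro sum.cong refl arg_cong2[where f = "(*)"], subst v_eq,
            rule bilinear_form_sum(2)[OF S(1) bil[OF rU]]) (use e in auto)
      finally show ?thesis
        by (simp add: sum_distrib_left mult.assoc)
    qed
    also have "\<dots> = (\<Sum>i<k. \<Sum>j<k. a i * a j * \<delta> i j) +
        (\<Sum>i<k. \<Sum>j<k. a i * a j * (Q r (e i) (e j) - \<delta> i j))"
      by (simp add: algebra_simps flip: sum.distrib)
    also have "(\<Sum>i<k. \<Sum>j<k. a i * a j * \<delta> i j) = A"
      unfolding A_def \<delta>_def
        by (intro sum.cong refl) (auto simp: power2_eq_square if_distrib[of "\<lambda>x. _ * x"] cong: if_cong)
    finally have Q: "Q r v v = A + (\<Sum>i<k. \<Sum>j<k. a i * a j * (Q r (e i) (e j) - \<delta> i j))" .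
    have aa: "\<bar>a i * a j\<bar> \<le> A" if "i < k" "j < k" for i j
    proof -
      have "(a i)\<^sup>2 \<le> A" "(a j)\<^sup>2 \<le> A"
        unfolding A_def using that by (auto intro!: member_le_sum)
      then have "(\<bar>a i\<bar> * \<bar>a j\<bar>) \<le> sqrt A * sqrt A"
        using A by (intro mult_mono) (auto simp: real_le_rsqrt)
      then show ?thesis
        using A by (simp add: abs_mult)
    qed
    have "\<bar>\<Sum>i<k. \<Sum>j<k. a i * a j * (Q r (e i) (e j) - \<delta> i j)\<bar> \<le>
        (\<Sum>i<k. \<Sum>j<k. \<bar>a i * a j * (Q r (e i) (e j) - \<delta> i j)\<bar>)"
      by (intro order_trans[OF sum_abs] sum_mono sum_abs)
    also have "\<dots> \<le> (\<Sum>i<k. \<Sum>j<k. A * \<bar>Q r (e i) (e j) - \<delta> i j\<bar>)"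
      by (intro sum_mono, subst abs_mult) (auto intro!: mult_right_mono aa)
    also have "\<dots> = A * h r"
      by (simp add: h_def sum_distrib_left)
    also have "\<dots> < A * 1"
      using d(3)[OF r] h0 A by (intro mult_strict_left_mono) auto
    finally show ?thesis
      using Q by simp
  qed
  show thesis
  proof (rule that[OF openin_cube _ d(2) *])
    show "r0 \<in> cube n r0 d"
      using cube_self[OF _ d(1)] U openin_subset_Rn by blast
  qed
qed

text \<open>Both \<open>B\<close> and \<open>A - B\<close> are positive semi-definite forms, with kernels \<open>E\<close> and its orthogonal
  complement. The rank of such a form can only jump up, and the two ranks add up to \<open>n\<close>.\<close>

lemma dim_kernel_locally_constant:
  assumes U: "openin (Euclidean_space m) U" "r0 \<in> U"
    and A: "\<And>r. r \<in> U \<Longrightarrow> bilinear_form_on (Rn n) (A r)" "\<And>r. r \<in> U \<Longrightarrow> symmetric_form_on (Rn n) (A r)"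
      "\<And>r v. r \<in> U \<Longrightarrow> v \<in> Rn n \<Longrightarrow> v \<noteq> 0 \<Longrightarrow> A r v v > 0"
      "\<And>v w. v \<in> Rn n \<Longrightarrow> w \<in> Rn n \<Longrightarrow> continuous_on U (\<lambda>r. A r v w)"
    and B: "\<And>r. r \<in> U \<Longrightarrow> bilinear_form_on (Rn n) (B r)" "\<And>r. r \<in> U \<Longrightarrow> symmetric_form_on (Rn n) (B r)"
      "\<And>v w. v \<in> Rn n \<Longrightarrow> w \<in> Rn n \<Longrightarrow> continuous_on U (\<lambda>r. B r v w)"
    and E: "\<And>r. r \<in> U \<Longrightarrow> subspace (E r)" "\<And>r. r \<in> U \<Longrightarrow> E r \<subseteq> Rn n"
    and BA: "\<And>r v u. r \<in> U \<Longrightarrow> v \<in> Rn n \<Longrightarrow> u \<in> Rn n \<Longrightarrow> \<forall>a\<in>E r. A r u a = 0 \<Longrightarrow> v - u \<in> E r \<Longrightarrow>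
      B r v v = A r u u"
  obtains N where "openin (Euclidean_space m) N" "r0 \<in> N" "N \<subseteq> U" "\<And>r. r \<in> N \<Longrightarrow> dim (E r) = dim (E r0)"
proof -
  \<comment> \<open>The orthogonal complement of \<open>E r\<close> for \<open>A r\<close>. The
    quadratic form of \<open>B r\<close> agrees there with that of \<open>A r\<close>, and it
    vanishes on \<open>E r\<close>; both are instances of \<open>BA\<close>, with
    \<open>v = u\<close> and with \<open>u = 0\<close>.\<close>
  define P where "P r = {u\<in>Rn n. \<forall>a\<in>E r. A r u a = 0}" for r
  have fin: "finite_span S" if "S \<subseteq> Rn n" for S
    using finite_span_subset[OF finite_span_Rn that] .
  have PR: "P r \<subseteq> Rn n" for r
    by (auto simp: P_def)
  have subP: "subspace (P r)" if "r \<in> U" for r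
    using subspace_Rn[of n] E(2)[OF that] unfolding subspace_def P_def
    by (auto simp: bilinear_form_zero[OF subspace_Rn A(1)[OF that]] subset_iff
        bilinear_form_add[OF subspace_Rn A(1)[OF that]]
            bilinear_form_scale[OF subspace_Rn A(1)[OF that]])
  have BP: "B r u u = A r u u" if "r \<in> U" "u \<in> P r" for r u
    using BA[OF that(1), of u u] that(2) subspace_0[OF E(1)[OF that(1)]] by (simp add: P_def)
  have BE: "B r a a = 0" if "r \<in> U" "a \<in> E r" for r a
    using BA[OF that(1), of a 0] that E(2)[OF that(1)]
        bilinear_form_zero[OF subspace_Rn A(1)[OF that(1)]]
      subspace_0[OF subspace_Rn] by (simp add: subset_iff)
  have dims: "dim (E r) + dim (P r) = dim (Rn n)" if r: "r \<in> U" for r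
  proof -
    have "{x + y | x y. x \<in> E r \<and> y \<in> P r} = Rn n"
    proof (intro equalityI subsetI)
      fix v assume "v \<in> Rn n"
      then obtain u where "u \<in> Rn n" "\<forall>a\<in>E r. A r u a = 0" "v - u \<in> E r"
        using orthogonal_decomposition[OF subspace_Rn A(1)[OF r] A(2)[OF r] A(3)[OF r] E(1)[OF r]
            fin[OF E(2)[OF r]] E(2)[OF r]]
        by blast
      then have "v = (v - u) + u" "v - u \<in> E r" "u \<in> P r"
        by (auto simp: P_def)
      then show "v \<in> {x + y | x y. x \<in> E r \<and> y \<in> P r}"
        by blast
    qed (use E(2)[OF r] PR subspace_add[OF subspace_Rn] in blast)
    moreover have "E r \<inter> P r \<subseteq> {0}"
      using A(3)[OF r] E(2)[OF r] by (force simp: P_def)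
    ultimately show ?thesis
      using dim_direct_sum[OF E(1)[OF r] fin[OF E(2)[OF r]] subP[OF r] fin[OF PR]] by simp
  qed
  have le: "dim S + dim K \<le> dim (Rn n)"
    if "subspace S" "S \<subseteq> Rn n" "subspace K" "K \<subseteq> Rn n" "S \<inter> K \<subseteq> {0}" for S K
  proof -
    have "{x + y | x y. x \<in> S \<and> y \<in> K} \<subseteq> Rn n"
      using that subspace_add[OF subspace_Rn] by blast
    then show ?thesis
      using dim_direct_sum[of S K] that fin dim_mono_finite_span[OF finite_span_Rn] by simp
  qed
  \<comment> \<open>\<open>B r\<close> stays definite on the fixed space \<open>P r0\<close> but
    vanishes on \<open>E r\<close>, so the two meet only in 0 and \<open>dim (E r)\<close> cannot
    grow near \<open>r0\<close>.\<close>
  obtain N1 where N1: "openin (Euclidean_space m) N1" "r0 \<in> N1" "N1 \<subseteq> U"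
    "\<And>r v. r \<in> N1 \<Longrightarrow> v \<in> P r0 \<Longrightarrow> v \<noteq> 0 \<Longrightarrow> B r v v > 0"
  proof (rule positive_definite_open[OF U, of "P r0" B])
    show "bilinear_form_on (P r0) (B r)" if "r \<in> U" for r
      using bilinear_form_on_subset[OF B(1)[OF that] PR] .
    show "symmetric_form_on (P r0) (B r0)"
      using symmetric_form_on_subset[OF B(2)[OF U(2)] PR] .
    show "continuous_on U (\<lambda>r. B r v w)" if "v \<in> P r0" "w \<in> P r0" for v w
      using that PR by (intro B(3)) auto
    show "B r0 v v > 0" if "v \<in> P r0" "v \<noteq> 0" for v
      using BP[OF U(2) that(1)] A(3)[OF U(2) _ that(2)] PR that(1) by auto
  qed (use subP[OF U(2)] fin[OF PR] in auto)
  \<comment> \<open>The difference stays definite on the fixed space \<open>E r0\<close> but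
    vanishes on \<open>P r\<close>. So \<open>dim (P r)\<close> cannot grow, and
    \<open>dim (E r)\<close> cannot drop.\<close>
  obtain N2 where N2: "openin (Euclidean_space m) N2" "r0 \<in> N2" "N2 \<subseteq> U"
    "\<And>r v. r \<in> N2 \<Longrightarrow> v \<in> E r0 \<Longrightarrow> v \<noteq> 0 \<Longrightarrow> A r v v - B r v v > 0"
  proof (rule positive_definite_open[OF U, of "E r0" "\<lambda>r v w. A r v w - B r v w"])
    show "bilinear_form_on (E r0) (\<lambda>v w. A r v w - B r v w)" if "r \<in> U" for r
      using bilinear_form_on_subset[OF A(1)[OF that] E(2)[OF U(2)]]
          bilinear_form_on_subset[OF B(1)[OF that] E(2)[OF U(2)]]
      unfolding bilinear_form_on_def by (simp add: algebra_simps)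
    show "symmetric_form_on (E r0) (\<lambda>v w. A r0 v w - B r0 v w)"
      using symmetric_form_on_subset[OF A(2)[OF U(2)] E(2)[OF U(2)]]
          symmetric_form_on_subset[OF B(2)[OF U(2)] E(2)[OF U(2)]]
      unfolding symmetric_form_on_def by simp
    show "continuous_on U (\<lambda>r. A r v w - B r v w)" if "v \<in> E r0" "w \<in> E r0" for v w
      using that E(2)[OF U(2)] by (intro continuous_intros A(4) B(3)) auto
    show "A r0 v v - B r0 v v > 0" if "v \<in> E r0" "v \<noteq> 0" for v
      using BE[OF U(2) that(1)] A(3)[OF U(2) _ that(2)] E(2)[OF U(2)] that(1) by auto
  qed (use E(1)[OF U(2)] fin[OF E(2)[OF U(2)]] in auto)
  have *: "dim (E r) = dim (E r0)" if r: "r \<in> N1 \<inter> N2" for r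
  proof -
    have rU: "r \<in> U"
      using r N1 by blast
    have "E r \<inter> P r0 \<subseteq> {0}"
      using N1(4)[of r] BE[OF rU] r by force
    then have "dim (E r) + dim (P r0) \<le> dim (Rn n)"
      by (intro le E rU subP U PR)
    moreover have "P r \<inter> E r0 \<subseteq> {0}"
      using N2(4)[of r] BP[OF rU] r by force
    then have "dim (P r) + dim (E r0) \<le> dim (Rn n)"
      by (intro le E rU subP U PR)
    ultimately show ?thesis
      using dims[OF rU] dims[OF U(2)] by linarith
  qed
  show thesis
  proof (rule that[OF _ _ _ *])
    show "openin (Euclidean_space m) (N1 \<inter> N2)" "r0 \<in> N1 \<inter> N2" "N1 \<inter> N2 \<subseteq> U"
      using N1(1-3) N2(1-3) by auto
  qed
qed

section \<open>Manifolds\<close>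

lemma
  assumes "smooth_manifold M" "c \<in> atlas M"
  shows smooth_manifold_open_chart: "openin (mtop M) (fst c)"
    and smooth_manifold_open_image: "openin (Euclidean_space (mdim M)) (snd c ` fst c)"
    and smooth_manifold_homeo: "homeomorphic_map (subtopology (mtop M) (fst c))
      (subtopology (Euclidean_space (mdim M)) (snd c ` fst c)) (snd c)"
  using assms unfolding smooth_manifold_def by (cases c; force)+

lemma smooth_manifold_cover: "smooth_manifold M \<Longrightarrow> (\<Union>c\<in>atlas M. fst c) = points M"
  by (simp add: smooth_manifold_def)

lemma charts_at_nonempty: "smooth_manifold M \<Longrightarrow> x \<in> points M \<Longrightarrow> \<exists>c. c \<in> charts_at M x"
  using smooth_manifold_cover[of M] unfolding charts_at_def by blast

lemma chart_inj_on:
  assumes "smooth_manifold M" "c \<in> atlas M"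
  shows "inj_on (snd c) (fst c)"
  using homeomorphic_imp_injective_map[OF smooth_manifold_homeo[OF assms]]
    openin_subset[OF smooth_manifold_open_chart[OF assms]] by (simp add: Int_absorb1)

lemma chart_in_Rn:
  assumes "smooth_manifold M" "c \<in> atlas M" "x \<in> fst c"
  shows "snd c x \<in> Rn (mdim M)"
  using openin_subset_Rn[OF smooth_manifold_open_image[OF assms(1,2)]] assms(3) by blast

lemma smooth_on_Rn_all:
  assumes "\<And>j. j < m \<Longrightarrow> smooth_on n U (\<lambda>x. g x j)" "openin (Euclidean_space n) U" "\<And>x. x \<in> U \<Longrightarrow>
      g x \<in> Rn m"
  shows "smooth_on n U (\<lambda>x. g x j)"
proof (cases "j < m")
  case False
  show ?thesis
    by (rule smooth_on_cong[OF smooth_on_const[OF assms(2), of 0]])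
        (use assms(3) False in \<open>auto simp: Rn_iff\<close>)
qed (use assms in auto)

lemma
  assumes "p \<in> manifold_diffeology M n U"
  shows manifold_plot_open: "openin (Euclidean_space n) U"
    and manifold_plot_in: "u \<in> U \<Longrightarrow> p u \<in> points M"
    and manifold_plot_continuous: "continuous_map (subtopology (Euclidean_space n) U) (mtop M) p"
  using assms by (auto simp: manifold_diffeology_def)

lemma manifold_plot_chart_open:
  assumes p: "p \<in> manifold_diffeology M n U" and W: "openin (mtop M) W"
  shows "openin (Euclidean_space n) {u\<in>U. p u \<in> W}"
proof -
  have U: "openin (Euclidean_space n) U"
    using manifold_plot_open[OF p] .
  have "topspace (subtopology (Euclidean_space n) U) = U"
    using openin_subset[OF U] by auto
  then have "openin (subtopology (Euclidean_space n) U) {u\<in>U. p u \<in> W}"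
    using openin_continuous_map_preimage[OF manifold_plot_continuous[OF p] W] by (simp only:)
  then show ?thesis
    using openin_open_subtopology[OF U] by blast
qed

lemma manifold_plot_chart_smooth:
  assumes M: "smooth_manifold M" and p: "p \<in> manifold_diffeology M n U" and d: "d \<in> atlas M"
  shows "smooth_on n {u\<in>U. p u \<in> fst d} (\<lambda>u. snd d (p u) j)"
proof (rule smooth_on_Rn_all)
  show "smooth_on n {u\<in>U. p u \<in> fst d} (\<lambda>u. snd d (p u) j)" if "j < mdim M" for j
    using p d that unfolding manifold_diffeology_def by (cases d) auto
  show "openin (Euclidean_space n) {u\<in>U. p u \<in> fst d}"
    using manifold_plot_chart_open[OF p smooth_manifold_open_chart[OF M d]] .
  show "snd d (p u) \<in> Rn (mdim M)" if "u \<in> {u\<in>U. p u \<in> fst d}" for u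
    using chart_in_Rn[OF M d] that by blast
qed

lemma manifold_plot_comp:
  assumes M: "smooth_manifold M" and p: "p \<in> manifold_diffeology M n U"
      and V: "openin (Euclidean_space m) V"
    and f: "\<And>j. j < n \<Longrightarrow> smooth_on m V (\<lambda>v. f v j)" and fU: "\<And>v. v \<in> V \<Longrightarrow> f v \<in> U"
  shows "(\<lambda>v\<in>V. p (f v)) \<in> manifold_diffeology M m V"
proof -
  have U: "openin (Euclidean_space n) U"
    using manifold_plot_open[OF p] .
  have fs: "restrict f V \<in> smooth_maps m V n U"
    using f fU V openin_subset_Rn[OF U] unfolding smooth_maps_def
    by (auto intro: smooth_on_cong[OF f])
  have "continuous_map (subtopology (Euclidean_space m) V) (subtopology (Euclidean_space n) U)
      (restrict f V)"
    using smooth_maps_continuous[OF fs] fU by (auto simp: continuous_map_in_subtopology)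
  from continuous_map_compose[OF this manifold_plot_continuous[OF p]]
  have "continuous_map (subtopology (Euclidean_space m) V) (mtop M) (\<lambda>v\<in>V. p (f v))"
    by (rule continuous_map_eq) auto
  moreover have *: "smooth_on m {v\<in>V. (\<lambda>v\<in>V. p (f v)) v \<in> W} (\<lambda>v. \<phi> ((\<lambda>v\<in>V. p (f v)) v) j)"
    if "(W, \<phi>) \<in> atlas M" for W \<phi> j
  proof -
    have d: "smooth_on n {u\<in>U. p u \<in> W} (\<lambda>u. \<phi> (p u) j)"
      using manifold_plot_chart_smooth[OF M p that] by simp
    have "{u\<in>U. p u \<in> W} \<subseteq> U"
      by blast
    from smooth_maps_restrict(1)[OF fs this smooth_on_open[OF d]]
    have "openin (Euclidean_space m) {v\<in>V. restrict f V v \<in> {u\<in>U. p u \<in> W}}" .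
    also have "{v\<in>V. restrict f V v \<in> {u\<in>U. p u \<in> W}} = {v\<in>V. (\<lambda>v\<in>V. p (f v)) v \<in> W}"
      using fU by auto
    finally have O: "openin (Euclidean_space m) {v\<in>V. (\<lambda>v\<in>V. p (f v)) v \<in> W}" .
    have "smooth_on m {v\<in>V. (\<lambda>v\<in>V. p (f v)) v \<in> W} (\<lambda>v. \<phi> (p (f v)) j)"
    proof (rule smooth_on_comp[OF d O])
      show "smooth_on m {v\<in>V. (\<lambda>v\<in>V. p (f v)) v \<in> W} (\<lambda>v. f v j)" if "j < n" for j
        by (rule smooth_on_subset[OF f[OF that] O]) blast
    qed (use fU in auto)
    then show ?thesis
      by (rule smooth_on_cong) auto
  qed
  moreover have "(\<lambda>v\<in>V. p (f v)) \<in> V \<rightarrow>\<^sub>E points M"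
    using fU manifold_plot_in[OF p] by auto
  ultimately show ?thesis
    using V unfolding manifold_diffeology_def by blast
qed

section \<open>Velocities of plots, inverse charts and tangent maps\<close>

lemma plot_tangent_cong:
  assumes "openin (Euclidean_space n) V" "r \<in> V" "\<And>u. u \<in> V \<Longrightarrow> p u = q u"
  shows "plot_tangent M n p r v = plot_tangent M n q r v"
proof -
  have "deriv_map n (\<lambda>u. snd d (p u)) r v j = deriv_map n (\<lambda>u. snd d (q u)) r v j" for d j
    using assms(3) by (intro deriv_map_cong[OF assms(1,2)]) simp
  then show ?thesis
    using assms(2,3) by (auto simp: plot_tangent_def fun_eq_iff)
qed

lemma chart_inv_into:
  assumes "smooth_manifold M" "c \<in> atlas M" "x \<in> fst c"
  shows "inv_into (fst c) (snd c) (snd c x) = x"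
  using inv_into_f_f[OF chart_inj_on[OF assms(1,2)] assms(3)] .

lemma transition_smooth_on:
  assumes M: "smooth_manifold M" and c: "c \<in> atlas M" and d: "d \<in> atlas M"
    and O: "openin (Euclidean_space (mdim M)) (snd c ` (fst c \<inter> fst d))"
  shows "smooth_on (mdim M) (snd c ` (fst c \<inter> fst d)) (\<lambda>u. transition c d id u j)"
proof (rule smooth_on_Rn_all[OF _ O])
  show "smooth_on (mdim M) (snd c ` (fst c \<inter> fst d)) (\<lambda>u. transition c d id u j)" if "j < mdim M" for j
    using M c d that unfolding smooth_manifold_def by blast
  show "transition c d id u \<in> Rn (mdim M)" if "u \<in> snd c ` (fst c \<inter> fst d)" for u
    using that chart_in_Rn[OF M d] by (auto simp: transition_def chart_inv_into[OF M c])
qed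

text \<open>Restricted to the image of the chart because plots are extensional. As a plot it turns
  statements about tangent vectors of \<open>M\<close> into statements on an open subset of
  R^n.\<close>

definition chart_inv :: "'a chart \<Rightarrow> vec \<Rightarrow> 'a"
  where "chart_inv c = restrict (inv_into (fst c) (snd c)) (snd c ` fst c)"

lemma chart_inv_chart:
  assumes "smooth_manifold M" "c \<in> atlas M" "x \<in> fst c"
  shows "chart_inv c (snd c x) = x"
  using chart_inv_into[OF assms] assms(3) by (simp add: chart_inv_def)

text \<open>Read in a second chart, the inverse of a chart is a transition map; its continuity is
  part of the homeomorphism property.\<close>

lemma chart_inv_plot:
  assumes M: "smooth_manifold M" and c: "c \<in> atlas M"
  shows "chart_inv c \<in> manifold_diffeology M (mdim M) (snd c ` fst c)"
proof -
  let ?U = "snd c ` fst c"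
  let ?E = "Euclidean_space (mdim M)"
  note ci = chart_inv_chart[OF M c]
  have Wsub: "fst c \<subseteq> points M"
    using openin_subset[OF smooth_manifold_open_chart[OF M c]] .
  have Usub: "topspace (subtopology ?E ?U) = ?U"
    using openin_subset[OF smooth_manifold_open_image[OF M c]] by auto
  obtain g where g: "homeomorphic_maps (subtopology (mtop M) (fst c)) (subtopology ?E ?U) (snd c) g"
    using smooth_manifold_homeo[OF M c] homeomorphic_map_maps by blast
  have "continuous_map (subtopology ?E ?U) (mtop M) g"
    using g continuous_map_into_fulltopology by (auto simp: homeomorphic_maps_def)
  moreover have "g u = chart_inv c u" if "u \<in> ?U" for u
    using that g ci Wsub by (auto simp: homeomorphic_maps_def)
  ultimately have cont: "continuous_map (subtopology ?E ?U) (mtop M) (chart_inv c)"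
    using Usub by (auto elim: continuous_map_eq)
  have set: "{u\<in>?U. chart_inv c u \<in> fst d} = snd c ` (fst c \<inter> fst d)" for d
    using ci by auto
  have "smooth_on (mdim M) {u\<in>?U. chart_inv c u \<in> fst d} (\<lambda>u. snd d (chart_inv c u) j)"
    if "d \<in> atlas M" "j < mdim M" for d j
  proof -
    have "smooth_on (mdim M) (snd c ` (fst c \<inter> fst d)) (\<lambda>u. transition c d id u j)"
      using M c that unfolding smooth_manifold_def by blast
    then have "smooth_on (mdim M) (snd c ` (fst c \<inter> fst d)) (\<lambda>u. snd d (chart_inv c u) j)"
      by (rule smooth_on_cong) (auto simp: transition_def ci chart_inv_into[OF M c])
    then show ?thesis
      by (simp only: set)
  qed
  then have "\<forall>(W, \<phi>)\<in>atlas M. \<forall>j<mdim M. smooth_on (mdim M) {u\<in>?U. chart_inv c u \<in> W}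
      (\<lambda>u. \<phi> (chart_inv c u) j)"
    by fastforce
  moreover have "chart_inv c \<in> ?U \<rightarrow>\<^sub>E points M"
    using ci Wsub by (auto simp: chart_inv_def)
  ultimately show ?thesis
    using cont smooth_manifold_open_image[OF M c] unfolding manifold_diffeology_def by blast
qed

text \<open>The compatibility of the coordinate vectors is the chain rule for the transition map
  between two charts around \<open>p r\<close>.\<close>

lemma plot_tangent_in:
  assumes M: "smooth_manifold M" and p: "p \<in> manifold_diffeology M n U" and r: "r \<in> U"
  shows "plot_tangent M n p r v \<in> tangent_space M (p r)"
proof -
  have "plot_tangent M n p r v c \<in> Rn (mdim M)" if "c \<in> charts_at M (p r)" for c
  proof -
    have c: "c \<in> atlas M" "p r \<in> fst c"
      using that by (auto simp: charts_at_def)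
    have "deriv_map n (\<lambda>u. snd c (p u)) r v \<in> Rn (mdim M)"
      by (rule deriv_map_in_Rn[OF manifold_plot_chart_open[OF p smooth_manifold_open_chart[OF M c(1)]]])
        (use r c chart_in_Rn[OF M c(1)] in auto)
    then show ?thesis
      using that by (simp add: plot_tangent_def)
  qed
  moreover have "plot_tangent M n p r v d =
      deriv_map (mdim M) (transition c d id) (snd c (p r)) (plot_tangent M n p r v c)"
    if "c \<in> charts_at M (p r)" "d \<in> charts_at M (p r)" for c d
  proof
    fix j
    have c: "c \<in> atlas M" "p r \<in> fst c" and d: "d \<in> atlas M" "p r \<in> fst d"
      using that by (auto simp: charts_at_def)
    have "openin (mtop M) (fst c \<inter> fst d)"
      using smooth_manifold_open_chart[OF M c(1)] smooth_manifold_open_chart[OF M d(1)] by blast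
    from manifold_plot_chart_open[OF p this]
    have V: "openin (Euclidean_space n) {u\<in>U. p u \<in> fst c \<inter> fst d}" (is "openin _ ?V") .
    have "{u\<in>snd c ` fst c. chart_inv c u \<in> fst d} = snd c ` (fst c \<inter> fst d)"
      using chart_inv_chart[OF M c(1)] by auto
    then have O: "openin (Euclidean_space (mdim M)) (snd c ` (fst c \<inter> fst d))"
      using manifold_plot_chart_open[OF chart_inv_plot[OF M c(1)]
          smooth_manifold_open_chart[OF M d(1)]] by simp
    have rV: "r \<in> ?V"
      using r c d by auto
    have "deriv_map n (\<lambda>u. snd d (p u)) r v j = deriv_map n (\<lambda>u. transition c d id (snd c (p u))) r v j"
      by (rule deriv_map_cong[OF V rV]) (auto simp: transition_def chart_inv_into[OF M c(1)])
    also have "\<dots> = deriv_map (mdim M) (transition c d id) (snd c (p r))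
        (deriv_map n (\<lambda>u. snd c (p u)) r v) j"
    proof (rule deriv_map_comp[OF transition_smooth_on[OF M c(1) d(1) O] V _ _ rV])
      show "smooth_on n ?V (\<lambda>u. snd c (p u) j)" for j
        by (rule smooth_on_subset[OF manifold_plot_chart_smooth[OF M p c(1)] V]) auto
    qed auto
    finally show "plot_tangent M n p r v d j =
        deriv_map (mdim M) (transition c d id) (snd c (p r)) (plot_tangent M n p r v c) j"
      using that by (simp add: plot_tangent_def)
  qed
  moreover have "plot_tangent M n p r v c = 0" if "c \<notin> charts_at M (p r)" for c
    using that by (simp add: plot_tangent_def)
  ultimately show ?thesis
    unfolding tangent_space_def by blast
qed

lemma tangent_space_eqI:
  assumes v: "v \<in> tangent_space M x" and w: "w \<in> tangent_space M x" and c: "c \<in> charts_at M x"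
      and eq: "v c = w c"
  shows "v = w"
proof
  fix d
  show "v d = w d"
  proof (cases "d \<in> charts_at M x")
    case True
    have "v d = deriv_map (mdim M) (transition c d id) (snd c x) (v c)"
      "w d = deriv_map (mdim M) (transition c d id) (snd c x) (w c)"
      using v w c True unfolding tangent_space_def by blast+
    then show ?thesis
      using eq by simp
  next
    case False
    then have "v d = 0" "w d = 0"
      using v w unfolding tangent_space_def by blast+
    then show ?thesis
      by simp
  qed
qed

lemma tangent_space_in_Rn: "v \<in> tangent_space M x \<Longrightarrow> c \<in> charts_at M x \<Longrightarrow> v c \<in> Rn (mdim M)"
  unfolding tangent_space_def by blast

lemma tangent_space_outside: "v \<in> tangent_space M x \<Longrightarrow> c \<notin> charts_at M x \<Longrightarrow> v c = 0"
  unfolding tangent_space_def by blast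

lemma scaleR_fun_apply: "(a *\<^sub>R f) x = a *\<^sub>R f x"
  by (simp add: scaleR_fun_def)

lemma subspace_tangent_space: "subspace (tangent_space M x)"
  unfolding subspace_def
proof (intro conjI ballI allI)
  note Rn = subspace_0[OF subspace_Rn] subspace_add[OF subspace_Rn] subspace_scale[OF subspace_Rn]
  note L = linear_0[OF linear_deriv_map] linear_add[OF linear_deriv_map]
      linear_cmul[OF linear_deriv_map]
  show "0 \<in> tangent_space M x"
  proof -
    have z: "(0 :: 'a tvec) c = 0" for c
      by (rule zero_fun_apply)
    show ?thesis
      unfolding tangent_space_def mem_Collect_eq z L(1) using Rn(1) by blast
  qed
  fix u v assume u: "u \<in> tangent_space M x" and v: "v \<in> tangent_space M x"
  show "u + v \<in> tangent_space M x"
    unfolding tangent_space_def mem_Collect_eq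
  proof (intro conjI allI impI ballI)
    show "(u + v) c = 0" if "c \<notin> charts_at M x" for c
      by (simp only: plus_fun_apply[of u v] tangent_space_outside[OF u that]
          tangent_space_outside[OF v that] add_0)
    show "(u + v) c \<in> Rn (mdim M)" if "c \<in> charts_at M x" for c
      unfolding plus_fun_apply[of u v]
        by (intro Rn(2) tangent_space_in_Rn[OF u that] tangent_space_in_Rn[OF v that])
    show "(u + v) d = deriv_map (mdim M) (transition c d id) (snd c x) ((u + v) c)"
      if "c \<in> charts_at M x" "d \<in> charts_at M x" for c d
    proof -
      have "u d = deriv_map (mdim M) (transition c d id) (snd c x) (u c)"
        "v d = deriv_map (mdim M) (transition c d id) (snd c x) (v c)"
        using u v that unfolding tangent_space_def by blast+
      then show ?thesis
        by (simp only: plus_fun_apply L(2))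
    qed
  qed
next
  note Rn = subspace_scale[OF subspace_Rn]
  fix a v assume v: "v \<in> tangent_space M x"
  show "a *\<^sub>R v \<in> tangent_space M x"
    unfolding tangent_space_def mem_Collect_eq scaleR_fun_apply[of a v]
  proof (intro conjI allI impI ballI)
    show "a *\<^sub>R v c = 0" if "c \<notin> charts_at M x" for c
      by (simp only: tangent_space_outside[OF v that] scaleR_zero_right)
    show "a *\<^sub>R v c \<in> Rn (mdim M)" if "c \<in> charts_at M x" for c
      using v that Rn unfolding tangent_space_def by blast
    show "a *\<^sub>R v d = deriv_map (mdim M) (transition c d id) (snd c x) (a *\<^sub>R v c)"
      if "c \<in> charts_at M x" "d \<in> charts_at M x" for c d
    proof -
      have "v d = deriv_map (mdim M) (transition c d id) (snd c x) (v c)"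
        using v that unfolding tangent_space_def by blast
      then show ?thesis
        by (simp only: linear_cmul[OF linear_deriv_map])
    qed
  qed
qed

lemma linear_plot_tangent: "linear (plot_tangent M n p r)"
proof (rule linearI)
  show "plot_tangent M n p r (u + v) = plot_tangent M n p r u + plot_tangent M n p r v" for u v
    by (rule ext) (simp add: plot_tangent_def linear_add[OF linear_deriv_map])
  show "plot_tangent M n p r (a *\<^sub>R v) = a *\<^sub>R plot_tangent M n p r v" for a v
    by (rule ext) (simp add: plot_tangent_def linear_cmul[OF linear_deriv_map] scaleR_fun_apply[of a
        "\<lambda>d. _ d"])
qed

lemma linear_tangent_map: "linear (tangent_map M N f x)"
proof (rule linearI)
  show "tangent_map M N f x (u + v) = tangent_map M N f x u + tangent_map M N f x v" for u v
    by (rule ext) (simp add: tangent_map_def Let_def linear_add[OF linear_deriv_map])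
  show "tangent_map M N f x (a *\<^sub>R v) = a *\<^sub>R tangent_map M N f x v" for a v
    by (rule ext) (simp add: tangent_map_def Let_def linear_cmul[OF linear_deriv_map]
        scaleR_fun_apply[of a v]
        scaleR_fun_apply[of a "\<lambda>d. _ d"])
qed

lemma plot_tangent_chart_inv:
  assumes M: "smooth_manifold M" and c: "c \<in> charts_at M x" and y: "y \<in> Rn (mdim M)"
  shows "plot_tangent M (mdim M) (chart_inv c) (snd c x) y c = y"
proof -
  have c': "c \<in> atlas M" "x \<in> fst c"
    using c by (auto simp: charts_at_def)
  note ci = chart_inv_chart[OF M c'(1)]
  have "deriv_map (mdim M) (\<lambda>u. snd c (chart_inv c u)) (snd c x) y j =
      deriv_map (mdim M) (\<lambda>u. u) (snd c x) y j" for j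
    by (rule deriv_map_cong[OF smooth_manifold_open_image[OF M c'(1)]]) (use c'(2) ci in auto)
  then have "deriv_map (mdim M) (\<lambda>u. snd c (chart_inv c u)) (snd c x) y = y"
    using deriv_map_id[OF y] by auto
  then show ?thesis
    using c ci[OF c'(2)] by (simp add: plot_tangent_def)
qed

lemma chart_inv_tangent_in:
  assumes M: "smooth_manifold M" and c: "c \<in> charts_at M x"
  shows "plot_tangent M (mdim M) (chart_inv c) (snd c x) y \<in> tangent_space M x"
proof -
  have c': "c \<in> atlas M" "x \<in> fst c"
    using c by (auto simp: charts_at_def)
  show ?thesis
    using plot_tangent_in[OF M chart_inv_plot[OF M c'(1)], of "snd c x" y] c'(2)
        chart_inv_chart[OF M c'] by simp
qed

lemma plot_tangent_chart_inv_eq: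
  assumes M: "smooth_manifold M" and c: "c \<in> charts_at M x" and v: "v \<in> tangent_space M x"
  shows "plot_tangent M (mdim M) (chart_inv c) (snd c x) (v c) = v"
  using tangent_space_eqI[OF chart_inv_tangent_in[OF M c] v c]
    plot_tangent_chart_inv[OF M c tangent_space_in_Rn[OF v c]] by blast

text \<open>The derivative of the inverse chart is injective as well, so finite span and dimension
  of tangent spaces are transported from R^n along it.\<close>

lemma tangent_space_eq_image:
  assumes M: "smooth_manifold M" and c: "c \<in> charts_at M x"
  shows "tangent_space M x = plot_tangent M (mdim M) (chart_inv c) (snd c x) ` Rn (mdim M)"
proof
  show "tangent_space M x \<subseteq> plot_tangent M (mdim M) (chart_inv c) (snd c x) ` Rn (mdim M)"
  proof
    fix v assume v: "v \<in> tangent_space M x"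
    from tangent_space_in_Rn[OF v c]
    have "plot_tangent M (mdim M) (chart_inv c) (snd c x) (v c) \<in> plot_tangent M (mdim M)
        (chart_inv c) (snd c x) ` Rn (mdim M)"
      by (rule imageI)
    then show "v \<in> plot_tangent M (mdim M) (chart_inv c) (snd c x) ` Rn (mdim M)"
      by (simp only: plot_tangent_chart_inv_eq[OF M c v])
  qed
qed (use chart_inv_tangent_in[OF M c] in blast)

lemma finite_span_tangent_space:
  assumes "smooth_manifold M" "x \<in> points M"
  shows "finite_span (tangent_space M x)"
proof -
  obtain c where "c \<in> charts_at M x"
    using charts_at_nonempty[OF assms] by blast
  then show ?thesis
    using tangent_space_eq_image[OF assms(1)]
        finite_span_image[OF linear_plot_tangent finite_span_Rn] by metis
qed

lemma plot_tangent_chart_inv_inj: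
  assumes M: "smooth_manifold M" and c: "c \<in> charts_at M x" and y: "y \<in> Rn (mdim M)"
    and 0: "plot_tangent M (mdim M) (chart_inv c) (snd c x) y = 0"
  shows "y = 0"
  using plot_tangent_chart_inv[OF M c y] 0 by simp

lemma dim_tangent_space:
  assumes M: "smooth_manifold M" and x: "x \<in> points M"
  shows "dim (tangent_space M x) = dim (Rn (mdim M))"
proof -
  obtain c where c: "c \<in> charts_at M x"
    using charts_at_nonempty[OF assms] by blast
  show ?thesis
    unfolding tangent_space_eq_image[OF M c]
    by (rule dim_linear_image_inj[OF linear_plot_tangent subspace_Rn finite_span_Rn
        plot_tangent_chart_inv_inj[OF M c]])
qed

text \<open>Functoriality: the tangent map of a composite with a plot is the composite of the
  derivatives. It frees later arguments from the chart chosen in \<open>tangent_map\<close>.\<close>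

lemma tangent_map_plot_tangent:
  assumes M: "smooth_manifold M" and N: "smooth_manifold N"
    and f: "dsmooth (manifold_diffeology M) (manifold_diffeology N) f"
    and p: "p \<in> manifold_diffeology M n U" and r: "r \<in> U"
  shows "tangent_map M N f (p r) (plot_tangent M n p r v) = plot_tangent N n (compose U f p) r v"
proof
  fix d
  \<comment> \<open>This has to be the very chart that \<open>tangent_map\<close> picks.\<close>
  define c where "c = (SOME c. c \<in> charts_at M (p r))"
  have c: "c \<in> charts_at M (p r)"
    using charts_at_nonempty[OF M manifold_plot_in[OF p r]] unfolding c_def by (rule someI_ex)
  have c': "c \<in> atlas M" "p r \<in> fst c"
    using c by (auto simp: charts_at_def)
  have fp: "compose U f p \<in> manifold_diffeology N n U"
    using f p by (simp add: dsmooth_def)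
  have fc: "compose (snd c ` fst c) f (chart_inv c) \<in> manifold_diffeology N (mdim M) (snd c ` fst c)"
    using f chart_inv_plot[OF M c'(1)] by (simp add: dsmooth_def)
  have fpr: "compose U f p r = f (p r)"
    using r by (simp add: compose_def)
  show "tangent_map M N f (p r) (plot_tangent M n p r v) d = plot_tangent N n (compose U f p) r v d"
  proof (cases "d \<in> charts_at N (f (p r))")
    case True
    then have d: "d \<in> atlas N" "f (p r) \<in> fst d"
      by (auto simp: charts_at_def)
    define V where "V = {u\<in>U. p u \<in> fst c} \<inter> {u\<in>U. compose U f p u \<in> fst d}"
    have V: "openin (Euclidean_space n) V"
      unfolding V_def using manifold_plot_chart_open[OF p smooth_manifold_open_chart[OF M c'(1)]]
        manifold_plot_chart_open[OF fp smooth_manifold_open_chart[OF N d(1)]] by blast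
    have rV: "r \<in> V"
      using r c'(2) d(2) by (simp add: V_def compose_def)
    have t: "transition c d f (snd c y) = snd d (f y)" if "y \<in> fst c" for y
      by (simp add: transition_def chart_inv_into[OF M c'(1) that])
    have sm: "smooth_on (mdim M) {u\<in>snd c ` fst c. compose (snd c ` fst c) f (chart_inv c) u \<in> fst
        d} (\<lambda>u. transition c d f u j)" for j
      by (rule smooth_on_cong[OF manifold_plot_chart_smooth[OF N fc d(1)]])
        (auto simp: compose_def transition_def chart_inv_def)
    have "plot_tangent N n (compose U f p) r v d j =
        deriv_map (mdim M) (transition c d f) (snd c (p r)) (plot_tangent M n p r v c) j" for j
    proof -
      have "deriv_map n (\<lambda>u. snd d (compose U f p u)) r v j =
          deriv_map n (\<lambda>u. transition c d f (snd c (p u))) r v j"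
        by (rule deriv_map_cong[OF V rV]) (auto simp: V_def t compose_def)
      also have "\<dots> = deriv_map (mdim M) (transition c d f) (snd c (p r))
          (deriv_map n (\<lambda>u. snd c (p u)) r v) j"
      proof (rule deriv_map_comp[OF sm V _ _ rV])
        show "smooth_on n V (\<lambda>u. snd c (p u) j)" for j
          by (rule smooth_on_subset[OF manifold_plot_chart_smooth[OF M p c'(1)] V]) (auto simp: V_def)
        show "snd c (p u) \<in> {u\<in>snd c ` fst c. compose (snd c ` fst c) f (chart_inv c) u \<in> fst d}"
            if "u \<in> V" for u
          using that by (auto simp: V_def compose_def chart_inv_chart[OF M c'(1)])
      qed
      finally show ?thesis
        using True c fpr by (simp add: plot_tangent_def)
    qed
    then show ?thesis
      using True by (auto simp: tangent_map_def Let_def c_def)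
  next
    case False
    then show ?thesis
      using fpr by (simp add: tangent_map_def Let_def plot_tangent_def)
  qed
qed

lemma tangent_map_in:
  assumes M: "smooth_manifold M" and N: "smooth_manifold N"
    and f: "dsmooth (manifold_diffeology M) (manifold_diffeology N) f"
    and x: "x \<in> points M" and v: "v \<in> tangent_space M x"
  shows "tangent_map M N f x v \<in> tangent_space N (f x)"
proof -
  obtain c where c: "c \<in> charts_at M x"
    using charts_at_nonempty[OF M x] by blast
  have c': "c \<in> atlas M" "x \<in> fst c"
    using c by (auto simp: charts_at_def)
  let ?U = "snd c ` fst c"
  have q: "compose ?U f (chart_inv c) \<in> manifold_diffeology N (mdim M) ?U"
    using f chart_inv_plot[OF M c'(1)] by (simp add: dsmooth_def)
  have "plot_tangent N (mdim M) (compose ?U f (chart_inv c)) (snd c x) (v c) \<in> tangent_space N (f x)"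
    using plot_tangent_in[OF N q, of "snd c x" "v c"] c'(2)
      by (simp add: compose_def chart_inv_chart[OF M c'])
  then show ?thesis
    using tangent_map_plot_tangent[OF M N f chart_inv_plot[OF M c'(1)], of "snd c x" "v c"] c'(2)
    by (simp add: chart_inv_chart[OF M c'] plot_tangent_chart_inv_eq[OF M c v])
qed

lemma chart_chart_inv: "y \<in> snd c ` fst c \<Longrightarrow> snd c (chart_inv c y) = y"
  by (simp add: chart_inv_def f_inv_into_f)

lemma const_manifold_plot:
  assumes M: "smooth_manifold M" and a: "a \<in> points M" and V: "openin (Euclidean_space n) V"
  shows "(\<lambda>v\<in>V. a) \<in> manifold_diffeology M n V"
proof -
  obtain c where "c \<in> charts_at M a"
    using charts_at_nonempty[OF M a] by blast
  then have c: "c \<in> atlas M" "a \<in> fst c"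
    by (auto simp: charts_at_def)
  have "(\<lambda>v\<in>V. chart_inv c (snd c a)) \<in> manifold_diffeology M n V"
    using c(2) by (intro manifold_plot_comp[OF M chart_inv_plot[OF M c(1)] V] smooth_on_const V) auto
  then show ?thesis
    by (simp add: chart_inv_chart[OF M c])
qed

lemma plot_tangent_const: "plot_tangent M n (\<lambda>u. a) r v = 0"
  by (simp add: plot_tangent_def deriv_map_const fun_eq_iff)

text \<open>Names the term at which \<open>TF\<close> evaluates derivatives, the unit vector of
  R^1.\<close>

definition unit_velocity :: vec
  where "unit_velocity = (\<lambda>i. if i = 0 then 1 else 0)"

text \<open>The cube is the image of an interval under the identification of the reals with R^1. A
  connected domain is what keeps a curve inside one leaf.\<close>

lemma connected_cube_1: "connected_space (subtopology (Euclidean_space 1) (cube 1 0 e))"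
proof -
  have "continuous_on {-e<..<e} (\<lambda>s::real. \<lambda>i::nat. if i = 0 then s else 0)"
  proof (rule continuous_on_coordinatewise_then_product)
    show "continuous_on {-e<..<e} (\<lambda>s::real. if i = 0 then s else 0)" for i :: nat
      by (cases "i = 0") (auto intro: continuous_intros)
  qed
  then have "connected ((\<lambda>s::real. \<lambda>i::nat. if i = 0 then s else 0) ` {-e<..<e})"
    by (rule connected_continuous_image) simp
  moreover have "(\<lambda>s::real. \<lambda>i::nat. if i = 0 then s else 0) ` {-e<..<e} = cube 1 0 e" (is "?L = _")
  proof
    show "cube 1 0 e \<subseteq> ?L"
    proof
      fix y assume y: "y \<in> cube 1 0 e"
      then have "y = (\<lambda>i. if i = 0 then y 0 else 0)" "y 0 \<in> {-e<..<e}"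
        by (auto simp: cube_def Rn_iff fun_eq_iff)
      then show "y \<in> ?L"
        by (rule image_eqI)
    qed
  qed (auto simp: cube_def Rn_iff)
  ultimately have "connected (cube 1 0 e)"
    by simp
  moreover have "subtopology (Euclidean_space 1) (cube 1 0 e) = top_of_set (cube 1 0 e)"
    using arg_cong[OF Euclidean_space_eq[of 1], of "\<lambda>X. subtopology X (cube 1 0 e)"]
    by (simp add: subtopology_subtopology cube_def Int_absorb1)
  ultimately show ?thesis
    by (simp only: connectedin_iff_connected[symmetric] connectedin_def)
qed

section \<open>The orbit foliation\<close>

lemma topspace_quotient_topology: "topspace (quotient_topology X f) = f ` topspace X"
proof
  have "{x \<in> topspace X. f x \<in> f ` topspace X} = topspace X"
    by auto
  then have "openin (quotient_topology X f) (f ` topspace X)"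
    by (simp add: openin_quotient_topology)
  then show "f ` topspace X \<subseteq> topspace (quotient_topology X f)"
    by (rule openin_subset)
  show "topspace (quotient_topology X f) \<subseteq> f ` topspace X"
    using openin_quotient_topology[of X f "topspace (quotient_topology X f)"] by simp
qed

lemma continuous_map_quotient_topology: "continuous_map X (quotient_topology X f) f"
  by (auto simp: continuous_map_def topspace_quotient_topology openin_quotient_topology)

context lie_groupoid
begin

text \<open>The tangent space at \<open>g\<close> of the source fibre, in linear form; its elements
  turn out to be exactly the velocities of curves in that fibre.\<close>

definition src_kernel :: "'g \<Rightarrow> 'g tvec set"
  where "src_kernel g = {\<xi>\<in>tangent_space (arrows G) g. T_src G g \<xi> = 0}"

lemma src_kernel_velocity:
  assumes p: "\<gamma> \<in> manifold_diffeology (arrows G) n U" and r: "r \<in> U"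
      and c: "\<And>u. u \<in> U \<Longrightarrow> src G (\<gamma> u) = x"
  shows "plot_tangent (arrows G) n \<gamma> r v \<in> src_kernel (\<gamma> r)"
proof -
  have "T_src G (\<gamma> r) (plot_tangent (arrows G) n \<gamma> r v) =
      plot_tangent (base G) n (compose U (src G) \<gamma>) r v"
    by (rule tangent_map_plot_tangent[OF arrows_manifold base_manifold src_smooth p r])
  also have "\<dots> = plot_tangent (base G) n (\<lambda>u. x) r v"
    by (rule plot_tangent_cong[OF manifold_plot_open[OF p] r]) (simp add: compose_def c)
  finally show ?thesis
    using plot_tangent_in[OF arrows_manifold p r] by (simp add: src_kernel_def plot_tangent_const)
qed

text \<open>In charts the source map becomes a map \<open>F\<close> with surjective derivative. The
  curve is the straight line through \<open>u0\<close> in direction \<open>\<xi> c\<close>, bent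
  into the level set by \<open>\<Gamma>\<close>; as the derivative of \<open>\<Gamma>\<close> fixes
  kernel vectors, the velocity survives.\<close>

lemma src_kernel_curve:
  assumes g: "g \<in> points (arrows G)" and \<xi>: "\<xi> \<in> src_kernel g"
  obtains e \<gamma> where "e > 0" "\<gamma> \<in> manifold_diffeology (arrows G) 1 (cube 1 0 e)" "\<gamma> 0 = g"
    "\<And>u. u \<in> cube 1 0 e \<Longrightarrow> src G (\<gamma> u) = src G g"
    "plot_tangent (arrows G) 1 \<gamma> 0 unit_velocity = \<xi>"
proof -
  let ?A = "arrows G" and ?B = "base G"
  let ?N = "mdim ?A" and ?m = "mdim ?B"
  \<comment> \<open>The chart chosen by \<open>tangent_map\<close>, so that \<open>T_src G g\<close>
    read in the chart \<open>d\<close> is literally the derivative of \<open>F\<close>.\<close>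
  define c where "c = (SOME c. c \<in> charts_at ?A g)"
  have c: "c \<in> charts_at ?A g"
    unfolding c_def using charts_at_nonempty[OF arrows_manifold g] by (rule someI_ex)
  have c': "c \<in> atlas ?A" "g \<in> fst c"
    using c by (auto simp: charts_at_def)
  obtain d where d: "d \<in> charts_at ?B (src G g)"
    using charts_at_nonempty[OF base_manifold src_in[OF g]] by blast
  have d': "d \<in> atlas ?B" "src G g \<in> fst d"
    using d by (auto simp: charts_at_def)
  note ci = chart_inv_chart[OF arrows_manifold c'(1)]
  define U0 where "U0 = snd c ` fst c"
  define U where "U = {u\<in>U0. compose U0 (src G) (chart_inv c) u \<in> fst d}"
  define F where "F = transition c d (src G)"
  define u0 where "u0 = snd c g"
  have q: "compose U0 (src G) (chart_inv c) \<in> manifold_diffeology ?B ?N U0"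
    using src_smooth chart_inv_plot[OF arrows_manifold c'(1)] by (simp add: dsmooth_def U0_def)
  have FE: "F u = snd d (src G (chart_inv c u))" if "u \<in> U" for u
    using that by (simp add: F_def transition_def chart_inv_def U_def U0_def)
  have F: "smooth_on ?N U (\<lambda>u. F u l)" for l
    unfolding U_def
      by (rule smooth_on_cong[OF manifold_plot_chart_smooth[OF base_manifold q d'(1), of l]])
      (use FE in \<open>auto simp: U_def compose_def\<close>)
  have U: "openin (Euclidean_space ?N) U" "u0 \<in> U"
    using smooth_on_open[OF F] c'(2) d'(2) by (auto simp: U_def U0_def u0_def compose_def ci)
  have T: "T_src G g \<zeta> d = deriv_map ?N F u0 (\<zeta> c)" for \<zeta>
    using d by (simp add: tangent_map_def Let_def F_def u0_def flip: c_def)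
  have surj: "\<exists>w\<in>Rn ?N. \<forall>l'<?m. deriv_map ?N F u0 w l' = (if l' = l then 1 else 0)" if l: "l < ?m" for l
  proof -
    \<comment> \<open>The \<open>l\<close>-th coordinate vector, which lifts to the arrows because
      the source map is a submersion.\<close>
    define y :: vec where "y = (\<lambda>l'. if l' = l then 1 else 0)"
    have y: "y \<in> Rn ?m"
      using l by (auto simp: y_def Rn_iff)
    have "plot_tangent ?B ?m (chart_inv d) (snd d (src G g)) y \<in> T_src G g ` tangent_space ?A g"
      using chart_inv_tangent_in[OF base_manifold d] src_submersion[OF g] by simp
    then obtain \<zeta> where \<zeta>: "\<zeta> \<in> tangent_space ?A g"
        "T_src G g \<zeta> = plot_tangent ?B ?m (chart_inv d) (snd d (src G g)) y"
      by force
    have "deriv_map ?N F u0 (\<zeta> c) = y"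
      using plot_tangent_chart_inv[OF base_manifold d y] \<zeta>(2) T[of \<zeta>] by simp
    then show ?thesis
      using tangent_space_in_Rn[OF \<zeta>(1) c] by (intro bexI[of _ "\<zeta> c"]) (simp_all add: y_def)
  qed
  obtain W \<Gamma> where W: "openin (Euclidean_space ?N) W" "u0 \<in> W" and \<Gamma>s: "\<And>j. smooth_on ?N W (\<lambda>x. \<Gamma> x j)"
    and \<Gamma>0: "\<Gamma> u0 = u0" and \<Gamma>U: "\<And>x. x \<in> W \<Longrightarrow> \<Gamma> x \<in> U"
        and F\<Gamma>: "\<And>x l. x \<in> W \<Longrightarrow> l < ?m \<Longrightarrow> F (\<Gamma> x) l = F u0 l"
    and \<Gamma>D: "\<And>v. v \<in> Rn ?N \<Longrightarrow> \<forall>l<?m. deriv_map ?N F u0 v l = 0 \<Longrightarrow> deriv_map ?N \<Gamma> u0 v = v"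
    using level_set_parametrization[of ?m ?N U F u0, OF F U surj] by blast
  have \<xi>T: "\<xi> \<in> tangent_space ?A g" "T_src G g \<xi> = 0"
    using \<xi> by (auto simp: src_kernel_def)
  define v where "v = \<xi> c"
  have v: "v \<in> Rn ?N"
    using tangent_space_in_Rn[OF \<xi>T(1) c] by (simp add: v_def)
  have Dv: "deriv_map ?N \<Gamma> u0 v = v"
    using T[of \<xi>] \<xi>T(2) by (intro \<Gamma>D[OF v]) (simp add: v_def)
  define \<kappa> :: "vec \<Rightarrow> vec" where "\<kappa> t = (\<lambda>j. u0 j + t 0 * v j)" for t
  have u0R: "u0 \<in> Rn ?N"
    using W openin_subset_Rn by blast
  have R1: "openin (Euclidean_space 1) (Rn 1)"
    by simp
  have \<kappa>s: "smooth_on 1 V (\<lambda>t. \<kappa> t j)" if "openin (Euclidean_space 1) V" for V j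
    unfolding \<kappa>_def by (intro smooth_onI that Ck_add Ck_mult Ck_const Ck_coord)
  have \<kappa>R: "\<kappa> t \<in> Rn ?N" for t
    using u0R v by (simp add: \<kappa>_def Rn_iff)
  have \<kappa>0: "\<kappa> 0 = u0"
    by (simp add: \<kappa>_def)
  have "smooth_on 1 (Rn 1) (\<lambda>t. restrict \<kappa> (Rn 1) t j)" for j
    by (rule smooth_on_cong[OF \<kappa>s[OF R1]]) simp
  moreover have "restrict \<kappa> (Rn 1) \<in> Rn 1 \<rightarrow>\<^sub>E Rn ?N"
    using \<kappa>R by simp
  ultimately have "restrict \<kappa> (Rn 1) \<in> smooth_maps 1 (Rn 1) ?N (Rn ?N)"
    unfolding smooth_maps_def using R1 by blast
  from smooth_maps_restrict(1)[OF this openin_subset_Rn[OF W(1)] W(1)]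
  have "openin (Euclidean_space 1) {t \<in> Rn 1. restrict \<kappa> (Rn 1) t \<in> W}" .
  moreover have "0 \<in> {t \<in> Rn 1. restrict \<kappa> (Rn 1) t \<in> W}"
    using W(2) \<kappa>0 by (simp add: Rn_iff)
  ultimately obtain e where e: "e > 0" "cube 1 0 e \<subseteq> {t \<in> Rn 1. restrict \<kappa> (Rn 1) t \<in> W}"
    using cube_inside by blast
  define I where "I = cube 1 0 e"
  have I: "openin (Euclidean_space 1) I"
    unfolding I_def by (rule openin_cube)
  have I0: "0 \<in> I"
    using cube_self[of 0 1 e] e(1) by (simp add: I_def Rn_iff)
  have \<kappa>W: "\<kappa> t \<in> W" if "t \<in> I" for t
    using that e(2) by (auto simp: I_def)
  have \<Gamma>\<kappa>: "\<Gamma> (\<kappa> t) \<in> U" if "t \<in> I" for t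
    using \<Gamma>U[OF \<kappa>W[OF that]] .
  have \<Gamma>\<kappa>0: "\<Gamma> (\<kappa> t) \<in> U0" if "t \<in> I" for t
    using \<Gamma>\<kappa>[OF that] by (simp add: U_def)
  have \<Gamma>\<kappa>s: "smooth_on 1 I (\<lambda>t. \<Gamma> (\<kappa> t) j)" for j
    by (rule smooth_on_comp[OF \<Gamma>s I \<kappa>s[OF I] \<kappa>W])
  define \<gamma> where "\<gamma> = (\<lambda>t\<in>I. chart_inv c (\<Gamma> (\<kappa> t)))"
  have \<gamma>: "\<gamma> \<in> manifold_diffeology ?A 1 I"
    unfolding \<gamma>_def using \<Gamma>\<kappa>0 \<Gamma>\<kappa>s
    by (intro manifold_plot_comp[OF arrows_manifold chart_inv_plot[OF arrows_manifold c'(1)] I])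
        (auto simp: U0_def)
  have "\<gamma> 0 = chart_inv c u0"
    using I0 by (simp add: \<gamma>_def \<kappa>0 \<Gamma>0)
  then have \<gamma>0: "\<gamma> 0 = g"
    by (simp add: u0_def ci[OF c'(2)])
  have src: "src G (\<gamma> t) = src G g" if t: "t \<in> I" for t
  proof -
    have fd: "src G (\<gamma> t) \<in> fst d"
      using \<Gamma>\<kappa>[OF t] t by (auto simp: U_def \<gamma>_def compose_def)
    have 1: "F (\<Gamma> (\<kappa> t)) = snd d (src G (\<gamma> t))"
      using FE[OF \<Gamma>\<kappa>[OF t]] t by (simp add: \<gamma>_def)
    have 2: "F u0 = snd d (src G g)"
      using FE[OF U(2)] by (simp add: u0_def ci[OF c'(2)])
    \<comment> \<open>The level set fixes the coordinates below the dimension of the base; the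
      others are 0 in every chart.\<close>
    have "snd d (src G (\<gamma> t)) l = snd d (src G g) l" for l
    proof (cases "l < ?m")
      case True
      then show ?thesis
        using F\<Gamma>[OF \<kappa>W[OF t] True] 1 2 by simp
    next
      case False
      then show ?thesis
        using chart_in_Rn[OF base_manifold d'(1) fd] chart_in_Rn[OF base_manifold d']
          by (simp add: Rn_iff)
    qed
    then have "snd d (src G (\<gamma> t)) = snd d (src G g)"
      by blast
    then show ?thesis
      using inj_onD[OF chart_inj_on[OF base_manifold d'(1)] _ fd d'(2)] by blast
  qed
  have D\<kappa>: "deriv_map 1 \<kappa> 0 unit_velocity = v"
  proof
    fix j
    have "((\<lambda>t. \<kappa> (0(0 := t)) j) has_real_derivative v j) (at (0 0))"
      by (auto simp: \<kappa>_def intro!: derivative_eq_intros)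
    then have "partial_deriv 0 (\<lambda>t. \<kappa> t j) 0 = v j"
      unfolding partial_deriv_def by (rule DERIV_imp_deriv)
    then show "deriv_map 1 \<kappa> 0 unit_velocity j = v j"
      by (simp add: deriv_map_def unit_velocity_def)
  qed
  have "plot_tangent ?A 1 \<gamma> 0 unit_velocity c j = \<xi> c j" for j
  proof -
    have "plot_tangent ?A 1 \<gamma> 0 unit_velocity c j = deriv_map 1 (\<lambda>t. snd c (\<gamma> t)) 0 unit_velocity j"
      using c by (simp add: plot_tangent_def \<gamma>0)
    also have "\<dots> = deriv_map 1 (\<lambda>t. \<Gamma> (\<kappa> t)) 0 unit_velocity j"
      by (rule deriv_map_cong[OF I I0]) (use \<Gamma>\<kappa>0 in \<open>simp add: \<gamma>_def chart_chart_inv U0_def\<close>)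
    also have "\<dots> = deriv_map ?N \<Gamma> (\<kappa> 0) (deriv_map 1 \<kappa> 0 unit_velocity) j"
      by (rule deriv_map_comp[of ?N W \<Gamma> j 1 I \<kappa>, OF \<Gamma>s I \<kappa>s[OF I] \<kappa>W I0])
    finally show ?thesis
      unfolding D\<kappa> \<kappa>0 Dv unfolding v_def .
  qed
  then have "plot_tangent ?A 1 \<gamma> 0 unit_velocity c = \<xi> c"
    by blast
  then have "plot_tangent ?A 1 \<gamma> 0 unit_velocity = \<xi>"
    using tangent_space_eqI[OF _ \<xi>T(1) c] plot_tangent_in[OF arrows_manifold \<gamma> I0, of unit_velocity]
        \<gamma>0 by simp
  then show thesis
    using that[of e \<gamma>] e(1) \<gamma> \<gamma>0 src by (simp add: I_def)
qed

text \<open>The leaf is a component for the orbit topology, in general finer than that of the base.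
  Continuity of the curve into it is therefore obtained from the lift \<open>l\<close> into the
  source fibre.\<close>

lemma connected_curve_in_leaf:
  assumes l: "l \<in> manifold_diffeology (arrows G) n I"
      and I: "connected_space (subtopology (Euclidean_space n) I)"
    and s: "\<And>u. u \<in> I \<Longrightarrow> src G (l u) = x" and r: "r \<in> I" "tgt G (l r) = x" and u: "u \<in> I"
  shows "tgt G (l u) \<in> leaf G x"
proof -
  let ?E = "subtopology (Euclidean_space n) I" and ?S = "subtopology (mtop (arrows G)) (src_fibre G x)"
  have tE: "topspace ?E = I"
    using openin_subset_Rn[OF manifold_plot_open[OF l]] by auto
  have "l u \<in> src_fibre G x" if "u \<in> I" for u
    using that s manifold_plot_in[OF l] by (simp add: src_fibre_def)
  then have "continuous_map ?E ?S l"
    using manifold_plot_continuous[OF l] tE by (auto simp: continuous_map_in_subtopology)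
  then have "continuous_map ?E (orbit_topology G x) (tgt G \<circ> l)"
    unfolding orbit_topology_def using continuous_map_quotient_topology by (rule continuous_map_compose)
  then have "connectedin (orbit_topology G x) ((tgt G \<circ> l) ` topspace ?E)"
    by (rule connectedin_continuous_map_image) (simp only: connectedin_topspace I)
  then have "connected_component_of (orbit_topology G x) x (tgt G (l u))"
    unfolding connected_component_of_def using r u tE
    by (intro exI[of _ "(tgt G \<circ> l) ` I"]) force
  then show ?thesis
    by (simp add: leaf_def)
qed

text \<open>Smoothness of the multiplication is phrased for pairs of plots, so the fixed arrow
  enters as a constant plot.\<close>

lemma mult_plot:
  assumes "a \<in> manifold_diffeology (arrows G) n U" "k \<in> points (arrows G)" "\<And>u. u \<in> U \<Longrightarrow>
      src G (a u) = tgt G k"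
  shows "(\<lambda>u\<in>U. gmult G (a u) k) \<in> manifold_diffeology (arrows G) n U"
proof -
  have "(\<lambda>u\<in>U. gmult G (a u) ((\<lambda>u\<in>U. k) u)) \<in> manifold_diffeology (arrows G) n U"
    by (rule mult_smooth[OF assms(1)
        const_manifold_plot[OF arrows_manifold assms(2) manifold_plot_open[OF assms(1)]]])
      (simp add: assms(3))
  moreover have "(\<lambda>u\<in>U. gmult G (a u) ((\<lambda>u\<in>U. k) u)) = (\<lambda>u\<in>U. gmult G (a u) k)"
    by (rule restrict_ext) simp
  ultimately show ?thesis
    by simp
qed

text \<open>Right translation by \<open>g\<^sup>-\<^sup>1\<close> moves the curve through \<open>g\<close> to the source fibre over \<open>t(g)\<close>.\<close>

lemma T_tgt_src_kernel_in_TF: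
  assumes g: "g \<in> points (arrows G)" and \<xi>: "\<xi> \<in> src_kernel g"
  shows "T_tgt G g \<xi> \<in> TF G (tgt G g)"
proof -
  let ?A = "arrows G" and ?B = "base G"
  obtain e \<gamma> where e: "e > 0" and \<gamma>: "\<gamma> \<in> manifold_diffeology ?A 1 (cube 1 0 e)" and \<gamma>0: "\<gamma> 0 = g"
    and s: "\<And>u. u \<in> cube 1 0 e \<Longrightarrow> src G (\<gamma> u) = src G g"
        and vel: "plot_tangent ?A 1 \<gamma> 0 unit_velocity = \<xi>"
    using src_kernel_curve[OF g \<xi>] by blast
  define I where "I = cube 1 0 e"
  note \<gamma> = \<gamma>[folded I_def] and s = s[folded I_def]
  have I0: "0 \<in> I"
    using cube_self[of 0 1 e] e by (simp add: I_def Rn_iff)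
  have I: "openin (Euclidean_space 1) I"
    using manifold_plot_open[OF \<gamma>] .
  define x where "x = tgt G g"
  define h where "h = ginv G g"
  have h: "h \<in> points ?A" "src G h = x" "tgt G h = src G g"
    using g by (auto simp: h_def x_def inv_in src_inv tgt_inv)
  define l where "l = (\<lambda>u\<in>I. gmult G (\<gamma> u) h)"
  have l: "l \<in> manifold_diffeology ?A 1 I"
    unfolding l_def using s h by (intro mult_plot[OF \<gamma>]) auto
  have \<gamma>A: "\<gamma> u \<in> points ?A" if "u \<in> I" for u
    using manifold_plot_in[OF \<gamma> that] .
  have ls: "src G (l u) = x" and lt: "tgt G (l u) = tgt G (\<gamma> u)" if "u \<in> I" for u
    using that s h \<gamma>A by (auto simp: l_def src_mult tgt_mult)
  define c where "c = compose I (tgt G) l"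
  have "l \<in> subset_diffeology (manifold_diffeology ?A) (src_fibre G x) 1 I"
    using l ls manifold_plot_in[OF l] by (auto simp: subset_diffeology_def src_fibre_def)
  then have "c \<in> orbit_diffeology G x 1 I"
    unfolding orbit_diffeology_def quotient_diffeology_def using I
    by (auto simp: c_def compose_def intro!: exI[of _ I] bexI[of _ l])
  \<comment> \<open>The curve passes through \<open>x\<close> at parameter 0, so its connected image
    lies in the component of \<open>x\<close>.\<close>
  moreover have "tgt G (l u) \<in> leaf G x" if "u \<in> I" for u
    using connected_curve_in_leaf[OF l _ ls I0 _ that] connected_cube_1 I0 lt[OF I0] \<gamma>0
    by (simp add: I_def x_def)
  then have "c ` I \<subseteq> leaf G x"
    by (auto simp: c_def compose_def)
  ultimately have "c \<in> subset_diffeology (orbit_diffeology G x) (leaf G x) 1 I"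
    by (simp add: subset_diffeology_def)
  moreover have "c 0 = x"
    using I0 lt[OF I0] \<gamma>0 by (simp add: c_def compose_def x_def)
  moreover have "T_tgt G g \<xi> = plot_tangent ?B 1 c 0 unit_velocity"
  proof -
    have "T_tgt G g \<xi> = plot_tangent ?B 1 (compose I (tgt G) \<gamma>) 0 unit_velocity"
      using tangent_map_plot_tangent[OF arrows_manifold base_manifold tgt_smooth \<gamma> I0, of
          unit_velocity] \<gamma>0 vel by simp
    also have "\<dots> = plot_tangent ?B 1 c 0 unit_velocity"
      by (rule plot_tangent_cong[OF I I0]) (simp add: c_def compose_def lt)
    finally show ?thesis .
  qed
  ultimately show ?thesis
    unfolding TF_def x_def[symmetric] unit_velocity_def[symmetric] using I0 by blast
qed

text \<open>A curve of the leaf lifts near 0 to the source fibre over its base point. A right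
  translation makes the lift pass through \<open>g\<close> without changing targets.\<close>

lemma TF_in_T_tgt_src_kernel:
  assumes g: "g \<in> points (arrows G)" and v: "v \<in> TF G (tgt G g)"
  shows "v \<in> T_tgt G g ` src_kernel g"
proof -
  let ?A = "arrows G" and ?B = "base G"
  define x where "x = tgt G g"
  obtain c I where vc: "v = plot_tangent ?B 1 c 0 unit_velocity" and c: "c \<in> orbit_diffeology G x 1 I"
    and I0: "0 \<in> I" and c0: "c 0 = x"
    using v unfolding TF_def x_def[symmetric] unit_velocity_def[symmetric] subset_diffeology_def
      by blast
  then obtain V l where V: "openin (Euclidean_space 1) V" "0 \<in> V"
    and l: "l \<in> subset_diffeology (manifold_diffeology ?A) (src_fibre G x) 1 V"
        and cl: "\<And>u. u \<in> V \<Longrightarrow> c u = tgt G (l u)"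
    unfolding orbit_diffeology_def quotient_diffeology_def by blast
  have lA: "l \<in> manifold_diffeology ?A 1 V" and ls: "\<And>u. u \<in> V \<Longrightarrow> src G (l u) = x"
    using l by (auto simp: subset_diffeology_def src_fibre_def)
  have lp: "l u \<in> points ?A" if "u \<in> V" for u
    using manifold_plot_in[OF lA that] .
  define h where "h = l 0"
  have h: "h \<in> points ?A" "src G h = x" "tgt G h = x"
    using lp ls cl c0 V(2) by (auto simp: h_def)
  \<comment> \<open>The lift starts at some arrow \<open>h\<close> from \<open>x\<close> to
    \<open>x\<close>, not necessarily a unit. Translating by the inverse of \<open>h\<close> times
    \<open>g\<close> brings \<open>h\<close> to \<open>g\<close>.\<close>
  define k where "k = gmult G (ginv G h) g"
  have k: "k \<in> points ?A" "src G k = src G g" "tgt G k = x"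
    using h g by (auto simp: k_def x_def mult_in src_mult tgt_mult inv_in src_inv tgt_inv)
  define \<gamma> where "\<gamma> = (\<lambda>u\<in>V. gmult G (l u) k)"
  have \<gamma>: "\<gamma> \<in> manifold_diffeology ?A 1 V"
    unfolding \<gamma>_def using ls k by (intro mult_plot[OF lA]) auto
  have s: "src G (\<gamma> u) = src G g" and t: "tgt G (\<gamma> u) = c u" if "u \<in> V" for u
    using that ls k lp cl by (auto simp: \<gamma>_def src_mult tgt_mult)
  have "\<gamma> 0 = gmult G (gmult G h (ginv G h)) g"
    using V(2) h g mult_assoc[of h "ginv G h" g]
      by (simp add: \<gamma>_def k_def x_def inv_in src_inv tgt_inv flip: h_def)
  also have "\<dots> = g"
    using mult_inv_right[OF h(1)] mult_unit_left[OF g] h(3) by (simp add: x_def)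
  finally have \<gamma>0: "\<gamma> 0 = g" .
  have "T_tgt G g (plot_tangent ?A 1 \<gamma> 0 unit_velocity) =
      plot_tangent ?B 1 (compose V (tgt G) \<gamma>) 0 unit_velocity"
    using tangent_map_plot_tangent[OF arrows_manifold base_manifold tgt_smooth \<gamma> V(2), of
        unit_velocity] \<gamma>0 by simp
  also have "\<dots> = v"
    unfolding vc by (rule plot_tangent_cong[OF V]) (simp add: compose_def t)
  finally show ?thesis
    using src_kernel_velocity[OF \<gamma> V(2) s, of unit_velocity] \<gamma>0 by force
qed

text \<open>Used at units to see that \<open>TF\<close> is a linear subspace, and at an arbitrary
  arrow to compute the rank there.\<close>

lemma TF_eq: "g \<in> points (arrows G) \<Longrightarrow> TF G (tgt G g) = T_tgt G g ` src_kernel g"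
  using T_tgt_src_kernel_in_TF TF_in_T_tgt_src_kernel by blast

lemma subspace_src_kernel: "subspace (src_kernel g)"
proof -
  have "src_kernel g = tangent_space (arrows G) g \<inter> {\<xi>. T_src G g \<xi> = 0}"
    by (auto simp: src_kernel_def)
  then show ?thesis
    using subspace_inter[OF subspace_tangent_space linear_subspace_kernel[OF linear_tangent_map]]
      by simp
qed

lemma subspace_TF: "x \<in> points (base G) \<Longrightarrow> subspace (TF G x)"
  using TF_eq[OF unit_in] linear_subspace_image[OF linear_tangent_map subspace_src_kernel]
    by (simp add: tgt_unit)

lemma TF_subset:
  assumes x: "x \<in> points (base G)"
  shows "TF G x \<subseteq> tangent_space (base G) x"
proof -
  have "T_tgt G (gunit G x) ` src_kernel (gunit G x) \<subseteq> tangent_space (base G) (tgt G (gunit G x))"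
    using tangent_map_in[OF arrows_manifold base_manifold tgt_smooth unit_in[OF x]]
      by (auto simp: src_kernel_def)
  then show ?thesis
    using TF_eq[OF unit_in[OF x]] tgt_unit[OF x] by simp
qed

text \<open>Rank-nullity for the second projection on the image of the differential of (t,s). The
  projection is onto the tangent space at the source by submersivity, and its kernel consists of the
  pairs (Tt \<xi>, 0) with \<xi> in the kernel of Ts.\<close>

lemma anchor_rank_eq:
  assumes g: "g \<in> points (arrows G)"
  shows "anchor_rank G g = dim (Rn (mdim (base G))) + dim (TF G (tgt G g))"
proof -
  let ?T = "tangent_space (arrows G) g"
  let ?a = "\<lambda>\<xi>. (T_tgt G g \<xi>, T_src G g \<xi>)"
  have a: "linear ?a"
    using linear_tangent_map[of "arrows G" "base G"]
      by (intro linearI) (simp_all add: linear_add linear_cmul)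
  have S: "subspace (?a ` ?T)" "finite_span (?a ` ?T)"
    using linear_subspace_image[OF a subspace_tangent_space]
        finite_span_image[OF a finite_span_tangent_space[OF arrows_manifold g]] by auto
  have "anchor_rank G g = dim (snd ` ?a ` ?T) + dim {z \<in> ?a ` ?T. snd z = 0}"
    unfolding anchor_rank_def by (rule dim_image_plus_dim_kernel[OF linear_snd_prod S])
  also have "snd ` ?a ` ?T = tangent_space (base G) (src G g)"
    using src_submersion[OF g] by (simp add: image_image)
  also have "{z \<in> ?a ` ?T. snd z = 0} = (\<lambda>v. (v, 0)) ` TF G (tgt G g)"
    by (auto simp: TF_eq[OF g] src_kernel_def image_iff)
  also have "dim ((\<lambda>v. (v, 0::'m tvec)) ` TF G (tgt G g)) = dim (TF G (tgt G g))"
    using tgt_in[OF g] finite_span_subset[OF finite_span_tangent_space[OF base_manifold] TF_subset]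
    by (intro dim_linear_image_inj[OF linear_Pair0 subspace_TF]) (auto simp: zero_prod_def)
  finally show ?thesis
    using dim_tangent_space[OF base_manifold src_in[OF g]] by simp
qed

end

section \<open>Regularity\<close>

context lie_groupoid
begin

text \<open>The hypotheses make \<open>u\<close> the orthogonal part of \<open>v\<close>. The
  representative \<open>w\<close> picked in \<open>eta_N\<close> differs from \<open>v\<close> by an
  element of \<open>TF G x\<close>, so it has the same orthogonal part.\<close>

lemma eta_N_class:
  assumes x: "x \<in> points (base G)" and \<eta>: "riemannian_metric (base G) \<eta>"
    and v: "v \<in> tangent_space (base G) x"
    and u: "u \<in> tangent_space (base G) x" "\<And>a. a \<in> TF G x \<Longrightarrow> \<eta> x u a = 0" "v - u \<in> TF G x"
  shows "eta_N G \<eta> (x, normal_class G x v, normal_class G x v) = \<eta> x u u"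
proof -
  let ?T = "tangent_space (base G) x"
  define w where "w = (SOME w. w \<in> normal_class G x v)"
  have "v \<in> normal_class G x v"
    using v subspace_0[OF subspace_TF[OF x]] by (simp add: normal_class_def)
  then have "w \<in> normal_class G x v"
    unfolding w_def by (rule someI[of "\<lambda>w. w \<in> normal_class G x v"])
  then have w: "w \<in> ?T" "w - v \<in> TF G x"
    by (auto simp: normal_class_def)
  have pos: "\<And>a. a \<in> ?T \<Longrightarrow> a \<noteq> 0 \<Longrightarrow> \<eta> x a a > 0" and bil: "bilinear_form_on ?T (\<eta> x)"
    and sym: "symmetric_form_on ?T (\<eta> x)"
    using \<eta> x by (auto simp: riemannian_metric_def)
  have "w - u = (w - v) + (v - u)"
    by simp
  then have "w - u \<in> TF G x"
    using subspace_add[OF subspace_TF[OF x] w(2) u(3)] by metis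
  then have "perp G \<eta> x w = u"
    unfolding perp_def
    using u(1,2) finite_span_subset[OF finite_span_tangent_space[OF base_manifold x] TF_subset[OF x]]
    by (intro the1_equality
        orthogonal_decomposition[OF subspace_tangent_space bil sym pos subspace_TF[OF x]
            _ TF_subset[OF x] w(1)]) auto
  then show ?thesis
    by (simp add: eta_N_def flip: w_def)
qed

text \<open>Pulling everything back by the inverse chart \<open>p\<close> puts the forms at
  different points on one and the same R^n, where they can be compared: \<open>A\<close> is the
  metric of the base, \<open>B\<close> that of the orbit space, and \<open>E\<close> the
  foliation.\<close>

lemma dim_TF_locally_constant:
  assumes \<eta>: "riemannian_metric (base G) \<eta>" and ind: "induces G \<eta> q" and x0: "x0 \<in> points (base G)"
  obtains W where "openin (mtop (base G)) W" "x0 \<in> W" "\<And>x. x \<in> W \<Longrightarrow> dim (TF G x) = dim (TF G x0)"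
proof -
  let ?B = "base G" and ?m = "mdim (base G)"
  obtain l where wrm: "weak_riemannian_metric (orbit_space_diffeology G) q" and l: "is_lambda G l"
    and ql: "\<And>X. X \<in> N2F G \<Longrightarrow> q (l X) = eta_N G \<eta> X"
    using ind by (auto simp: induces_def)
  obtain c where c: "c \<in> charts_at ?B x0"
    using charts_at_nonempty[OF base_manifold x0] by blast
  have c': "c \<in> atlas ?B" "x0 \<in> fst c"
    using c by (auto simp: charts_at_def)
  define U where "U = snd c ` fst c"
  define p where "p = chart_inv c"
  define t where "t = plot_tangent ?B ?m p"
  have ci: "p (snd c x) = x" if "x \<in> fst c" for x
    using chart_inv_chart[OF base_manifold c'(1) that] by (simp add: p_def)
  have p: "p \<in> manifold_diffeology ?B ?m U"
    using chart_inv_plot[OF base_manifold c'(1)] by (simp add: U_def p_def)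
  have U: "openin (Euclidean_space ?m) U"
    using manifold_plot_open[OF p] .
  have pB: "p r \<in> points ?B" if "r \<in> U" for r
    using manifold_plot_in[OF p that] .
  have cp: "c \<in> charts_at ?B (p r)" "snd c (p r) = r" if "r \<in> U" for r
    using that ci c'(1) by (auto simp: U_def charts_at_def)
  have tT: "t r v \<in> tangent_space ?B (p r)" if "r \<in> U" for r v
    unfolding t_def using plot_tangent_in[OF base_manifold p that] .
  have t_inj: "v = 0" if "r \<in> U" "v \<in> Rn ?m" "t r v = 0" for r v
    using plot_tangent_chart_inv_inj[OF base_manifold cp(1)[OF that(1)] that(2)] that(1,3)
        cp(2)[OF that(1)]
    by (simp add: t_def p_def)
  have t_image: "tangent_space ?B (p r) = t r ` Rn ?m" if "r \<in> U" for r
    using tangent_space_eq_image[OF base_manifold cp(1)[OF that]] cp(2)[OF that]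
      by (simp add: t_def p_def)
  have lin: "linear (t r)" for r
    unfolding t_def by (rule linear_plot_tangent)
  define A where "A r v w = \<eta> (p r) (t r v) (t r w)" for r v w
  have tensor: "covariant_2_tensor ?m U A"
    using \<eta>[unfolded riemannian_metric_def, THEN conjunct2, rule_format, OF p]
      unfolding A_def[abs_def] t_def .
  have \<eta>x: "symmetric_form_on (tangent_space ?B x) (\<eta> x)" "\<And>v. v \<in> tangent_space ?B x \<Longrightarrow> v \<noteq> 0 \<Longrightarrow>
      \<eta> x v v > 0"
    if "x \<in> points ?B" for x
    using \<eta> that by (auto simp: riemannian_metric_def)
  have A1: "bilinear_form_on (Rn ?m) (A r)" if "r \<in> U" for r
    using tensor that by (simp add: covariant_2_tensor_def)
  have A2: "symmetric_form_on (Rn ?m) (A r)" if "r \<in> U" for r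
    using \<eta>x(1)[OF pB[OF that]] tT[OF that] by (simp add: symmetric_form_on_def A_def)
  have A3: "A r v v > 0" if "r \<in> U" "v \<in> Rn ?m" "v \<noteq> 0" for r v
    using \<eta>x(2)[OF pB[OF that(1)] tT[OF that(1)]] t_inj[OF that(1,2)] that(3) by (auto simp: A_def)
  have A4: "continuous_on U (\<lambda>r. A r v w)" if "v \<in> Rn ?m" "w \<in> Rn ?m" for v w
    using tensor that by (intro smooth_on_continuous_on[of ?m]) (simp add: covariant_2_tensor_def)
  define \<pi>p where "\<pi>p = compose U (orbit G) p"
  \<comment> \<open>The plot \<open>p\<close> of the base is a lift on all of
    \<open>U\<close>.\<close>
  have \<pi>p: "\<pi>p \<in> orbit_space_diffeology G ?m U"
    unfolding orbit_space_diffeology_def quotient_diffeology_def using U p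
    by (auto simp: \<pi>p_def compose_def intro!: exI[of _ U] bexI[of _ p])
  define B where "B r v w = q (T2_class (orbit_space_diffeology G) (?m, U, \<pi>p) r v w)" for r v w
  \<comment> \<open>A weak Riemannian metric pulls back along this plot to a smooth tensor; the
    continuity of \<eta>N in the chart comes from here.\<close>
  have Bt: "covariant_2_tensor ?m U B" "\<And>r. r \<in> U \<Longrightarrow> symmetric_form_on (Rn ?m) (B r)"
    using wrm \<pi>p unfolding weak_riemannian_metric_def Let_def B_def[abs_def] by blast+
  have B1: "bilinear_form_on (Rn ?m) (B r)" if "r \<in> U" for r
    using Bt(1) that by (simp add: covariant_2_tensor_def)
  have B3: "continuous_on U (\<lambda>r. B r v w)" if "v \<in> Rn ?m" "w \<in> Rn ?m" for v w
    using Bt(1) that by (intro smooth_on_continuous_on[of ?m]) (simp add: covariant_2_tensor_def)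
  define E where "E r = {v\<in>Rn ?m. t r v \<in> TF G (p r)}" for r
  have E1: "subspace (E r)" if "r \<in> U" for r
  proof -
    have "E r = Rn ?m \<inter> t r -` TF G (p r)"
      by (auto simp: E_def)
    then show ?thesis
      using subspace_inter[OF subspace_Rn
          linear_subspace_vimage[OF lin subspace_TF[OF pB[OF that]]]] by simp
  qed
  have E2: "E r \<subseteq> Rn ?m" for r
    by (auto simp: E_def)
  have E_image: "t r ` E r = TF G (p r)" if "r \<in> U" for r
    using TF_subset[OF pB[OF that]] t_image[OF that] by (auto simp: E_def)
  have dimE: "dim (E r) = dim (TF G (p r))" if "r \<in> U" for r
    using dim_linear_image_inj[OF lin E1[OF that] finite_span_subset[OF finite_span_Rn E2], of r]
        t_inj[OF that] E2 E_image[OF that]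
    by (metis subsetD)
  \<comment> \<open>The defining property of \<lambda> at the plot \<open>p\<close> turns the class
    inside \<open>B\<close> into \<lambda> of a pair of normal classes, where the induced metric
    takes the value of \<open>eta_N\<close>.\<close>
  have BA: "B r v v = A r u u"
    if r: "r \<in> U" and v: "v \<in> Rn ?m" and u: "u \<in> Rn ?m" "\<forall>a\<in>E r. A r u a = 0" "v - u \<in> E r" for r v u
  proof -
    have "normal_class G (p r) (t r v) \<in> normal_space G (p r)"
      using tT[OF r] by (simp add: normal_space_def)
    then have N: "(p r, normal_class G (p r) (t r v), normal_class G (p r) (t r v)) \<in> N2F G"
      using pB[OF r] by (simp add: N2F_def)
    have "B r v v = q (l (p r, normal_class G (p r) (t r v), normal_class G (p r) (t r v)))"
      using l p r v unfolding is_lambda_def t_def B_def \<pi>p_def by simp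
    also have "\<dots> = eta_N G \<eta> (p r, normal_class G (p r) (t r v), normal_class G (p r) (t r v))"
      by (rule ql[OF N])
    also have "\<dots> = \<eta> (p r) (t r u) (t r u)"
    proof (rule eta_N_class[OF pB[OF r] \<eta> tT[OF r] tT[OF r]])
      show "\<eta> (p r) (t r u) a = 0" if "a \<in> TF G (p r)" for a
        using that u(2) unfolding E_image[OF r, symmetric] A_def by blast
      show "t r v - t r u \<in> TF G (p r)"
        using u(3) by (simp add: E_def linear_diff[OF lin])
    qed
    finally show ?thesis
      by (simp add: A_def)
  qed
  have r0: "snd c x0 \<in> U"
    using c'(2) by (simp add: U_def)
  obtain N where N: "openin (Euclidean_space ?m) N" "snd c x0 \<in> N" "N \<subseteq> U"
    "\<And>r. r \<in> N \<Longrightarrow> dim (E r) = dim (E (snd c x0))"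
    using dim_kernel_locally_constant[of ?m U
        "snd c x0" ?m A B E, OF U r0 A1 A2 A3 A4 B1 Bt(2) B3 E1 E2 BA] by blast
  \<comment> \<open>The neighbourhood found in coordinates, carried back to the base.\<close>
  define W where "W = {x \<in> fst c. snd c x \<in> N}"
  let ?X = "subtopology (mtop ?B) (fst c)"
  have oc: "openin (mtop ?B) (fst c)"
    using smooth_manifold_open_chart[OF base_manifold c'(1)] .
  have "continuous_map ?X (Euclidean_space ?m) (snd c)"
    using homeomorphic_imp_continuous_map[OF smooth_manifold_homeo[OF base_manifold c'(1)]]
      continuous_map_into_fulltopology by blast
  from openin_continuous_map_preimage[OF this N(1)]
  have "openin ?X {x \<in> topspace ?X. snd c x \<in> N}" .
  moreover have "topspace ?X = fst c"
    using openin_subset[OF oc] by auto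
  ultimately have "openin ?X W"
    by (simp only: W_def)
  then have "openin (mtop ?B) W"
    using openin_open_subtopology[OF oc] by blast
  moreover have "dim (TF G x) = dim (TF G x0)" if "x \<in> W" for x
    using that N(4)[of "snd c x"] dimE[of "snd c x"] dimE[OF r0] N(3) ci[of x] ci[OF c'(2)]
      by (auto simp: W_def)
  moreover have "x0 \<in> W"
    using N(2) c'(2) by (simp add: W_def)
  ultimately show thesis
    using that[of W] by blast
qed

end

text \<open>A set defined by a condition on \<open>f z\<close> contains, with each point, a
  neighbourhood on which \<open>f\<close> is constant. So both it and its complement are open,
  whatever the type of the values.\<close>

lemma connected_space_locally_constant:
  assumes X: "connected_space X"
      and loc: "\<And>x. x \<in> topspace X \<Longrightarrow> \<exists>U. openin X U \<and> x \<in> U \<and> (\<forall>y\<in>U. f y = f x)"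
    and xy: "x \<in> topspace X" "y \<in> topspace X"
  shows "f y = f x"
proof (rule ccontr)
  assume ne: "f y \<noteq> f x"
  let ?S = "{z \<in> topspace X. f z = f x}" and ?T = "{z \<in> topspace X. f z \<noteq> f x}"
  have *: "openin X {z \<in> topspace X. P (f z)}" for P
  proof (subst openin_subopen, rule ballI)
    fix z assume z: "z \<in> {z \<in> topspace X. P (f z)}"
    then have zX: "z \<in> topspace X" "P (f z)"
      by auto
    obtain U where U: "openin X U" "z \<in> U" "\<forall>y\<in>U. f y = f z"
      using loc[OF zX(1)] by blast
    have "U \<subseteq> {z \<in> topspace X. P (f z)}"
      using zX(2) U(3) openin_subset[OF U(1)] by force
    with U show "\<exists>T. openin X T \<and> z \<in> T \<and> T \<subseteq> {z \<in> topspace X. P (f z)}"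
      by blast
  qed
  have "openin X ?S" "openin X ?T"
    by (rule *[of "\<lambda>a. a = f x"], rule *[of "\<lambda>a. a \<noteq> f x"])
  moreover have "topspace X \<subseteq> ?S \<union> ?T" "?S \<inter> ?T = {}" "?S \<noteq> {}" "?T \<noteq> {}"
    using xy ne by auto
  ultimately show False
    using X unfolding connected_space_def by blast
qed

theorem proposition4p8:
  fixes G :: "('g, 'm) groupoid"
    and \<eta> :: "'m \<Rightarrow> 'm tvec \<Rightarrow> 'm tvec \<Rightarrow> real"
  assumes "lie_groupoid G"
    and "connected_space (mtop (base G))"
    and "zero_metric G \<eta>"
    and "\<exists>g. induces G \<eta> g"
  shows "regular_groupoid G"
proof -
  interpret lie_groupoid G
    by fact
  obtain q where q: "induces G \<eta> q"
    using assms(4) by blast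
  have \<eta>: "riemannian_metric (base G) \<eta>"
    using assms(3) by (simp add: zero_metric_def)
  have "\<exists>W. openin (mtop (base G)) W \<and> x \<in> W \<and> (\<forall>y\<in>W. dim (TF G y) = dim (TF G x))"
    if "x \<in> points (base G)" for x
    using dim_TF_locally_constant[OF \<eta> q that] by metis
  then have const: "dim (TF G y) = dim (TF G x)" if "x \<in> points (base G)" "y \<in> points (base G)" for x y
    using connected_space_locally_constant[OF assms(2), of "\<lambda>x. dim (TF G x)"] that by blast
  show ?thesis
  proof (cases "points (base G) = {}")
    \<comment> \<open>Without objects there are no arrows, and any number serves as the
      rank.\<close>
    case True
    then show ?thesis
      unfolding regular_groupoid_def using src_in by blast
  next
    case False
    then obtain x where "x \<in> points (base G)"
      by blast
    then have "anchor_rank G g = dim (Rn (mdim (base G))) + dim (TF G x)" if "g \<in> points (arrows G)"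
        for g
      using anchor_rank_eq[OF that] const[OF _ tgt_in[OF that]] by simp
    then show ?thesis
      unfolding regular_groupoid_def by blast
  qed
qed

end
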